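(* Testing isomorphism of two finite groups $G$ and $H$ of order $n$ (given by their multiplication tables) is $n^{(1/2)\log_p n + O(1)}$ time Turing reducible to testing isomorphism of composition series for $G$ and $H$, where $p$ is the smallest prime dividing the order of the group. That is, there is an algorithm with access to an oracle deciding whether a given composition series for $G$ is isomorphic to a given composition series for $H$, which decides whether $G \cong H$ in time $n^{(1/2)\log_p n + O(1)}$.
   Context: Groups are given as multiplication tables on the element set $[n]=\{1,\dots,n\}$. A subnormal series of a group $G$ is a tower of subgroups $G_0 = 1 \triangleleft G_1 \triangleleft \cdots \triangleleft G_m = G$; a composition series is a maximal subnormal series. Two composition series $G_0 = 1 \triangleleft \cdots \triangleleft G_m = G$ and $H_0 = 1 \triangleleft \cdots \triangleleft H_{m'} = H$ are isomorphic if there is a group isomorphism $\phi : G \to H$ such that $\phi[G_i] = H_i$ for each $i$ (in particular $m=m'$). Constants hidden in $O(\cdot)$ are absolute. *)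

theory Defs
  imports Complex_Main "HOL-Algebra.Algebra"
begin

section \<open>Composition series\<close>

definition subnormal_series :: "('a, 'b) monoid_scheme \<Rightarrow> 'a set list \<Rightarrow> bool" where
  "subnormal_series G Gs \<longleftrightarrow>
     Gs \<noteq> [] \<and> hd Gs = {\<one>\<^bsub>G\<^esub>} \<and> last Gs = carrier G \<and>
     (\<forall>A \<in> set Gs. subgroup A G) \<and>
     (\<forall>i. Suc i < length Gs \<longrightarrow> Gs ! i \<lhd> G\<lparr>carrier := Gs ! Suc i\<rparr>)"

text \<open>
  Maximality refers to series without repetitions (otherwise every series could be prolonged by
  repeating a term).  The terms of a series form a chain, so a repetition-free series is
  determined by its set of terms, and proper refinement is proper inclusion of these sets.
\<close>

definition composition_series :: "('a, 'b) monoid_scheme \<Rightarrow> 'a set list \<Rightarrow> bool" where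
  "composition_series G Gs \<longleftrightarrow>
     subnormal_series G Gs \<and> distinct Gs \<and>
     \<not> (\<exists>Hs. subnormal_series G Hs \<and> distinct Hs \<and> set Gs \<subset> set Hs)"

definition series_isomorphic ::
  "('a, 'c) monoid_scheme \<Rightarrow> 'a set list \<Rightarrow> ('b, 'd) monoid_scheme \<Rightarrow> 'b set list \<Rightarrow> bool" where
  "series_isomorphic G Gs H Hs \<longleftrightarrow>
     (\<exists>\<phi> \<in> iso G H. length Gs = length Hs \<and> (\<forall>i < length Gs. \<phi> ` (Gs ! i) = Hs ! i))"

section \<open>Groups given by multiplication tables\<close>

text \<open>
  Only the values \<open>m x y\<close> with \<open>x, y \<in> {1..n}\<close> matter.  A table does not name
  the identity, so it is recovered from the multiplication; the table is that of a group iff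
  \<open>group (table_group n m)\<close> holds.
\<close>

definition table_group :: "nat \<Rightarrow> (nat \<Rightarrow> nat \<Rightarrow> nat) \<Rightarrow> nat monoid" where
  "table_group n m =
     \<lparr>carrier = {1..n}, monoid.mult = m,
      one = (THE e. e \<in> {1..n} \<and> (\<forall>x \<in> {1..n}. m e x = x \<and> m x e = x))\<rparr>"

definition smallest_prime_divisor :: "nat \<Rightarrow> nat" where
  "smallest_prime_divisor n = (LEAST p. Factorial_Ring.prime p \<and> p dvd n)"

section \<open>Oracle random access machines\<close>

text \<open>
  A successor RAM with structured control flow and unit costs: finitely many registers named by
  the program, and an indirectly addressed memory, all holding natural numbers.  The only
  arithmetic is increment and decrement, so within \<open>t\<close> steps no value exceeds the largest
  input or program constant by more than \<open>t\<close>; hence unit cost differs from logarithmic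
  cost by a factor logarithmic in the running time and the input only.

  \<open>Query v a l\<close> asks the oracle about the word of length \<open>l\<close> stored in memory from
  address \<open>a\<close> on, charges for the length of the word, and puts the answer into \<open>v\<close>.
\<close>

datatype test = Less nat nat | Equal nat nat

datatype cmd =
    Skip
  | Const nat nat
  | Copy nat nat
  | Incr nat
  | Decr nat
  | Load nat nat   \<comment> \<open>\<open>Load v a\<close>: register \<open>v\<close> gets memory cell (register \<open>a\<close>)\<close>
  | Store nat nat  \<comment> \<open>\<open>Store a v\<close>: memory cell (register \<open>a\<close>) gets register \<open>v\<close>\<close>
  | Query nat nat nat
  | Seq cmd cmd
  | Cond test cmd cmd
  | While test cmd

type_synonym state = "(nat \<Rightarrow> nat) \<times> (nat \<Rightarrow> nat)"  \<comment> \<open>registers, memory\<close>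

fun holds :: "test \<Rightarrow> (nat \<Rightarrow> nat) \<Rightarrow> bool" where
  "holds (Less v w) r \<longleftrightarrow> r v < r w"
| "holds (Equal v w) r \<longleftrightarrow> r v = r w"

text \<open>\<open>exec Q c s t s'\<close>: with oracle \<open>Q\<close>, \<open>c\<close> started in \<open>s\<close> halts in \<open>s'\<close> after \<open>t\<close> steps.\<close>

inductive exec :: "(nat list \<Rightarrow> bool) \<Rightarrow> cmd \<Rightarrow> state \<Rightarrow> nat \<Rightarrow> state \<Rightarrow> bool"
  for Q :: "nat list \<Rightarrow> bool" where
  Skip: "exec Q Skip s 1 s"
| Const: "exec Q (Const v k) (r, m) 1 (r(v := k), m)"
| Copy: "exec Q (Copy v w) (r, m) 1 (r(v := r w), m)"
| Incr: "exec Q (Incr v) (r, m) 1 (r(v := r v + 1), m)"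
| Decr: "exec Q (Decr v) (r, m) 1 (r(v := r v - 1), m)"
| Load: "exec Q (Load v a) (r, m) 1 (r(v := m (r a)), m)"
| Store: "exec Q (Store a v) (r, m) 1 (r, m(r a := r v))"
| Query: "exec Q (Query v a l) (r, m) (1 + r l)
            (r(v := (if Q (map m [r a..<r a + r l]) then 1 else 0)), m)"
| Seq: "exec Q c s t s' \<Longrightarrow> exec Q d s' u s'' \<Longrightarrow> exec Q (Seq c d) s (t + u) s''"
| CondTrue: "holds b (fst s) \<Longrightarrow> exec Q c s t s' \<Longrightarrow> exec Q (Cond b c d) s (1 + t) s'"
| CondFalse: "\<not> holds b (fst s) \<Longrightarrow> exec Q d s t s' \<Longrightarrow> exec Q (Cond b c d) s (1 + t) s'"
| WhileFalse: "\<not> holds b (fst s) \<Longrightarrow> exec Q (While b c) s 1 s"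
| WhileTrue: "holds b (fst s) \<Longrightarrow> exec Q c s t s' \<Longrightarrow> exec Q (While b c) s' u s'' \<Longrightarrow>
                exec Q (While b c) s (1 + t + u) s''"

lemma exec_deterministic:
  assumes "exec Q c s t s'" and "exec Q c s t2 s2"
  shows "t = t2 \<and> s' = s2"
  using assms
proof (induction arbitrary: t2 s2 rule: exec.induct)
  case (Seq c s t s' d u s'')
  from Seq.prems show ?case by (cases rule: exec.cases) (blast dest: Seq.IH)
next
  case (CondTrue b s c t s' d)
  from CondTrue.prems CondTrue.hyps show ?case
    by (cases rule: exec.cases) (auto dest: CondTrue.IH)
next
  case (CondFalse b s d t s' c)
  from CondFalse.prems CondFalse.hyps show ?case
    by (cases rule: exec.cases) (auto dest: CondFalse.IH)
next
  case (WhileTrue b s c t s' u s'')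
  from WhileTrue.prems show ?case
    using WhileTrue.hyps(1) by (cases rule: exec.cases) (blast dest: WhileTrue.IH)+
qed (erule exec.cases; simp; fail)+

text \<open>The input word is placed at the start of memory; the answer is read off register 0.\<close>

definition initial_state :: "nat list \<Rightarrow> state" where
  "initial_state xs = ((\<lambda>_. 0), (\<lambda>i. if i < length xs then xs ! i else 0))"

definition decides_in_time :: "(nat list \<Rightarrow> bool) \<Rightarrow> cmd \<Rightarrow> nat list \<Rightarrow> bool \<Rightarrow> nat \<Rightarrow> bool" where
  "decides_in_time Q c xs answer t \<longleftrightarrow>
     (\<exists>s. exec Q c (initial_state xs) t s \<and> fst s 0 = (if answer then 1 else 0))"

section \<open>Encodings\<close>

definition encode_table :: "nat \<Rightarrow> (nat \<Rightarrow> nat \<Rightarrow> nat) \<Rightarrow> nat list" where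
  "encode_table n m = concat (map (\<lambda>x. map (m x) [1..<n + 1]) [1..<n + 1])"

definition encode_groups :: "nat \<Rightarrow> (nat \<Rightarrow> nat \<Rightarrow> nat) \<Rightarrow> (nat \<Rightarrow> nat \<Rightarrow> nat) \<Rightarrow> nat list" where
  "encode_groups n G H = n # encode_table n G @ encode_table n H"

text \<open>A series is encoded by its length, followed by the characteristic vectors of its terms.\<close>

definition encode_series :: "nat \<Rightarrow> nat set list \<Rightarrow> nat list" where
  "encode_series n Gs =
     length Gs # concat (map (\<lambda>A. map (\<lambda>x. if x \<in> A then 1 else 0) [1..<n + 1]) Gs)"

definition encode_series_query ::
  "nat \<Rightarrow> (nat \<Rightarrow> nat \<Rightarrow> nat) \<Rightarrow> nat set list \<Rightarrow> (nat \<Rightarrow> nat \<Rightarrow> nat) \<Rightarrow> nat set list \<Rightarrow> nat list" where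
  "encode_series_query n G Gs H Hs =
     encode_groups n G H @ encode_series n Gs @ encode_series n Hs"

text \<open>
  Nothing is required of the oracle on words that do not encode a pair consisting of a
  composition series of \<open>G\<close> and one of \<open>H\<close>.
\<close>

definition decides_series_isomorphism ::
  "(nat list \<Rightarrow> bool) \<Rightarrow> nat \<Rightarrow> (nat \<Rightarrow> nat \<Rightarrow> nat) \<Rightarrow> (nat \<Rightarrow> nat \<Rightarrow> nat) \<Rightarrow> bool" where
  "decides_series_isomorphism Q n G H \<longleftrightarrow>
     (\<forall>Gs Hs. composition_series (table_group n G) Gs \<and> composition_series (table_group n H) Hs \<longrightarrow>
        (Q (encode_series_query n G Gs H Hs) \<longleftrightarrow>
           series_isomorphic (table_group n G) Gs (table_group n H) Hs))"

end

theory Submission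
  imports Defs
begin

text \<open>
  Fix one composition series of \<open>G\<close> and compare it, by means of the oracle, with all composition series of \<open>H\<close>.
  The term following \<open>K\<close> in a composition series is the least subnormal subgroup containing \<open>K\<close> and \<open>x\<close>, for
  each of its elements \<open>x\<close> outside \<open>K\<close>.  This subnormal closure is computed in polynomial time by iterating
  normal closures, starting with the whole group.  Different candidates for the next term meet in
  \<open>K\<close>, and each has at least \<open>card K\<close> elements outside \<open>K\<close>, so there are at most \<open>n / card K\<close> of them.  As the order of
  the \<open>i\<close>-th term is at least \<open>p ^ i\<close>, a depth-first search visits at most
  \<open>n ^ O(1)\<close> times the product of the \<open>n / p ^ i\<close> with \<open>p ^ i \<le> n\<close>, hence \<open>n ^ (log p n / 2 + O(1))\<close> nodes.
\<close>

section \<open>A language of polynomial time blocks\<close>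

text \<open>An isomorphism carries the fixed series of \<open>G\<close> to some composition series
  of \<open>H\<close>, so a single series of \<open>G\<close> is enough. The oracle promises nothing
  on other words, hence each series queried must be a genuine composition series. The program tests
  neither normality nor maximality: both follow from minimality of the next subnormal subgroup.
  Different generators may yield the same next term; demanding the least one removes repetitions
  without storing the terms already tried. With L = log_p n the branching numbers multiply to about
  p to the power L + (L - 1) + ..., that is n to the power L / 2, and rounding L up to an integer
  costs only a constant in the exponent. The machine can merely increment and decrement. Therefore
  the polynomial parts are written in a small language whose compiled code has a time bound computed
  from the syntax, while a search, whose length need not be polynomial, is a plain
  \<open>While\<close> loop around one such block, with an explicit stack in place of
  recursion.\<close>

datatype expr = V nat | N nat | Mem expr | Plus expr expr | Minus expr expr | Times expr expr | Lt expr expr | Exi nat expr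

text \<open>
  A truth value is a number, \<open>0\<close> being false.  The bounded quantifier \<open>Exi v e\<close> lets register \<open>v\<close> range over
  \<open>{1..n}\<close>, where \<open>n\<close> is kept in register 1; the machine code restores \<open>v\<close> afterwards.
\<close>

primrec val :: "expr \<Rightarrow> (nat \<Rightarrow> nat) \<Rightarrow> (nat \<Rightarrow> nat) \<Rightarrow> nat" where
  "val (V v) r m = r v"
| "val (N c) r m = c"
| "val (Mem e) r m = m (val e r m)"
| "val (Plus a b) r m = val a r m + val b r m"
| "val (Minus a b) r m = val a r m - val b r m"
| "val (Times a b) r m = val a r m * val b r m"
| "val (Lt a b) r m = (if val a r m < val b r m then 1 else 0)"
| "val (Exi v e) r m = (if \<exists>x \<in> {1..r 1}. val e (r(v := x)) m \<noteq> 0 then 1 else 0)"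

text \<open>The value is left in register \<open>d\<close>; registers above \<open>d\<close> are scratch space.\<close>

primrec compile_expr :: "nat \<Rightarrow> expr \<Rightarrow> cmd" where
  "compile_expr d (V v) = Copy d v"
| "compile_expr d (N c) = Const d c"
| "compile_expr d (Mem e) = Seq (compile_expr d e) (Load d d)"
| "compile_expr d (Plus a b) = Seq (compile_expr d a) (Seq (compile_expr (d + 1) b) (Seq (Const (d + 2) 0)
     (While (Less (d + 2) (d + 1)) (Seq (Incr d) (Incr (d + 2))))))"
| "compile_expr d (Minus a b) = Seq (compile_expr d a) (Seq (compile_expr (d + 1) b) (Seq (Const (d + 2) 0)
     (While (Less (d + 2) (d + 1)) (Seq (Decr d) (Incr (d + 2))))))"
| "compile_expr d (Times a b) = Seq (compile_expr (d + 1) a) (Seq (compile_expr (d + 2) b) (Seq (Const d 0) (Seq (Const (d + 3) 0)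
     (While (Less (d + 3) (d + 2))
       (Seq (Const (d + 4) 0)
         (Seq (While (Less (d + 4) (d + 1)) (Seq (Incr d) (Incr (d + 4)))) (Incr (d + 3))))))))"
| "compile_expr d (Lt a b) = Seq (compile_expr d a) (Seq (compile_expr (d + 1) b) (Cond (Less d (d + 1)) (Const d 1) (Const d 0)))"
| "compile_expr d (Exi v e) = Seq (Const d 0) (Seq (Copy (d + 1) v) (Seq (Copy (d + 2) 1) (Seq (Const (d + 3) 0)
     (Seq (While (Less (d + 3) (d + 2))
       (Seq (Incr (d + 3)) (Seq (Copy v (d + 3)) (Seq (compile_expr (d + 4) e)
         (Seq (Const (d + 5) 0) (Cond (Less (d + 5) (d + 4)) (Const d 1) Skip))))))
       (Copy v (d + 1))))))"

text \<open>A quantifier also reads register 1, the limit of its range; counting it here puts it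
  among the bounded registers and so limits the number of rounds.\<close>

primrec expr_regs :: "expr \<Rightarrow> nat set" where
  "expr_regs (V v) = {v}"
| "expr_regs (N c) = {}"
| "expr_regs (Mem e) = expr_regs e"
| "expr_regs (Plus a b) = expr_regs a \<union> expr_regs b"
| "expr_regs (Minus a b) = expr_regs a \<union> expr_regs b"
| "expr_regs (Times a b) = expr_regs a \<union> expr_regs b"
| "expr_regs (Lt a b) = expr_regs a \<union> expr_regs b"
| "expr_regs (Exi v e) = insert 1 (insert v (expr_regs e))"

text \<open>
  Running times and values are measured by exponents: with all registers and memory cells bounded by
  \<open>B \<ge> 2\<close>, the value of \<open>e\<close> is at most \<open>B ^ growth e\<close> and its evaluation takes at most \<open>B ^ cost e\<close> steps.
\<close>

primrec growth :: "expr \<Rightarrow> nat" where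
  "growth (V v) = 1"
| "growth (N c) = c"
| "growth (Mem e) = 1"
| "growth (Plus a b) = growth a + growth b + 1"
| "growth (Minus a b) = growth a"
| "growth (Times a b) = growth a + growth b"
| "growth (Lt a b) = 0"
| "growth (Exi v e) = 0"

primrec cost :: "expr \<Rightarrow> nat" where
  "cost (V v) = 0"
| "cost (N c) = 0"
| "cost (Mem e) = cost e + 1"
| "cost (Plus a b) = cost a + cost b + growth b + 3"
| "cost (Minus a b) = cost a + cost b + growth b + 3"
| "cost (Times a b) = cost a + cost b + growth a + growth b + 4"
| "cost (Lt a b) = cost a + cost b + 2"
| "cost (Exi v e) = cost e + 1 + 4"

text \<open>Only registers below \<open>D\<close> are limited: those above are scratch registers of
  compiled code, where intermediate values may exceed \<open>B\<close>.\<close>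

definition bounded :: "nat \<Rightarrow> nat \<Rightarrow> state \<Rightarrow> bool" where
  "bounded D B s \<longleftrightarrow> (\<forall>i<D. fst s i \<le> B) \<and> (\<forall>i. snd s i \<le> B)"

lemma bounded_upd: "bounded D B (r, m) \<Longrightarrow> x \<le> B \<Longrightarrow> bounded D B (r(v := x), m)"
  by (auto simp: bounded_def)

lemma val_le:
  assumes "2 \<le> B"
  shows "expr_regs e \<subseteq> {..<D} \<Longrightarrow> bounded D B (r, m) \<Longrightarrow> val e r m \<le> B ^ growth e"
proof (induction e arbitrary: r)
  case (N c)
  have "c \<le> 2 ^ c" by (simp add: less_imp_le)
  also have "\<dots> \<le> B ^ c" using assms by (simp add: power_mono)
  finally show ?case by simp
next
  case (Plus a b)
  have *: "B ^ i + B ^ j \<le> B ^ (i + j + 1)" for i j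
  proof -
    have "B ^ i + B ^ j \<le> B ^ (i + j) + B ^ (i + j)"
      using assms by (intro add_mono power_increasing) auto
    also have "\<dots> = 2 * B ^ (i + j)" by simp
    also have "\<dots> \<le> B ^ (i + j + 1)" using assms by (simp del: mult_2)
    finally show ?thesis .
  qed
  show ?case
    using Plus.IH[OF _ Plus.prems(2)] Plus.prems(1) *[of "growth a" "growth b"] by simp
next
  case (Times a b)
  then show ?case by (simp add: power_add mult_mono)
next
  case (Minus a b)
  then show ?case by (simp add: le_diff_conv trans_le_add1)
qed (auto simp: bounded_def)

text \<open>The induction is on the number \<open>i\<close> of rounds still to come, since
  \<open>exec\<close> unrolls a loop at its front; \<open>I j\<close> describes the state after
  \<open>j\<close> rounds.\<close>

lemma count_loop:
  assumes "\<And>j s. j < n \<Longrightarrow> I j s \<Longrightarrow> \<exists>t s'. exec Q c s t s' \<and> t \<le> T \<and> I (Suc j) s'"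
    and "\<And>j s. I j s \<Longrightarrow> j \<le> n \<Longrightarrow> holds b (fst s) \<longleftrightarrow> j < n"
    and "I 0 s"
  shows "\<exists>t s'. exec Q (While b c) s t s' \<and> t \<le> n * (T + 1) + 1 \<and> I n s'"
proof -
  have "\<exists>t s'. exec Q (While b c) s t s' \<and> t \<le> i * (T + 1) + 1 \<and> I n s'"
    if "I (n - i) s" "i \<le> n" for i s
    using that
  proof (induction i arbitrary: s)
    case 0
    then have "exec Q (While b c) s 1 s" using assms(2)[of n s] by (intro exec.WhileFalse) auto
    then show ?case using 0 by (intro exI[of _ 1] exI[of _ s]) auto
  next
    case (Suc i)
    obtain t s' where 1: "exec Q c s t s'" "t \<le> T" "I (Suc (n - Suc i)) s'"
      using assms(1)[of "n - Suc i" s] Suc.prems by auto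
    then obtain u s'' where 2: "exec Q (While b c) s' u s''" "u \<le> i * (T + 1) + 1" "I n s''"
      using Suc.IH[of s'] Suc.prems by (auto simp: Suc_diff_Suc)
    have "holds b (fst s)" using assms(2)[OF Suc.prems(1)] Suc.prems(2) by simp
    then have "exec Q (While b c) s (1 + t + u) s''"
      using 1(1) 2(1) by (rule exec.WhileTrue)
    moreover have "1 + t + u \<le> Suc i * (T + 1) + 1" using 1(2) 2(2) by simp
    ultimately show ?case using 2(3) by blast
  qed
  from this[of n s] assms(3) show ?thesis by simp
qed

text \<open>As \<open>B\<close> is at least 2, a constant factor becomes an increase of the
  exponent. The closing numerals in \<open>cost\<close> and \<open>stm_cost\<close> arise in this
  way; for instance a factor 7 gives the 3 of \<open>Plus\<close>.\<close>

lemma le_power_add: "(t::nat) \<le> c * B ^ k \<Longrightarrow> c \<le> 2 ^ j \<Longrightarrow> 2 \<le> B \<Longrightarrow> t \<le> B ^ (k + j)"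
proof -
  assume *: "t \<le> c * B ^ k" "c \<le> 2 ^ j" "2 \<le> B"
  have "c * B ^ k \<le> B ^ j * B ^ k"
    using * by (intro mult_right_mono order_trans[OF *(2)] power_mono) auto
  with *(1) have "t \<le> B ^ j * B ^ k" by (rule order_trans)
  then show ?thesis by (simp add: power_add mult.commute)
qed

text \<open>The machine registers \<open>rl\<close> need to agree with \<open>r\<close> only below
  \<open>D\<close>. Because everything below \<open>d\<close> is preserved, a value kept in register
  \<open>d\<close> survives the evaluation of a second operand from \<open>d + 1\<close> on, and
  nesting needs no stack.\<close>

lemma compile_expr_exec:
  assumes B: "2 \<le> B"
  shows "expr_regs e \<subseteq> {..<D} \<Longrightarrow> D \<le> d \<Longrightarrow> (\<And>i. i < D \<Longrightarrow> rl i = r i) \<Longrightarrow> bounded D B (r, m) \<Longrightarrow>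
    \<exists>t rl'. exec Q (compile_expr d e) (rl, m) t (rl', m) \<and> (\<forall>i<d. rl' i = rl i) \<and> rl' d = val e r m \<and>
            t \<le> B ^ cost e"
proof (induction e arbitrary: d rl r)
  case (V v)
  have "exec Q (compile_expr d (V v)) (rl, m) 1 (rl(d := rl v), m)" unfolding compile_expr.simps by (rule exec.Copy)
  moreover have "1 \<le> B ^ cost (V v)" by simp
  ultimately show ?case using V.prems by (intro exI conjI) (assumption, auto)
next
  case (N c)
  have "exec Q (compile_expr d (N c)) (rl, m) 1 (rl(d := c), m)" unfolding compile_expr.simps by (rule exec.Const)
  moreover have "1 \<le> B ^ cost (N c)" by simp
  ultimately show ?case using N.prems by (intro exI conjI) (assumption, auto)
next
  case (Mem e)
  obtain t rl' where *: "exec Q (compile_expr d e) (rl, m) t (rl', m)" "\<forall>i<d. rl' i = rl i"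
    "rl' d = val e r m" "t \<le> B ^ cost e"
    using Mem.IH[OF _ Mem.prems(2-4)] Mem.prems(1) by (simp, blast)
  have "exec Q (compile_expr d (Mem e)) (rl, m) (t + 1) (rl'(d := m (rl' d)), m)"
    using exec.Seq[OF *(1) exec.Load] by simp
  moreover have "t + 1 \<le> B ^ (cost e + 1)"
  proof (rule le_power_add[where c = 2])
    show "t + 1 \<le> 2 * B ^ cost e" using *(4) one_le_power[of B "cost e"] B by linarith
  qed (use B in auto)
  ultimately show ?case using * by (intro exI conjI) (assumption, auto)
next
  case (Plus a b)
  obtain t1 r1 where 1: "exec Q (compile_expr d a) (rl, m) t1 (r1, m)" "\<forall>i<d. r1 i = rl i"
    "r1 d = val a r m" "t1 \<le> B ^ cost a"
    using Plus.IH(1)[OF _ Plus.prems(2-4)] Plus.prems(1) by (simp, blast)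
  have sub: "expr_regs b \<subseteq> {..<D}" "D \<le> d + 1" using Plus.prems by auto
  have e1: "r1 i = r i" if "i < D" for i using 1(2) Plus.prems(2,3) that by simp
  obtain t2 r2 where 2: "exec Q (compile_expr (d + 1) b) (r1, m) t2 (r2, m)" "\<forall>i<d+1. r2 i = r1 i"
    "r2 (d + 1) = val b r m" "t2 \<le> B ^ cost b"
    using Plus.IH(2)[OF sub e1 Plus.prems(4)] by blast
  define I where "I = (\<lambda>j s. snd s = m \<and> (\<forall>i<d. fst s i = rl i) \<and> fst s d = val a r m + j \<and>
     fst s (d + 1) = val b r m \<and> fst s (d + 2) = j)"
  have "\<exists>t s'. exec Q (While (Less (d + 2) (d + 1)) (Seq (Incr d) (Incr (d + 2)))) (r2(d + 2 := 0), m) t s'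
     \<and> t \<le> val b r m * (2 + 1) + 1 \<and> I (val b r m) s'"
  proof (rule count_loop[where I = I])
    fix j s assume "j < val b r m" "I j s"
    moreover obtain r' m' where s: "s = (r', m')" by (cases s)
    have "exec Q (Seq (Incr d) (Incr (d + 2))) s (1 + 1)
      ((r'(d := r' d + 1))(d + 2 := (r'(d := r' d + 1)) (d + 2) + 1), m')"
      unfolding s by (rule exec.Seq[OF exec.Incr exec.Incr])
    ultimately show "\<exists>t s'. exec Q (Seq (Incr d) (Incr (d + 2))) s t s' \<and> t \<le> 2 \<and> I (Suc j) s'"
      by (intro exI conjI) (assumption, auto simp: s I_def)
  qed (use 1 2 in \<open>auto simp: I_def\<close>)
  then obtain t3 r3 where 3: "exec Q (While (Less (d + 2) (d + 1)) (Seq (Incr d) (Incr (d + 2)))) (r2(d + 2 := 0), m) t3 (r3, m)"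
     "t3 \<le> val b r m * 3 + 1" "I (val b r m) (r3, m)" unfolding I_def by auto
  have "exec Q (compile_expr d (Plus a b)) (rl, m) (t1 + (t2 + (1 + t3))) (r3, m)"
    unfolding compile_expr.simps by (rule exec.Seq[OF 1(1) exec.Seq[OF 2(1) exec.Seq[OF exec.Const 3(1)]]])
  moreover have "t1 + (t2 + (1 + t3)) \<le> B ^ (cost a + cost b + growth b + 3)"
  proof (rule le_power_add[where c = 7])
    have "val b r m \<le> B ^ growth b" using val_le[OF B, of b D] Plus.prems by auto
    moreover have "B ^ growth b \<le> B ^ (cost a + cost b + growth b)" "B ^ cost a \<le> B ^ (cost a + cost b + growth b)"
      "B ^ cost b \<le> B ^ (cost a + cost b + growth b)"  "1 \<le> B ^ (cost a + cost b + growth b)"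
      using B by (auto intro!: power_increasing one_le_power)
    ultimately show "t1 + (t2 + (1 + t3)) \<le> 7 * B ^ (cost a + cost b + growth b)"
      using 1(4) 2(4) 3(2) by linarith
  qed (use B in auto)
  ultimately show ?case using 3(3) unfolding I_def by auto
next
  case (Minus a b)
  obtain t1 r1 where 1: "exec Q (compile_expr d a) (rl, m) t1 (r1, m)" "\<forall>i<d. r1 i = rl i"
    "r1 d = val a r m" "t1 \<le> B ^ cost a"
    using Minus.IH(1)[OF _ Minus.prems(2-4)] Minus.prems(1) by (simp, blast)
  have sub: "expr_regs b \<subseteq> {..<D}" "D \<le> d + 1" using Minus.prems by auto
  have e1: "r1 i = r i" if "i < D" for i using 1(2) Minus.prems(2,3) that by simp
  obtain t2 r2 where 2: "exec Q (compile_expr (d + 1) b) (r1, m) t2 (r2, m)" "\<forall>i<d+1. r2 i = r1 i"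
    "r2 (d + 1) = val b r m" "t2 \<le> B ^ cost b"
    using Minus.IH(2)[OF sub e1 Minus.prems(4)] by blast
  define I where "I = (\<lambda>j s. snd s = m \<and> (\<forall>i<d. fst s i = rl i) \<and> fst s d = val a r m - j \<and>
     fst s (d + 1) = val b r m \<and> fst s (d + 2) = j)"
  have "\<exists>t s'. exec Q (While (Less (d + 2) (d + 1)) (Seq (Decr d) (Incr (d + 2)))) (r2(d + 2 := 0), m) t s'
     \<and> t \<le> val b r m * (2 + 1) + 1 \<and> I (val b r m) s'"
  proof (rule count_loop[where I = I])
    fix j s assume "j < val b r m" "I j s"
    moreover obtain r' m' where s: "s = (r', m')" by (cases s)
    have "exec Q (Seq (Decr d) (Incr (d + 2))) s (1 + 1)
      ((r'(d := r' d - 1))(d + 2 := (r'(d := r' d - 1)) (d + 2) + 1), m')"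
      unfolding s by (rule exec.Seq[OF exec.Decr exec.Incr])
    ultimately show "\<exists>t s'. exec Q (Seq (Decr d) (Incr (d + 2))) s t s' \<and> t \<le> 2 \<and> I (Suc j) s'"
      by (intro exI conjI) (assumption, auto simp: s I_def)
  qed (use 1 2 in \<open>auto simp: I_def\<close>)
  then obtain t3 r3 where 3: "exec Q (While (Less (d + 2) (d + 1)) (Seq (Decr d) (Incr (d + 2)))) (r2(d + 2 := 0), m) t3 (r3, m)"
     "t3 \<le> val b r m * 3 + 1" "I (val b r m) (r3, m)" unfolding I_def by auto
  have "exec Q (compile_expr d (Minus a b)) (rl, m) (t1 + (t2 + (1 + t3))) (r3, m)"
    unfolding compile_expr.simps by (rule exec.Seq[OF 1(1) exec.Seq[OF 2(1) exec.Seq[OF exec.Const 3(1)]]])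
  moreover have "t1 + (t2 + (1 + t3)) \<le> B ^ (cost a + cost b + growth b + 3)"
  proof (rule le_power_add[where c = 7])
    have "val b r m \<le> B ^ growth b" using val_le[OF B, of b D] Minus.prems by auto
    moreover have "B ^ growth b \<le> B ^ (cost a + cost b + growth b)" "B ^ cost a \<le> B ^ (cost a + cost b + growth b)"
      "B ^ cost b \<le> B ^ (cost a + cost b + growth b)"  "1 \<le> B ^ (cost a + cost b + growth b)"
      using B by (auto intro!: power_increasing one_le_power)
    ultimately show "t1 + (t2 + (1 + t3)) \<le> 7 * B ^ (cost a + cost b + growth b)"
      using 1(4) 2(4) 3(2) by linarith
  qed (use B in auto)
  ultimately show ?case using 3(3) unfolding I_def by auto
next
  case (Times a b)
  obtain t1 r1 where 1: "exec Q (compile_expr (d + 1) a) (rl, m) t1 (r1, m)" "\<forall>i<d+1. r1 i = rl i"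
    "r1 (d + 1) = val a r m" "t1 \<le> B ^ cost a"
    using Times.IH(1)[OF _ _ Times.prems(3,4), of "d + 1"] Times.prems(1,2) by (simp, blast)
  have sub: "expr_regs b \<subseteq> {..<D}" "D \<le> d + 2" using Times.prems by auto
  have e1: "r1 i = r i" if "i < D" for i using 1(2) Times.prems(2,3) that by simp
  obtain t2 r2 where 2: "exec Q (compile_expr (d + 2) b) (r1, m) t2 (r2, m)" "\<forall>i<d+2. r2 i = r1 i"
    "r2 (d + 2) = val b r m" "t2 \<le> B ^ cost b"
    using Times.IH(2)[OF sub e1 Times.prems(4)] by blast
  define va vb where vab: "va = val a r m" "vb = val b r m"
  let ?inner = "While (Less (d + 4) (d + 1)) (Seq (Incr d) (Incr (d + 4)))"
  let ?body = "Seq (Const (d + 4) 0) (Seq ?inner (Incr (d + 3)))"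
  define I where "I = (\<lambda>j s. snd s = m \<and> (\<forall>i<d. fst s i = rl i) \<and> fst s d = va * j \<and>
     fst s (d + 1) = va \<and> fst s (d + 2) = vb \<and> fst s (d + 3) = j)"
  have "\<exists>t s'. exec Q (While (Less (d + 3) (d + 2)) ?body) (r2(d := 0, d + 3 := 0), m) t s'
     \<and> t \<le> vb * ((va * 3 + 3) + 1) + 1 \<and> I vb s'"
  proof (rule count_loop[where I = I])
    fix j s assume j: "j < vb" "I j s"
    obtain r' m' where s: "s = (r', m')" by (cases s)
    define J where "J = (\<lambda>k s. snd s = m \<and> (\<forall>i<d. fst s i = rl i) \<and> fst s d = va * j + k \<and>
       fst s (d + 1) = va \<and> fst s (d + 2) = vb \<and> fst s (d + 3) = j \<and> fst s (d + 4) = k)"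
    have "\<exists>t s'. exec Q ?inner (r'(d + 4 := 0), m') t s' \<and> t \<le> va * (2 + 1) + 1 \<and> J va s'"
    proof (rule count_loop[where I = J])
      fix k s assume "k < va" "J k s"
      moreover obtain r' m' where s: "s = (r', m')" by (cases s)
      have "exec Q (Seq (Incr d) (Incr (d + 4))) s (1 + 1)
        ((r'(d := r' d + 1))(d + 4 := (r'(d := r' d + 1)) (d + 4) + 1), m')"
        unfolding s by (rule exec.Seq[OF exec.Incr exec.Incr])
      ultimately show "\<exists>t s'. exec Q (Seq (Incr d) (Incr (d + 4))) s t s' \<and> t \<le> 2 \<and> J (Suc k) s'"
        by (intro exI conjI) (assumption, auto simp: s J_def)
    qed (use j in \<open>auto simp: I_def J_def s\<close>)
    then obtain t3 r3 where 3: "exec Q ?inner (r'(d + 4 := 0), m') t3 (r3, m')"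
       "t3 \<le> va * 3 + 1" "J va (r3, m')" using j unfolding J_def I_def s by auto
    have "exec Q ?body s (1 + (t3 + 1)) (r3(d + 3 := r3 (d + 3) + 1), m')"
      unfolding s by (rule exec.Seq[OF exec.Const exec.Seq[OF 3(1) exec.Incr]])
    then show "\<exists>t s'. exec Q ?body s t s' \<and> t \<le> va * 3 + 3 \<and> I (Suc j) s'"
      using 3(2,3) unfolding J_def I_def s by (intro exI conjI) (assumption, auto)
  qed (use 1 2 in \<open>auto simp: I_def vab\<close>)
  then obtain t3 r3 where 3: "exec Q (While (Less (d + 3) (d + 2)) ?body) (r2(d := 0, d + 3 := 0), m) t3 (r3, m)"
     "t3 \<le> vb * ((va * 3 + 3) + 1) + 1" "I vb (r3, m)" unfolding I_def by auto
  have "exec Q (compile_expr d (Times a b)) (rl, m) (t1 + (t2 + (1 + (1 + t3)))) (r3, m)"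
    unfolding compile_expr.simps
    by (rule exec.Seq[OF 1(1) exec.Seq[OF 2(1) exec.Seq[OF exec.Const exec.Seq[OF exec.Const 3(1)]]]])
  moreover have "t1 + (t2 + (1 + (1 + t3))) \<le> B ^ (cost a + cost b + growth a + growth b + 4)"
  proof (rule le_power_add[where c = 12])
    let ?E = "B ^ (cost a + cost b + growth a + growth b)"
    have v: "va \<le> B ^ growth a" "vb \<le> B ^ growth b" using val_le[OF B, of _ D] Times.prems vab by auto
    have "va * vb \<le> B ^ growth a * B ^ growth b" using v by (rule mult_mono) auto
    also have "\<dots> \<le> ?E" unfolding power_add[symmetric] using B by (intro power_increasing) auto
    finally have "va * vb \<le> ?E" .
    moreover have "vb \<le> ?E" using v(2) by (rule order_trans) (use B in \<open>auto intro: power_increasing\<close>)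
    moreover have "B ^ cost a \<le> ?E" "B ^ cost b \<le> ?E"  "1 \<le> ?E"
      using B by (auto intro!: power_increasing one_le_power)
    moreover have "t3 \<le> 3 * (va * vb) + 4 * vb + 1" using 3(2) by (simp add: algebra_simps)
    ultimately show "t1 + (t2 + (1 + (1 + t3))) \<le> 12 * ?E"
      using 1(4) 2(4) by linarith
  qed (use B in auto)
  ultimately show ?case using 3(3) unfolding I_def by (auto simp: vab)
next
  case (Lt a b)
  obtain t1 r1 where 1: "exec Q (compile_expr d a) (rl, m) t1 (r1, m)" "\<forall>i<d. r1 i = rl i"
    "r1 d = val a r m" "t1 \<le> B ^ cost a"
    using Lt.IH(1)[OF _ Lt.prems(2-4)] Lt.prems(1) by (simp, blast)
  have sub: "expr_regs b \<subseteq> {..<D}" "D \<le> d + 1" using Lt.prems by auto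
  have e1: "r1 i = r i" if "i < D" for i using 1(2) Lt.prems(2,3) that by simp
  obtain t2 r2 where 2: "exec Q (compile_expr (d + 1) b) (r1, m) t2 (r2, m)" "\<forall>i<d+1. r2 i = r1 i"
    "r2 (d + 1) = val b r m" "t2 \<le> B ^ cost b"
    using Lt.IH(2)[OF sub e1 Lt.prems(4)] by blast
  have "exec Q (Cond (Less d (d + 1)) (Const d 1) (Const d 0)) (r2, m) (1 + 1)
     (r2(d := if r2 d < r2 (d + 1) then 1 else 0), m)"
  proof (cases "r2 d < r2 (d + 1)")
    case True
    then show ?thesis using exec.CondTrue[OF _ exec.Const, of "Less d (d + 1)" r2 m] by simp
  next
    case False
    then show ?thesis using exec.CondFalse[OF _ exec.Const, of "Less d (d + 1)" r2 m] by simp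
  qed
  from exec.Seq[OF 1(1) exec.Seq[OF 2(1) this]] have "exec Q (compile_expr d (Lt a b)) (rl, m) (t1 + (t2 + (1 + 1)))
     (r2(d := if r2 d < r2 (d + 1) then 1 else 0), m)"
    unfolding compile_expr.simps .
  moreover have "t1 + (t2 + (1 + 1)) \<le> B ^ (cost a + cost b + 2)"
  proof (rule le_power_add[where c = 4])
    have "B ^ cost a \<le> B ^ (cost a + cost b)"
      "B ^ cost b \<le> B ^ (cost a + cost b)"  "1 \<le> B ^ (cost a + cost b)"
      using B by (auto intro!: power_increasing one_le_power)
    then show "t1 + (t2 + (1 + 1)) \<le> 4 * B ^ (cost a + cost b)"
      using 1(4) 2(4) by linarith
  qed (use B in auto)
  ultimately show ?case using 1 2 by (intro exI conjI) (assumption, auto)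
next
  case (Exi v e)
  define n where "n = r 1"
  let ?test = "Seq (Const (d + 5) 0) (Cond (Less (d + 5) (d + 4)) (Const d 1) Skip)"
  let ?body = "Seq (Incr (d + 3)) (Seq (Copy v (d + 3)) (Seq (compile_expr (d + 4) e) ?test))"
  \<comment> \<open>Register \<open>v\<close> is exempt, as it runs through the range; its old value
    waits in register \<open>d + 1\<close>.\<close>
  define I where "I = (\<lambda>j s. snd s = m \<and> (\<forall>i<d. i \<noteq> v \<longrightarrow> fst s i = rl i) \<and>
     fst s d = (if \<exists>x \<in> {1..j}. val e (r(v := x)) m \<noteq> 0 then 1 else 0) \<and>
     fst s (d + 1) = rl v \<and> fst s (d + 2) = n \<and> fst s (d + 3) = j)"
  let ?r0 = "(((rl(d := 0))(d + 1 := rl v))(d + 2 := n))(d + 3 := 0)"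
  have n: "rl 1 = n" "n \<le> B" "v < d" using Exi.prems by (auto simp: n_def bounded_def)
  have "\<exists>t s'. exec Q (While (Less (d + 3) (d + 2)) ?body) (?r0, m) t s'
     \<and> t \<le> n * ((B ^ cost e + 5) + 1) + 1 \<and> I n s'"
  proof (rule count_loop[where I = I])
    fix j s assume j: "j < n" "I j s"
    then obtain r' where s: "s = (r', m)" by (cases s) (auto simp: I_def)
    let ?r1 = "(r'(d + 3 := r' (d + 3) + 1))(v := r' (d + 3) + 1)"
    have "\<exists>t rl'. exec Q (compile_expr (d + 4) e) (?r1, m) t (rl', m) \<and>
          (\<forall>i<d+4. rl' i = ?r1 i) \<and> rl' (d + 4) = val e (r(v := Suc j)) m \<and> t \<le> B ^ cost e"
    proof (rule Exi.IH)
      show "?r1 i = (r(v := Suc j)) i" if "i < D" for i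
        using Exi.prems(2,3) j(2) that by (auto simp: I_def s)
      show "bounded D B (r(v := Suc j), m)"
        by (rule bounded_upd[OF Exi.prems(4)]) (use j(1) n(2) in simp)
    qed (use Exi.prems(1,2) in auto)
    then obtain t1 r1 where 1: "exec Q (compile_expr (d + 4) e) (?r1, m) t1 (r1, m)"
       "\<forall>i<d+4. r1 i = ?r1 i" "r1 (d + 4) = val e (r(v := Suc j)) m" "t1 \<le> B ^ cost e"
      by blast
    let ?r2 = "(r1(d + 5 := 0))(d := if r1 (d + 4) \<noteq> 0 then 1 else r1 d)"
    have "exec Q (Cond (Less (d + 5) (d + 4)) (Const d 1) Skip) (r1(d + 5 := 0), m) (1 + 1) (?r2, m)"
    proof (cases "r1 (d + 4) = 0")
      case True
      then have "?r2 = r1(d + 5 := 0)" by auto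
      then show ?thesis
        using exec.CondFalse[OF _ exec.Skip, of "Less (d + 5) (d + 4)" "(r1(d + 5 := 0), m)"] True by simp
    next
      case False
      then have "exec Q (Const d 1) (r1(d + 5 := 0), m) 1 (?r2, m)"
        using exec.Const[of Q d 1 "r1(d + 5 := 0)" m] by simp
      then show ?thesis
        using exec.CondTrue[OF _ \<open>exec Q (Const d 1) _ _ _\<close>, of "Less (d + 5) (d + 4)"] False by simp
    qed
    moreover have "exec Q (Copy v (d + 3)) (r'(d + 3 := r' (d + 3) + 1), m) 1 (?r1, m)"
      using exec.Copy[of Q v "d + 3" "r'(d + 3 := r' (d + 3) + 1)" m] by simp
    ultimately have "exec Q ?body s (1 + (1 + (t1 + (1 + (1 + 1))))) (?r2, m)"
      unfolding s using exec.Seq[OF exec.Incr exec.Seq[OF _ exec.Seq[OF 1(1) exec.Seq[OF exec.Const]]]] by blast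
    moreover have "I (Suc j) (?r2, m)"
    proof -
      have "{1..Suc j} = insert (Suc j) {1..j}" by auto
      then show ?thesis using 1 j n by (auto simp: I_def s)
    qed
    ultimately show "\<exists>t s'. exec Q ?body s t s' \<and> t \<le> B ^ cost e + 5 \<and> I (Suc j) s'"
      using 1(4) by (intro exI conjI) (assumption, auto)
  qed (use n in \<open>auto simp: I_def\<close>)
  then obtain t3 r3 where 3: "exec Q (While (Less (d + 3) (d + 2)) ?body) (?r0, m) t3 (r3, m)"
     "t3 \<le> n * ((B ^ cost e + 5) + 1) + 1" "I n (r3, m)" unfolding I_def by auto
  have c: "exec Q (Copy (d + 1) v) (rl(d := 0), m) 1 ((rl(d := 0))(d + 1 := rl v), m)"
    "exec Q (Copy (d + 2) 1) ((rl(d := 0))(d + 1 := rl v), m) 1 (((rl(d := 0))(d + 1 := rl v))(d + 2 := n), m)"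
    "exec Q (Copy v (d + 1)) (r3, m) 1 (r3(v := rl v), m)"
    using exec.Copy[of Q "d + 1" v "rl(d := 0)" m] n Exi.prems
      exec.Copy[of Q "d + 2" 1 "(rl(d := 0))(d + 1 := rl v)" m] exec.Copy[of Q v "d + 1" r3 m] 3(3)
    by (auto simp: I_def)
  have "exec Q (compile_expr d (Exi v e)) (rl, m) (1 + (1 + (1 + (1 + (t3 + 1))))) (r3(v := rl v), m)"
    unfolding compile_expr.simps
    by (rule exec.Seq[OF exec.Const exec.Seq[OF c(1) exec.Seq[OF c(2) exec.Seq[OF exec.Const exec.Seq[OF 3(1) c(3)]]]]])
  moreover have "(1 + (1 + (1 + (1 + (t3 + 1))))) \<le> B ^ (cost e + 1 + 4)"
  proof (rule le_power_add[where c = 13])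
    have "n * B ^ cost e \<le> B * B ^ cost e" "1 \<le> B * B ^ cost e" "n * 1 \<le> B * B ^ cost e"
      using n B one_le_power[of B "cost e"] mult_le_mono[of n B 1 "B ^ cost e"] mult_le_mono[of 1 B 1 "B ^ cost e"] by auto
    moreover have "t3 \<le> n * B ^ cost e + 6 * n + 1" using 3(2) by (simp add: algebra_simps)
    ultimately have "(1 + (1 + (1 + (1 + (t3 + 1))))) \<le> 13 * (B * B ^ cost e)"
      using 3(2) unfolding mult_1_right by linarith
    then show "(1 + (1 + (1 + (1 + (t3 + 1))))) \<le> 13 * B ^ (cost e + 1)" by simp
  qed (use B in auto)
  moreover have "\<forall>i<d. (r3(v := rl v)) i = rl i" "(r3(v := rl v)) d = val (Exi v e) r m"
    using 3(3) n(3) by (auto simp: I_def n_def)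
  ultimately show ?case unfolding cost.simps by blast
qed

section \<open>Statements: semantics, compilation and running time\<close>

datatype stm = Assign nat expr | Write expr expr | SSeq stm stm | Ite expr stm stm | For nat stm | Ask nat expr expr

text \<open>\<open>For\<close> reads its limit once, on entry. The compiled loop does the same:
  counter and limit live in the scratch registers \<open>d\<close> and \<open>d + 1\<close>, out of
  reach of the body.\<close>

primrec sem :: "(nat list \<Rightarrow> bool) \<Rightarrow> stm \<Rightarrow> state \<Rightarrow> state" where
  "sem Q (Assign v e) s = ((fst s)(v := val e (fst s) (snd s)), snd s)"
| "sem Q (Write a e) s = (fst s, (snd s)(val a (fst s) (snd s) := val e (fst s) (snd s)))"
| "sem Q (SSeq c d) s = sem Q d (sem Q c s)"
| "sem Q (Ite e c d) s = (if val e (fst s) (snd s) \<noteq> 0 then sem Q c s else sem Q d s)"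
| "sem Q (For v c) s = fold (\<lambda>j s. sem Q c ((fst s)(v := j), snd s)) [1..<fst s 1 + 1] s"
| "sem Q (Ask v a l) s = ((fst s)(v :=
     (if Q (map (snd s) [val a (fst s) (snd s)..<val a (fst s) (snd s) + val l (fst s) (snd s)])
      then 1 else 0)), snd s)"

primrec compile :: "nat \<Rightarrow> stm \<Rightarrow> cmd" where
  "compile d (Assign v e) = Seq (compile_expr d e) (Copy v d)"
| "compile d (Write a e) = Seq (compile_expr d a) (Seq (compile_expr (d + 1) e) (Store d (d + 1)))"
| "compile d (SSeq a b) = Seq (compile d a) (compile d b)"
| "compile d (Ite e a b) = Seq (compile_expr d e) (Seq (Const (d + 1) 0)
     (Cond (Less (d + 1) d) (compile d a) (compile d b)))"
| "compile d (For v c) = Seq (Const d 0) (Seq (Copy (d + 1) 1)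
     (While (Less d (d + 1)) (Seq (Incr d) (Seq (Copy v d) (compile (d + 2) c)))))"
| "compile d (Ask v a l) = Seq (compile_expr d a) (Seq (compile_expr (d + 1) l) (Query v d (d + 1)))"

primrec stm_regs :: "stm \<Rightarrow> nat set" where
  "stm_regs (Assign v e) = insert v (expr_regs e)"
| "stm_regs (Write a e) = expr_regs a \<union> expr_regs e"
| "stm_regs (SSeq c d) = stm_regs c \<union> stm_regs d"
| "stm_regs (Ite e c d) = expr_regs e \<union> stm_regs c \<union> stm_regs d"
| "stm_regs (For v c) = insert 1 (insert v (stm_regs c))"
| "stm_regs (Ask v a l) = insert v (expr_regs a \<union> expr_regs l)"

text \<open>Exponents multiply under sequencing, because the second statement starts from the bound
  \<open>B ^ stm_growth c\<close>. That a loop has growth 1 rests on the tameness of its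
  body.\<close>

primrec stm_growth :: "stm \<Rightarrow> nat" where
  "stm_growth (Assign v e) = growth e + 1"
| "stm_growth (Write a e) = growth e + 1"
| "stm_growth (SSeq c d) = stm_growth c * stm_growth d"
| "stm_growth (Ite e c d) = stm_growth c * stm_growth d"
| "stm_growth (For v c) = 1"
| "stm_growth (Ask v a l) = 1"

primrec stm_cost :: "stm \<Rightarrow> nat" where
  "stm_cost (Assign v e) = cost e + 1"
| "stm_cost (Write a e) = cost a + cost e + 2"
| "stm_cost (SSeq c d) = stm_cost c + stm_growth c * stm_cost d + 1"
| "stm_cost (Ite e c d) = cost e + stm_cost c + stm_cost d + 2"
| "stm_cost (For v c) = stm_cost c + 1 + 4"
| "stm_cost (Ask v a l) = cost a + cost l + growth l + 2"

text \<open>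
  Bodies of \<open>For\<close> loops must be tame, that is, they must not create values exceeding the current
  bound; otherwise iteration could lead to exponential growth.
\<close>

primrec small :: "expr \<Rightarrow> bool" where
  "small (V v) = True"
| "small (N c) = (c \<le> 2)"
| "small (Mem e) = True"
| "small (Plus a b) = False"
| "small (Minus a b) = small a"
| "small (Times a b) = False"
| "small (Lt a b) = True"
| "small (Exi v e) = True"

primrec tame :: "stm \<Rightarrow> bool" where
  "tame (Assign v e) = small e"
| "tame (Write a e) = small e"
| "tame (SSeq c d) = (tame c \<and> tame d)"
| "tame (Ite e c d) = (tame c \<and> tame d)"
| "tame (For v c) = tame c"
| "tame (Ask v a l) = True"

text \<open>Outside \<open>For\<close> loops, sums and products may be stored, as needed for
  addresses and for advancing the depth and the candidate. The search loop itself is not a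
  \<open>For\<close>; there the bound is part of the invariant and is re-established in each
  round.\<close>

primrec loops_tame :: "stm \<Rightarrow> bool" where
  "loops_tame (Assign v e) = True"
| "loops_tame (Write a e) = True"
| "loops_tame (SSeq c d) = (loops_tame c \<and> loops_tame d)"
| "loops_tame (Ite e c d) = (loops_tame c \<and> loops_tame d)"
| "loops_tame (For v c) = tame c"
| "loops_tame (Ask v a l) = True"

lemma fold_upt_induct:
  assumes "I 0 s" and "\<And>j s. j < n \<Longrightarrow> I j s \<Longrightarrow> I (Suc j) (f (Suc j) s)"
  shows "I n (fold f [1..<n + 1] s)"
proof -
  have "i \<le> n \<Longrightarrow> I i (fold f [1..<i + 1] s)" for i
    by (induction i) (use assms in auto)
  then show ?thesis by simp
qed

lemma sem_For_induct:
  assumes "I 0 s" and "\<And>j r m. j < fst s 1 \<Longrightarrow> I j (r, m) \<Longrightarrow> I (Suc j) (sem Q c (r(v := Suc j), m))"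
  shows "I (fst s 1) (sem Q (For v c) s)"
  unfolding sem.simps by (rule fold_upt_induct) (use assms in auto)

lemma tame_loops_tame: "tame c \<Longrightarrow> loops_tame c"
  by (induction c) auto

lemma stm_growth_pos: "1 \<le> stm_growth c"
  by (induction c) (auto simp: Suc_le_eq)

lemma val_small:
  assumes "2 \<le> B"
  shows "small e \<Longrightarrow> expr_regs e \<subseteq> {..<D} \<Longrightarrow> bounded D B s \<Longrightarrow> val e (fst s) (snd s) \<le> B"
  using assms by (induction e) (auto simp: bounded_def intro: le_trans[OF diff_le_self])

lemma bounded_sem_tame:
  assumes "2 \<le> B"
  shows "tame c \<Longrightarrow> stm_regs c \<subseteq> {..<D} \<Longrightarrow> bounded D B s \<Longrightarrow> bounded D B (sem Q c s)"
proof (induction c arbitrary: s)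
  case (Assign v e)
  then show ?case using val_small[OF assms, of e D s] by (auto simp: bounded_def)
next
  case (Write a e)
  then show ?case using val_small[OF assms, of e D s] by (auto simp: bounded_def)
next
  case (For v c)
  have "fst s 1 \<le> B" using For.prems by (auto simp: bounded_def)
  show ?case
  proof (rule sem_For_induct[where I = "\<lambda>j. bounded D B"])
    fix j r m assume "j < fst s 1" "bounded D B (r, m)"
    then show "bounded D B (sem Q c (r(v := Suc j), m))"
      using For.prems \<open>fst s 1 \<le> B\<close> by (intro For.IH bounded_upd) auto
  qed (rule For.prems)
next
  case (Ask v a l)
  then show ?case using assms by (auto simp: bounded_def)
qed auto

lemma bounded_mono: "bounded D B s \<Longrightarrow> B \<le> C \<Longrightarrow> bounded D C s"
  by (auto simp: bounded_def intro: le_trans)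

lemma bounded_sem:
  assumes "2 \<le> B"
  shows "loops_tame c \<Longrightarrow> stm_regs c \<subseteq> {..<D} \<Longrightarrow> bounded D B s \<Longrightarrow> bounded D (B ^ stm_growth c) (sem Q c s)"
  using assms
proof (induction c arbitrary: s B)
  case (Assign v e)
  have "val e (fst s) (snd s) \<le> B ^ growth e"
    using val_le[of B e D "fst s" "snd s"] Assign.prems by auto
  also have "\<dots> \<le> B ^ stm_growth (Assign v e)" using Assign.prems by (intro power_increasing) auto
  finally show ?case
    using bounded_mono[OF Assign.prems(3) self_le_power[of B "stm_growth (Assign v e)"]] Assign.prems(4)
    by (auto simp: bounded_def)
next
  case (Write a e)
  have "val e (fst s) (snd s) \<le> B ^ growth e"
    using val_le[of B e D "fst s" "snd s"] Write.prems by auto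
  also have "\<dots> \<le> B ^ stm_growth (Write a e)" using Write.prems by (intro power_increasing) auto
  finally show ?case
    using bounded_mono[OF Write.prems(3) self_le_power[of B "stm_growth (Write a e)"]] Write.prems(4)
    by (auto simp: bounded_def)
next
  case (SSeq c d)
  have "2 \<le> B ^ stm_growth c" using self_le_power[of B "stm_growth c"] stm_growth_pos[of c] SSeq.prems(4) by linarith
  then show ?case using SSeq by (simp add: power_mult)
next
  case (Ite e c d)
  have "B ^ stm_growth c \<le> B ^ (stm_growth c * stm_growth d)" "B ^ stm_growth d \<le> B ^ (stm_growth c * stm_growth d)"
    using Ite.prems(4) stm_growth_pos[of c] stm_growth_pos[of d] by (auto intro!: power_increasing)
  moreover have "bounded D (B ^ stm_growth c) (sem Q c s)" "bounded D (B ^ stm_growth d) (sem Q d s)"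
    using Ite.prems by (auto intro!: Ite.IH)
  ultimately show ?case by (auto intro: bounded_mono)
next
  case (For v c)
  then show ?case using bounded_sem_tame[of B "For v c" D s Q] by simp
next
  case (Ask v a l)
  then show ?case by (auto simp: bounded_def)
qed

lemma fold_upt_Suc: "fold f [1..<Suc j + 1] s = f (Suc j) (fold f [1..<j + 1] s)"
  by simp

text \<open>Registers below \<open>D\<close> follow the semantics, while those between
  \<open>D\<close> and \<open>d\<close> are left alone: there the enclosing loops keep their
  counters and limits. \<open>B\<close> varies in the induction because the second half of a
  sequence starts with a larger bound.\<close>

lemma compile_exec:
  assumes "2 \<le> B"
  shows "loops_tame c \<Longrightarrow> stm_regs c \<subseteq> {..<D} \<Longrightarrow> D \<le> d \<Longrightarrow> (\<And>i. i < D \<Longrightarrow> rl i = r i) \<Longrightarrow>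
    bounded D B (r, m) \<Longrightarrow>
    \<exists>t rl'. exec Q (compile d c) (rl, m) t (rl', snd (sem Q c (r, m))) \<and>
       (\<forall>i<D. rl' i = fst (sem Q c (r, m)) i) \<and> (\<forall>i. D \<le> i \<longrightarrow> i < d \<longrightarrow> rl' i = rl i) \<and>
       t \<le> B ^ stm_cost c"
  using assms
proof (induction c arbitrary: d rl r m B)
  case (Assign v e)
  have "expr_regs e \<subseteq> {..<D}" using Assign.prems by auto
  from compile_expr_exec[OF Assign.prems(6) this Assign.prems(3-5)]
  obtain t r1 where 1: "exec Q (compile_expr d e) (rl, m) t (r1, m)" "\<forall>i<d. r1 i = rl i"
    "r1 d = val e r m" "t \<le> B ^ cost e" by blast
  have "exec Q (compile d (Assign v e)) (rl, m) (t + 1) (r1(v := r1 d), m)"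
    unfolding compile.simps by (rule exec.Seq[OF 1(1) exec.Copy])
  moreover have "t + 1 \<le> B ^ (cost e + 1)"
  proof (rule le_power_add[where c = 2])
    show "t + 1 \<le> 2 * B ^ cost e" using 1(4) one_le_power[of B "cost e"] Assign.prems(6) by linarith
  qed (use Assign.prems(6) in auto)
  moreover have "\<forall>i<D. (r1(v := r1 d)) i = fst (sem Q (Assign v e) (r, m)) i"
    "\<forall>i. D \<le> i \<longrightarrow> i < d \<longrightarrow> (r1(v := r1 d)) i = rl i"
    using 1 Assign.prems(2-4) by auto
  ultimately show ?case unfolding sem.simps stm_cost.simps snd_conv by blast
next
  case (Write a e)
  have ra: "expr_regs a \<subseteq> {..<D}" and re: "expr_regs e \<subseteq> {..<D}" using Write.prems by auto
  from compile_expr_exec[OF Write.prems(6) ra Write.prems(3-5)]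
  obtain t r1 where 1: "exec Q (compile_expr d a) (rl, m) t (r1, m)" "\<forall>i<d. r1 i = rl i"
    "r1 d = val a r m" "t \<le> B ^ cost a" by blast
  have e1: "r1 i = r i" if "i < D" for i using 1(2) Write.prems(3,4) that by simp
  from compile_expr_exec[OF Write.prems(6) re _ e1 Write.prems(5), of "d + 1"]
  obtain t2 r2 where 2: "exec Q (compile_expr (d + 1) e) (r1, m) t2 (r2, m)" "\<forall>i<d+1. r2 i = r1 i"
    "r2 (d + 1) = val e r m" "t2 \<le> B ^ cost e" using Write.prems(3) by force
  have "exec Q (compile d (Write a e)) (rl, m) (t + (t2 + 1)) (r2, m(r2 d := r2 (d + 1)))"
    unfolding compile.simps by (rule exec.Seq[OF 1(1) exec.Seq[OF 2(1) exec.Store]])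
  moreover have "t + (t2 + 1) \<le> B ^ (cost a + cost e + 2)"
  proof (rule le_power_add[where c = 3])
    have "B ^ cost a \<le> B ^ (cost a + cost e)" "B ^ cost e \<le> B ^ (cost a + cost e)" "1 \<le> B ^ (cost a + cost e)"
      using Write.prems(6) by (auto intro!: power_increasing one_le_power)
    then show "t + (t2 + 1) \<le> 3 * B ^ (cost a + cost e)" using 1(4) 2(4) by linarith
  qed (use Write.prems(6) in auto)
  moreover have "m(r2 d := r2 (d + 1)) = snd (sem Q (Write a e) (r, m))"
    "\<forall>i<D. r2 i = fst (sem Q (Write a e) (r, m)) i" "\<forall>i. D \<le> i \<longrightarrow> i < d \<longrightarrow> r2 i = rl i"
    using 1 2 Write.prems(3,4) by auto
  ultimately show ?case unfolding stm_cost.simps by metis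
next
  case (SSeq a b)
  have ra: "stm_regs a \<subseteq> {..<D}" and rb: "stm_regs b \<subseteq> {..<D}" and l: "loops_tame a" "loops_tame b"
    using SSeq.prems by auto
  obtain r' m' where s: "sem Q a (r, m) = (r', m')" by fastforce
  from SSeq.IH(1)[OF l(1) ra SSeq.prems(3-6)] s
  obtain t1 r1 where 1: "exec Q (compile d a) (rl, m) t1 (r1, m')" "\<forall>i<D. r1 i = r' i"
    "\<forall>i. D \<le> i \<longrightarrow> i < d \<longrightarrow> r1 i = rl i" "t1 \<le> B ^ stm_cost a" by auto
  have B2: "2 \<le> B ^ stm_growth a"
    using self_le_power[of B "stm_growth a"] stm_growth_pos[of a] SSeq.prems(6) by linarith
  have b: "bounded D (B ^ stm_growth a) (r', m')"
    using bounded_sem[OF SSeq.prems(6) l(1) ra SSeq.prems(5), of Q] s by simp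
  have e1: "r1 i = r' i" if "i < D" for i using 1(2) that by simp
  from SSeq.IH(2)[OF l(2) rb SSeq.prems(3) e1 b B2]
  obtain t2 r2 where 2: "exec Q (compile d b) (r1, m') t2 (r2, snd (sem Q b (r', m')))"
    "\<forall>i<D. r2 i = fst (sem Q b (r', m')) i"
    "\<forall>i. D \<le> i \<longrightarrow> i < d \<longrightarrow> r2 i = r1 i" "t2 \<le> (B ^ stm_growth a) ^ stm_cost b" by blast
  have "t1 + t2 \<le> B ^ (stm_cost a + stm_growth a * stm_cost b + 1)"
  proof (rule le_power_add[where c = 2])
    have "B ^ stm_cost a \<le> B ^ (stm_cost a + stm_growth a * stm_cost b)"
      "B ^ (stm_growth a * stm_cost b) \<le> B ^ (stm_cost a + stm_growth a * stm_cost b)"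
      using SSeq.prems(6) by (auto intro!: power_increasing)
    then show "t1 + t2 \<le> 2 * B ^ (stm_cost a + stm_growth a * stm_cost b)"
      using 1(4) 2(4) unfolding power_mult[symmetric] by linarith
  qed (use SSeq.prems(6) in auto)
  then show ?case
    using exec.Seq[OF 1(1) 2(1)] 1(3) 2(2,3) s
    by (intro exI[of _ "t1 + t2"] exI[of _ r2]) auto
next
  case (Ite e a b)
  have ra: "stm_regs a \<subseteq> {..<D}" and rb: "stm_regs b \<subseteq> {..<D}" and l: "loops_tame a" "loops_tame b"
    and re: "expr_regs e \<subseteq> {..<D}"
    using Ite.prems by auto
  from compile_expr_exec[OF Ite.prems(6) re Ite.prems(3-5)]
  obtain t r1 where 1: "exec Q (compile_expr d e) (rl, m) t (r1, m)" "\<forall>i<d. r1 i = rl i"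
    "r1 d = val e r m" "t \<le> B ^ cost e" by blast
  define c where "c = (if val e r m \<noteq> 0 then a else b)"
  let ?r1 = "r1(d + 1 := 0)"
  have e1: "?r1 i = r i" if "i < D" for i using 1(2) Ite.prems(3,4) that by simp
  have "\<exists>t rl'. exec Q (compile d c) (?r1, m) t (rl', snd (sem Q c (r, m))) \<and>
       (\<forall>i<D. rl' i = fst (sem Q c (r, m)) i) \<and> (\<forall>i. D \<le> i \<longrightarrow> i < d \<longrightarrow> rl' i = ?r1 i) \<and>
       t \<le> B ^ stm_cost c"
    using Ite.IH(1)[OF l(1) ra Ite.prems(3) e1 Ite.prems(5,6)] Ite.IH(2)[OF l(2) rb Ite.prems(3) e1 Ite.prems(5,6)]
    unfolding c_def by presburger
  then obtain t2 r2 where 2: "exec Q (compile d c) (?r1, m) t2 (r2, snd (sem Q c (r, m)))"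
    "\<forall>i<D. r2 i = fst (sem Q c (r, m)) i"
    "\<forall>i. D \<le> i \<longrightarrow> i < d \<longrightarrow> r2 i = ?r1 i" "t2 \<le> B ^ stm_cost c" by blast
  have "exec Q (Cond (Less (d + 1) d) (compile d a) (compile d b)) (?r1, m) (1 + t2) (r2, snd (sem Q c (r, m)))"
  proof (cases "val e r m = 0")
    case True
    then show ?thesis
      using exec.CondFalse[OF _ 2(1), of "Less (d + 1) d"] 1(3) by (simp add: c_def)
  next
    case False
    then show ?thesis
      using exec.CondTrue[OF _ 2(1), of "Less (d + 1) d"] 1(3) by (simp add: c_def)
  qed
  then have "exec Q (compile d (Ite e a b)) (rl, m) (t + (1 + (1 + t2))) (r2, snd (sem Q c (r, m)))"
    unfolding compile.simps by (rule exec.Seq[OF 1(1) exec.Seq[OF exec.Const]])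
  moreover have "t + (1 + (1 + t2)) \<le> B ^ (cost e + stm_cost a + stm_cost b + 2)"
  proof (rule le_power_add[where c = 4])
    have "B ^ cost e \<le> B ^ (cost e + stm_cost a + stm_cost b)"
      "B ^ stm_cost c \<le> B ^ (cost e + stm_cost a + stm_cost b)"
      "1 \<le> B ^ (cost e + stm_cost a + stm_cost b)"
      using Ite.prems(6) by (auto simp: c_def intro!: power_increasing one_le_power)
    then show "t + (1 + (1 + t2)) \<le> 4 * B ^ (cost e + stm_cost a + stm_cost b)"
      using 1(4) 2(4) by linarith
  qed (use Ite.prems(6) in auto)
  moreover have "sem Q (Ite e a b) (r, m) = sem Q c (r, m)" by (simp add: c_def)
  moreover have "\<forall>i. D \<le> i \<longrightarrow> i < d \<longrightarrow> r2 i = rl i" using 2(3) 1(2) by simp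
  ultimately show ?case using 2(2) unfolding stm_cost.simps by metis
next
  case (For v c)
  define n where "n = r 1"
  define st where "st = (\<lambda>j. fold (\<lambda>j s. sem Q c ((fst s)(v := j), snd s)) [1..<j + 1] (r, m))"
  have B: "2 \<le> B" by fact
  have tame: "tame c" and rc: "stm_regs c \<subseteq> {..<D}" and v: "v < d" "v < D" using For.prems(1,2,3) by auto
  have n: "rl 1 = n" "n \<le> B" using For.prems(2,4,5) by (auto simp: n_def bounded_def)
  have st_Suc: "st (Suc j) = sem Q c ((fst (st j))(v := Suc j), snd (st j))" for j
    unfolding st_def fold_upt_Suc ..
  \<comment> \<open>Tameness keeps one and the same \<open>B\<close> for all rounds, so each costs
    at most \<open>B ^ stm_cost c\<close>.\<close>
  have b: "bounded D B (st j)" if "j \<le> n" for j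
    using that
  proof (induction j)
    case 0
    then show ?case using For.prems(5) by (simp add: st_def)
  next
    case (Suc j)
    have "bounded D B ((fst (st j))(v := Suc j), snd (st j))"
      using Suc n by (intro bounded_upd) auto
    from bounded_sem_tame[OF B tame rc this, of Q] show ?case unfolding st_Suc .
  qed
  let ?body = "Seq (Incr d) (Seq (Copy v d) (compile (d + 2) c))"
  define I where "I = (\<lambda>j s. snd s = snd (st j) \<and> (\<forall>i<D. fst s i = fst (st j) i) \<and>
     (\<forall>i. D \<le> i \<longrightarrow> i < d \<longrightarrow> fst s i = rl i) \<and> fst s d = j \<and> fst s (d + 1) = n)"
  let ?r0 = "(rl(d := 0))(d + 1 := n)"
  have "\<exists>t s'. exec Q (While (Less d (d + 1)) ?body) (?r0, m) t s'
     \<and> t \<le> n * ((B ^ stm_cost c + 2) + 1) + 1 \<and> I n s'"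
  proof (rule count_loop[where I = I])
    fix j s assume j: "j < n" "I j s"
    obtain r' m' where s: "s = (r', m')" by (cases s)
    let ?r1 = "(r'(d := r' d + 1))(v := r' d + 1)"
    have e1: "?r1 i = ((fst (st j))(v := Suc j)) i" if "i < D" for i
      using j(2) that For.prems(3) by (auto simp: I_def s)
    have "bounded D B ((fst (st j))(v := Suc j), snd (st j))"
      using b[of j] j n by (intro bounded_upd) auto
    moreover have "D \<le> d + 2" using For.prems(3) by simp
    ultimately
    obtain t1 r1 where 1: "exec Q (compile (d + 2) c) (?r1, snd (st j)) t1 (r1, snd (st (Suc j)))"
      "\<forall>i<D. r1 i = fst (st (Suc j)) i" "\<forall>i. D \<le> i \<longrightarrow> i < d + 2 \<longrightarrow> r1 i = ?r1 i"
      "t1 \<le> B ^ stm_cost c"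
      using For.IH[OF tame_loops_tame[OF tame] rc, of "d + 2" ?r1 "(fst (st j))(v := Suc j)" B "snd (st j)", OF _ e1 _ B]
      unfolding st_Suc by blast
    have m': "m' = snd (st j)" using j(2) by (simp add: I_def s)
    have "exec Q (Copy v d) (r'(d := r' d + 1), m') 1 (?r1, m')"
      using exec.Copy[of Q v d "r'(d := r' d + 1)" m'] by simp
    from exec.Seq[OF exec.Incr exec.Seq[OF this 1(1)[folded m']]]
    have "exec Q ?body s (1 + (1 + t1)) (r1, snd (st (Suc j)))" unfolding s .
    moreover have "I (Suc j) (r1, snd (st (Suc j)))"
      using 1(2,3) j(2) v For.prems(3) by (auto simp: I_def s)
    ultimately show "\<exists>t s'. exec Q ?body s t s' \<and> t \<le> B ^ stm_cost c + 2 \<and> I (Suc j) s'"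
      using 1(4) by (intro exI conjI) (assumption, auto)
  qed (use n For.prems(3,4) in \<open>auto simp: I_def st_def\<close>)
  then obtain t3 r3 where 3: "exec Q (While (Less d (d + 1)) ?body) (?r0, m) t3 (r3, snd (st n))"
     "t3 \<le> n * ((B ^ stm_cost c + 2) + 1) + 1" "I n (r3, snd (st n))" unfolding I_def by auto
  have "exec Q (Copy (d + 1) 1) (rl(d := 0), m) 1 (?r0, m)"
    using exec.Copy[of Q "d + 1" 1 "rl(d := 0)" m] n For.prems(2,3) by auto
  from exec.Seq[OF exec.Const exec.Seq[OF this 3(1)]]
  have "exec Q (compile d (For v c)) (rl, m) (1 + (1 + t3)) (r3, snd (st n))" unfolding compile.simps .
  moreover have "1 + (1 + t3) \<le> B ^ (stm_cost c + 1 + 4)"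
  proof (rule le_power_add[where c = 8])
    have "n * B ^ stm_cost c \<le> B * B ^ stm_cost c" "1 \<le> B * B ^ stm_cost c" "n * 1 \<le> B * B ^ stm_cost c"
      using n B one_le_power[of B "stm_cost c"] mult_le_mono[of n B 1 "B ^ stm_cost c"]
        mult_le_mono[of 1 B 1 "B ^ stm_cost c"] by auto
    moreover have "t3 \<le> n * B ^ stm_cost c + 3 * n + 1" using 3(2) by (simp add: algebra_simps)
    ultimately have "1 + (1 + t3) \<le> 8 * (B * B ^ stm_cost c)"
      unfolding mult_1_right by linarith
    then show "1 + (1 + t3) \<le> 8 * B ^ (stm_cost c + 1)" by simp
  qed (use B in auto)
  moreover have "sem Q (For v c) (r, m) = st n" by (simp add: st_def n_def)
  ultimately show ?case using 3(3) unfolding stm_cost.simps I_def by auto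
next
  case (Ask v a e)
  have ra: "expr_regs a \<subseteq> {..<D}" and re: "expr_regs e \<subseteq> {..<D}" using Ask.prems by auto
  from compile_expr_exec[OF Ask.prems(6) ra Ask.prems(3-5)]
  obtain t r1 where 1: "exec Q (compile_expr d a) (rl, m) t (r1, m)" "\<forall>i<d. r1 i = rl i"
    "r1 d = val a r m" "t \<le> B ^ cost a" by blast
  have e1: "r1 i = r i" if "i < D" for i using 1(2) Ask.prems(3,4) that by simp
  from compile_expr_exec[OF Ask.prems(6) re _ e1 Ask.prems(5), of "d + 1"]
  obtain t2 r2 where 2: "exec Q (compile_expr (d + 1) e) (r1, m) t2 (r2, m)" "\<forall>i<d+1. r2 i = r1 i"
    "r2 (d + 1) = val e r m" "t2 \<le> B ^ cost e" using Ask.prems(3) by force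
  let ?r = "r2(v := (if Q (map m [r2 d..<r2 d + r2 (d + 1)]) then 1 else 0))"
  have "exec Q (compile d (Ask v a e)) (rl, m) (t + (t2 + (1 + r2 (d + 1)))) (?r, m)"
    unfolding compile.simps by (rule exec.Seq[OF 1(1) exec.Seq[OF 2(1) exec.Query]])
  moreover have "t + (t2 + (1 + r2 (d + 1))) \<le> B ^ (cost a + cost e + growth e + 2)"
  proof (rule le_power_add[where c = 4])
    have "r2 (d + 1) \<le> B ^ growth e" using val_le[OF Ask.prems(6) re Ask.prems(5)] 2(3) by simp
    moreover have "B ^ cost a \<le> B ^ (cost a + cost e + growth e)" "B ^ cost e \<le> B ^ (cost a + cost e + growth e)"
      "B ^ growth e \<le> B ^ (cost a + cost e + growth e)" "1 \<le> B ^ (cost a + cost e + growth e)"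
      using Ask.prems(6) by (auto intro!: power_increasing one_le_power)
    ultimately show "t + (t2 + (1 + r2 (d + 1))) \<le> 4 * B ^ (cost a + cost e + growth e)"
      using 1(4) 2(4) by linarith
  qed (use Ask.prems(6) in auto)
  moreover have "\<forall>i<D. ?r i = fst (sem Q (Ask v a e) (r, m)) i" "\<forall>i. D \<le> i \<longrightarrow> i < d \<longrightarrow> ?r i = rl i"
    "m = snd (sem Q (Ask v a e) (r, m))"
    using 1 2 Ask.prems(2-4) by auto
  ultimately show ?case unfolding stm_cost.simps by metis
qed

section \<open>Subnormal closures and composition series\<close>

text \<open>Once an iterate is fixed, all later ones are. If the \<open>n\<close>-th were not fixed,
  the measure would rise at each of the steps 0 to \<open>n\<close> and exceed \<open>n\<close>.
  This allows the program to run a fixed number of rounds without testing for stabilisation.\<close>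

lemma iterate_fixpoint:
  fixes \<mu> :: "'a \<Rightarrow> nat"
  assumes "\<And>k. \<mu> ((f ^^ k) x) \<le> n"
    and "\<And>k. f ((f ^^ k) x) \<noteq> (f ^^ k) x \<Longrightarrow> \<mu> ((f ^^ k) x) < \<mu> (f ((f ^^ k) x))"
  shows "f ((f ^^ n) x) = (f ^^ n) x"
proof (rule ccontr)
  assume neq: "f ((f ^^ n) x) \<noteq> (f ^^ n) x"
  have stay: "f ((f ^^ k) x) = (f ^^ k) x \<Longrightarrow> f ((f ^^ (k + i)) x) = (f ^^ (k + i)) x" for k i
    by (induction i) auto
  have ne: "f ((f ^^ k) x) \<noteq> (f ^^ k) x" if "k \<le> n" for k
    using stay[of k "n - k"] neq that by auto
  have "k \<le> Suc n \<Longrightarrow> k \<le> \<mu> ((f ^^ k) x)" for k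
  proof (induction k)
    case (Suc k)
    then show ?case using assms(2)[OF ne[of k]] by simp
  qed simp
  from this[of "Suc n"] show False using assms(1)[of "Suc n"] by simp
qed

section \<open>Subnormal closures by iterated normal closures\<close>

context group
begin

text \<open>A left translation of a finite set into itself is injective, hence surjective, which
  produces the unit and the inverses. So the closure computation has to care about products and
  conjugates only.\<close>

lemma finite_subgroupI:
  assumes "finite T" "T \<noteq> {}" "T \<subseteq> carrier G" "\<And>a b. a \<in> T \<Longrightarrow> b \<in> T \<Longrightarrow> a \<otimes> b \<in> T"
  shows "subgroup T G"
proof -
  have sur: "\<exists>b\<in>T. a \<otimes> b = c" if "a \<in> T" "c \<in> T" for a c
  proof -
    have "inj_on ((\<otimes>) a) T" using assms(3) that by (intro inj_onI) (metis l_cancel subsetD)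
    then have "(\<otimes>) a ` T = T" using assms that by (intro endo_inj_surj) auto
    then show ?thesis using that(2) by (metis imageE)
  qed
  obtain a where a: "a \<in> T" using assms(2) by blast
  then obtain b where b: "b \<in> T" "a \<otimes> b = a" using sur by blast
  have c: "a \<in> carrier G" "b \<in> carrier G" using a b(1) assms(3) by auto
  have "b = \<one>" using l_cancel[of a b \<one>] b(2) c by simp
  then have one: "\<one> \<in> T" using b(1) by simp
  show ?thesis
  proof (rule subgroupI)
    fix a assume a: "a \<in> T"
    then obtain b where b: "b \<in> T" "a \<otimes> b = \<one>" using sur one by blast
    have "a \<in> carrier G" "b \<in> carrier G" using a b(1) assms(3) by auto
    then have "inv a = b" using b(2) by (metis inv_equality inv_comm)
    then show "inv a \<in> T" using b by simp
  qed (use assms in auto)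
qed

lemma normal_in_subgroup_iff:
  assumes "subgroup B G"
  shows "A \<lhd> G\<lparr>carrier := B\<rparr> \<longleftrightarrow> subgroup A G \<and> A \<subseteq> B \<and> (\<forall>x\<in>B. \<forall>h\<in>A. x \<otimes> h \<otimes> inv x \<in> A)"
proof -
  interpret B: group "G\<lparr>carrier := B\<rparr>" using assms by (rule subgroup_imp_group)
  have "subgroup A (G\<lparr>carrier := B\<rparr>) \<longleftrightarrow> subgroup A G \<and> A \<subseteq> B"
    using incl_subgroup[OF assms, of A] subgroup.subset[of A "G\<lparr>carrier := B\<rparr>"] subgroup_incl[OF _ assms, of A]
    by auto
  then show ?thesis
    unfolding B.normal_inv_iff using assms by (auto simp: m_inv_consistent)
qed

text \<open>Chains grow downwards from the whole group, which fits both the iteration of normal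
  closures and the descent in \<open>fixpoint_least\<close>.\<close>

inductive subnormal :: "'a set \<Rightarrow> bool" where
  carrier: "subnormal (carrier G)"
| step: "subnormal B \<Longrightarrow> A \<lhd> G\<lparr>carrier := B\<rparr> \<Longrightarrow> subnormal A"

lemma subnormal_subgroup: "subnormal A \<Longrightarrow> subgroup A G"
  by (induction rule: subnormal.induct) (auto simp: subgroup_self normal_in_subgroup_iff)

text \<open>
  The conjugate \<open>a b a\<inverse>\<close> is described as the solution \<open>z\<close> of \<open>z a = a b\<close>, so that
  the closure can be computed from a multiplication table without inverses.
\<close>

definition closure_step :: "'a set \<Rightarrow> 'a set \<Rightarrow> 'a set" where
  "closure_step S T = {z \<in> carrier G. z \<in> T \<or>
     (\<exists>a \<in> carrier G. \<exists>b \<in> carrier G. b \<in> T \<and> (a \<in> T \<and> z = a \<otimes> b \<or> a \<in> S \<and> z \<otimes> a = a \<otimes> b))}"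

text \<open>A round that changes anything adds an element, so \<open>order G\<close> rounds suffice;
  a fixed number of rounds matches a \<open>For\<close> loop over the elements.\<close>

definition normal_closure_in :: "'a set \<Rightarrow> 'a set \<Rightarrow> 'a set" where
  "normal_closure_in S U = (closure_step S ^^ order G) U"

definition subnormal_closure :: "'a set \<Rightarrow> 'a set" where
  "subnormal_closure U = ((\<lambda>S. normal_closure_in S U) ^^ order G) (carrier G)"

lemma closure_step_subset:
  assumes "subgroup B G" "A \<lhd> G\<lparr>carrier := B\<rparr>" "S \<subseteq> B" "T \<subseteq> A"
  shows "closure_step S T \<subseteq> A"
proof
  note A = assms(2)[unfolded normal_in_subgroup_iff[OF assms(1)]]
  interpret A: subgroup A G using A by simp
  fix z assume z: "z \<in> closure_step S T"
  have "z \<in> A" if "b \<in> T" "a \<in> S" "z \<otimes> a = a \<otimes> b" "z \<in> carrier G" for a b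
  proof -
    have "a \<in> carrier G" "b \<in> carrier G"
      using that(1,2) assms(3,4) subgroup.subset[OF assms(1)] A.subset by auto
    then have "z = a \<otimes> b \<otimes> inv a" using that(3,4) inv_solve_right[of z "a \<otimes> b" a] by simp
    moreover have "a \<in> B" "b \<in> A" using that(1,2) assms(3,4) by auto
    ultimately show ?thesis using A by simp
  qed
  then show "z \<in> A" using z assms(4) by (auto simp: closure_step_def)
qed

lemma normal_closure_in_subset:
  assumes "subgroup B G" "A \<lhd> G\<lparr>carrier := B\<rparr>" "S \<subseteq> B" "U \<subseteq> A"
  shows "normal_closure_in S U \<subseteq> A"
proof -
  have "(closure_step S ^^ k) U \<subseteq> A" for k
    by (induction k) (use assms closure_step_subset in auto)
  then show ?thesis by (simp add: normal_closure_in_def)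
qed

text \<open>The iterates increase inside \<open>S\<close>, so a fixed point is reached after
  \<open>order G\<close> rounds. A fixed point of \<open>closure_step\<close> is closed under
  products and under conjugation by \<open>S\<close>, and finiteness supplies the rest.\<close>

lemma normal_closure_in:
  assumes fin: "finite (carrier G)" and S: "subgroup S G" and U: "U \<subseteq> S" "U \<noteq> {}"
  shows "U \<subseteq> normal_closure_in S U" and "normal_closure_in S U \<lhd> G\<lparr>carrier := S\<rparr>"
proof -
  let ?f = "closure_step S"
  let ?T = "normal_closure_in S U"
  have Sc: "S \<subseteq> carrier G" using S by (rule subgroup.subset)
  have SS: "S \<lhd> G\<lparr>carrier := S\<rparr>"
    unfolding normal_in_subgroup_iff[OF S] using S by (auto simp: subgroup.m_closed subgroup.m_inv_closed)
  have sub: "(?f ^^ k) U \<subseteq> S" for k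
    by (induction k) (use U closure_step_subset[OF S SS] in auto)
  have inc: "T \<subseteq> ?f T" if "T \<subseteq> S" for T
    using that Sc by (auto simp: closure_step_def)
  have finS: "finite S" using Sc fin by (rule finite_subset)
  have fp: "?f ?T = ?T"
    unfolding normal_closure_in_def
  proof (rule iterate_fixpoint[where \<mu> = card])
    fix k
    have "card ((?f ^^ k) U) \<le> card (carrier G)" using sub Sc fin by (meson card_mono order_trans)
    then show "card ((?f ^^ k) U) \<le> order G" by (simp add: order_def)
    assume "?f ((?f ^^ k) U) \<noteq> (?f ^^ k) U"
    then have "(?f ^^ k) U \<subset> ?f ((?f ^^ k) U)" using inc[OF sub[of k]] by auto
    moreover have "finite (?f ((?f ^^ k) U))" using sub[of "Suc k"] finS finite_subset by auto
    ultimately show "card ((?f ^^ k) U) < card (?f ((?f ^^ k) U))" by (rule psubset_card_mono[rotated])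
  qed
  have "U \<subseteq> (?f ^^ k) U" for k
    by (induction k) (use inc[OF sub] in auto)
  then show XT: "U \<subseteq> ?T" by (simp add: normal_closure_in_def)
  have TS: "?T \<subseteq> S" using sub by (simp add: normal_closure_in_def)
  have closed: "z \<in> ?T" if "z \<in> carrier G" "a \<in> carrier G" "b \<in> ?T"
    "a \<in> ?T \<and> z = a \<otimes> b \<or> a \<in> S \<and> z \<otimes> a = a \<otimes> b" for z a b
  proof -
    have "b \<in> carrier G" using that(3) TS Sc by auto
    then have "z \<in> ?f ?T" using that by (auto simp: closure_step_def)
    then show ?thesis by (simp add: fp)
  qed
  have "subgroup ?T G"
  proof (rule finite_subgroupI)
    fix a b assume "a \<in> ?T" "b \<in> ?T"
    moreover then have "a \<in> carrier G" "b \<in> carrier G" using TS Sc by auto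
    ultimately show "a \<otimes> b \<in> ?T" by (intro closed[of "a \<otimes> b" a b]) auto
  qed (use TS Sc XT U finite_subset[OF TS finS] in auto)
  moreover have "a \<otimes> b \<otimes> inv a \<in> ?T" if "a \<in> S" "b \<in> ?T" for a b
  proof -
    have "a \<in> carrier G" "b \<in> carrier G" using that TS Sc by auto
    moreover from this have "a \<otimes> b \<otimes> inv a \<otimes> a = a \<otimes> b" by (simp add: m_assoc)
    ultimately show ?thesis using closed[of "a \<otimes> b \<otimes> inv a" a b] that by simp
  qed
  ultimately show "?T \<lhd> G\<lparr>carrier := S\<rparr>"
    unfolding normal_in_subgroup_iff[OF S] using TS by auto
qed

text \<open>Descent along a chain leading to \<open>A\<close>: if \<open>S\<close> lies in
  \<open>B\<close> and \<open>A\<close> is normal in \<open>B\<close>, then the normal closure of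
  \<open>U\<close> in \<open>S\<close> stays inside \<open>A\<close>; but this closure is
  \<open>S\<close>.\<close>

lemma fixpoint_least:
  assumes "normal_closure_in S U = S" "S \<subseteq> carrier G" "subnormal A" "U \<subseteq> A"
  shows "S \<subseteq> A"
  using assms(3,4)
proof (induction rule: subnormal.induct)
  case (step B A)
  have "A \<subseteq> B" using step.hyps normal_in_subgroup_iff[OF subnormal_subgroup[OF step.hyps(1)]] by auto
  then have "S \<subseteq> B" using step by auto
  then show ?case
    using normal_closure_in_subset[OF subnormal_subgroup[OF step.hyps(1)] step.hyps(2) _ step.prems] assms(1) by auto
qed (rule assms)

text \<open>The iterates decrease through subnormal subgroups containing \<open>U\<close>, and stop
  at one that is its own normal closure of \<open>U\<close>. Leastness then comes from
  \<open>fixpoint_least\<close>, without intersecting subnormal subgroups.\<close>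

lemma subnormal_closure:
  assumes fin: "finite (carrier G)" and U: "U \<subseteq> carrier G" "U \<noteq> {}"
  shows subset_subnormal_closure: "U \<subseteq> subnormal_closure U"
    and subnormal_subnormal_closure: "subnormal (subnormal_closure U)"
    and subnormal_closure_least: "subnormal A \<Longrightarrow> U \<subseteq> A \<Longrightarrow> subnormal_closure U \<subseteq> A"
proof -
  let ?f = "\<lambda>S. normal_closure_in S U"
  have it: "subnormal ((?f ^^ k) (carrier G)) \<and> U \<subseteq> (?f ^^ k) (carrier G)" for k
  proof (induction k)
    case 0
    then show ?case using U subnormal.carrier by simp
  next
    case (Suc k)
    then show ?case
      using normal_closure_in[OF fin subnormal_subgroup _ U(2)] subnormal.step by simp blast
  qed
  then show "U \<subseteq> subnormal_closure U" "subnormal (subnormal_closure U)"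
    by (simp_all add: subnormal_closure_def)
  have sub: "(?f ^^ k) (carrier G) \<subseteq> carrier G" for k
    using it[of k] subnormal_subgroup subgroup.subset by blast
  have dec: "?f ((?f ^^ k) (carrier G)) \<subseteq> (?f ^^ k) (carrier G)" for k
    using normal_closure_in(2)[OF fin subnormal_subgroup _ U(2), of "(?f ^^ k) (carrier G)"] it[of k]
      normal_in_subgroup_iff[OF subnormal_subgroup] by blast
  have fp: "?f (subnormal_closure U) = subnormal_closure U"
    unfolding subnormal_closure_def
  \<comment> \<open>The chain descends, so the measure counts the elements already lost.\<close>
  proof (rule iterate_fixpoint[where \<mu> = "\<lambda>S. order G - card S"])
    fix k
    show "order G - card ((?f ^^ k) (carrier G)) \<le> order G" by simp
    assume "?f ((?f ^^ k) (carrier G)) \<noteq> (?f ^^ k) (carrier G)"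
    then have "?f ((?f ^^ k) (carrier G)) \<subset> (?f ^^ k) (carrier G)" using dec[of k] by auto
    moreover have f: "finite ((?f ^^ k) (carrier G))" using sub fin finite_subset by blast
    ultimately have "card (?f ((?f ^^ k) (carrier G))) < card ((?f ^^ k) (carrier G))"
      by (intro psubset_card_mono)
    moreover have "card ((?f ^^ k) (carrier G)) \<le> order G"
      unfolding order_def using sub fin by (intro card_mono) auto
    ultimately show "order G - card ((?f ^^ k) (carrier G)) < order G - card (?f ((?f ^^ k) (carrier G)))"
      by linarith
  qed
  show "subnormal A \<Longrightarrow> U \<subseteq> A \<Longrightarrow> subnormal_closure U \<subseteq> A"
    using fp fixpoint_least sub[of "order G"] by (simp add: subnormal_closure_def)
qed

lemma subnormal_closure_eqI:
  assumes fin: "finite (carrier G)" and "normal_closure_in S U = S" "subnormal S" "U \<subseteq> S" "U \<noteq> {}"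
  shows "subnormal_closure U = S"
proof
  have "S \<subseteq> carrier G" using assms(3) subnormal_subgroup subgroup.subset by blast
  then show "subnormal_closure U \<subseteq> S" "S \<subseteq> subnormal_closure U"
    using subnormal_closure[OF fin, of U] fixpoint_least[OF assms(2)] assms(3-5) by auto
qed

end

text \<open>
  For a term \<open>K\<close> of a composition series, every possible next term is the subnormal closure of \<open>K\<close>
  and any one of its elements outside \<open>K\<close>; \<open>next_gen\<close> selects the least of these elements.
\<close>

definition next_gen :: "('a :: linorder, 'b) monoid_scheme \<Rightarrow> 'a set \<Rightarrow> 'a \<Rightarrow> bool" where
  "next_gen G K x \<longleftrightarrow> x \<in> carrier G \<and> x \<notin> K \<and>
     (\<forall>y \<in> group.subnormal_closure G (insert x K).
        y \<in> K \<or> x \<le> y \<and> x \<in> group.subnormal_closure G (insert y K))"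

section \<open>Minimal subnormal overgroups\<close>

context
  fixes G :: "('a :: linorder, 'b) monoid_scheme" (structure)
  assumes grp: "group G" and fin: "finite (carrier G)"
begin

interpretation group G by (rule grp)

abbreviation scl :: "'a set \<Rightarrow> 'a set" where
  "scl U \<equiv> subnormal_closure U"

lemma scl_insert:
  assumes "subnormal K" "x \<in> carrier G"
  shows "K \<subseteq> scl (insert x K)" "x \<in> scl (insert x K)" "subnormal (scl (insert x K))"
    "subnormal A \<Longrightarrow> K \<subseteq> A \<Longrightarrow> x \<in> A \<Longrightarrow> scl (insert x K) \<subseteq> A"
proof -
  have "insert x K \<subseteq> carrier G" using assms subnormal_subgroup subgroup.subset by blast
  then show "K \<subseteq> scl (insert x K)" "x \<in> scl (insert x K)" "subnormal (scl (insert x K))"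
    "subnormal A \<Longrightarrow> K \<subseteq> A \<Longrightarrow> x \<in> A \<Longrightarrow> scl (insert x K) \<subseteq> A"
    using subnormal_closure[OF fin, of "insert x K"] by auto
qed

text \<open>Any \<open>y\<close> of \<open>L\<close> outside \<open>K\<close> generates
  \<open>x\<close> back, by the second clause of \<open>next_gen\<close>. Hence no subnormal
  subgroup lies strictly between \<open>K\<close> and the next term.\<close>

lemma next_gen_minimal:
  assumes K: "subnormal K" and x: "next_gen G K x" and L: "subnormal L" "K \<subset> L" "L \<subseteq> scl (insert x K)"
  shows "L = scl (insert x K)"
proof -
  obtain y where y: "y \<in> L" "y \<notin> K" using L(2) by blast
  have yc: "y \<in> carrier G" using y L(1) subnormal_subgroup subgroup.subset by blast
  have "x \<in> scl (insert y K)" using x y L(3) unfolding next_gen_def by blast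
  moreover have "scl (insert y K) \<subseteq> L" using scl_insert(4)[OF K yc L(1)] y L(2) by blast
  ultimately have "x \<in> L" by blast
  then have "scl (insert x K) \<subseteq> L" using scl_insert(4)[OF K _ L(1)] x L(2) by (auto simp: next_gen_def)
  then show ?thesis using L(3) by blast
qed

text \<open>The normal closure of \<open>K\<close> in the next term is subnormal, so by minimality
  it is \<open>K\<close> or the whole next term. In the latter case \<open>fixpoint_least\<close>
  with \<open>U = K\<close> would force the next term into \<open>K\<close>.\<close>

lemma next_gen_normal:
  assumes K: "subnormal K" and x: "next_gen G K x"
  shows "K \<lhd> G\<lparr>carrier := scl (insert x K)\<rparr>"
proof -
  let ?S = "scl (insert x K)"
  let ?L = "normal_closure_in ?S K"
  have xc: "x \<in> carrier G" "x \<notin> K" using x by (auto simp: next_gen_def)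
  note S = scl_insert[OF K xc(1)]
  have Kne: "K \<noteq> {}" using subnormal_subgroup[OF K] subgroup.one_closed by blast
  note L = normal_closure_in[OF fin subnormal_subgroup[OF S(3)] S(1) Kne]
  have Ls: "subnormal ?L" using subnormal.step[OF S(3) L(2)] .
  have LS: "?L \<subseteq> ?S" using L(2) normal_in_subgroup_iff[OF subnormal_subgroup[OF S(3)]] by blast
  have "?L = K"
  proof (rule ccontr)
    assume "?L \<noteq> K"
    then have "?L = ?S" using L(1) LS next_gen_minimal[OF K x Ls] by blast
    then have "?S \<subseteq> K"
      using fixpoint_least[OF _ subgroup.subset[OF subnormal_subgroup[OF S(3)]] K] by blast
    then show False using S(2) xc(2) by blast
  qed
  then show ?thesis using L(2) by simp
qed

text \<open>A subnormal subgroup of least order properly containing \<open>K\<close> is the closure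
  of \<open>K\<close> and any one of its elements outside \<open>K\<close>; the least such element
  qualifies.\<close>

lemma next_gen_exists:
  assumes K: "subnormal K" "K \<noteq> carrier G"
  shows "\<exists>x. next_gen G K x"
proof -
  let ?P = "\<lambda>A. subnormal A \<and> K \<subset> A"
  have "K \<subseteq> carrier G" using K subnormal_subgroup subgroup.subset by blast
  then have "?P (carrier G)" using K subnormal.carrier by blast
  then obtain A where A: "?P A" and min: "\<And>B. ?P B \<Longrightarrow> card A \<le> card B"
    using ex_has_least_nat[of ?P "carrier G" card] by blast
  have Ac: "A \<subseteq> carrier G" using A subnormal_subgroup subgroup.subset by blast
  have fA: "finite A" using Ac fin finite_subset by blast
  have eq: "scl (insert y K) = A" if "y \<in> A" "y \<notin> K" for y
  proof -
    have yc: "y \<in> carrier G" using that Ac by blast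
    note S = scl_insert[OF K(1) yc]
    have sub: "scl (insert y K) \<subseteq> A" using S(4) A that by blast
    have "?P (scl (insert y K))" using S that by blast
    from card_seteq[OF fA sub min[OF this]] show ?thesis .
  qed
  define x where "x = Min (A - K)"
  have ne: "A - K \<noteq> {}" "finite (A - K)" using A fA by auto
  have x: "x \<in> A" "x \<notin> K" using Min_in[OF ne(2,1)] by (auto simp: x_def)
  have "x \<le> y \<and> x \<in> scl (insert y K)" if "y \<in> A" "y \<notin> K" for y
    using that Min_le[OF ne(2), of y] eq[OF that] x(1) by (simp add: x_def)
  then have "next_gen G K x"
    unfolding next_gen_def eq[OF x] using x Ac by blast
  then show ?thesis ..
qed

section \<open>Composition series as lists of generators\<close>

fun group_of :: "'a list \<Rightarrow> 'a set" where
  "group_of [] = {\<one>}"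
| "group_of (x # xs) = scl (insert x (group_of xs))"

fun series_of :: "'a list \<Rightarrow> 'a set list" where
  "series_of [] = [{\<one>}]"
| "series_of (x # xs) = series_of xs @ [group_of (x # xs)]"

text \<open>A good list is a path in the search tree with the most recent generator in front: the
  children of \<open>xs\<close> are lists \<open>x # xs\<close>, and backtracking takes the
  tail.\<close>

fun good :: "'a list \<Rightarrow> bool" where
  "good [] = True"
| "good (x # xs) = (good xs \<and> next_gen G (group_of xs) x)"

lemma subnormal_one: "subnormal {\<one>}"
proof (rule subnormal.step[OF subnormal.carrier])
  show "{\<one>} \<lhd> G\<lparr>carrier := carrier G\<rparr>"
    unfolding normal_in_subgroup_iff[OF subgroup_self] using triv_subgroup by auto
qed

lemma good_subnormal: "good xs \<Longrightarrow> subnormal (group_of xs)"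
  by (induction xs) (auto simp: subnormal_one next_gen_def intro!: scl_insert)

lemma good_psubset: "good (x # xs) \<Longrightarrow> group_of xs \<subset> group_of (x # xs)"
  using scl_insert(1,2)[OF good_subnormal[of xs], of x] by (auto simp: next_gen_def)

lemma length_series_of [simp]: "length (series_of xs) = Suc (length xs)"
  by (induction xs) auto

lemma series_of_ne [simp]: "series_of xs \<noteq> []"
  using length_series_of[of xs] by (metis list.size(3) nat.simps(3))

lemma last_series_of [simp]: "last (series_of xs) = group_of xs"
  by (cases xs) auto

lemma hd_series_of [simp]: "hd (series_of xs) = {\<one>}"
  by (induction xs) auto

lemma series_of_last_nth: "series_of xs ! length xs = group_of xs"
  using last_conv_nth[of "series_of xs"] by simp

lemma good_series_steps:
  assumes "good xs" "i < length xs"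
  obtains x K where "series_of xs ! i = K" "series_of xs ! Suc i = scl (insert x K)" "subnormal K" "next_gen G K x"
  using assms
proof (induction xs arbitrary: thesis)
  case (Cons y ys)
  show ?case
  proof (cases "i < length ys")
    case True
    obtain x K where "series_of ys ! i = K" "series_of ys ! Suc i = scl (insert x K)" "subnormal K" "next_gen G K x"
      using Cons.IH[OF _ _ True] Cons.prems(2) by auto
    then show ?thesis using Cons.prems(1)[of K x] True by (simp add: nth_append)
  next
    case False
    then have "i = length ys" using Cons.prems(3) by simp
    then show ?thesis
      using Cons.prems(1)[of "group_of ys" y] Cons.prems(2) good_subnormal[of ys]
      by (simp add: nth_append series_of_last_nth)
  qed
qed simp

lemma good_series_subnormal:
  assumes "good xs" "A \<in> set (series_of xs)"
  shows "subnormal A"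
  using assms
  by (induction xs) (auto simp: subnormal_one next_gen_def intro!: scl_insert good_subnormal)

lemma subnormal_series_mono:
  assumes "subnormal_series G Hs" "i \<le> j" "j < length Hs"
  shows "Hs ! i \<subseteq> Hs ! j"
  using assms(2,3)
proof (induction j rule: dec_induct)
  case (step k)
  have "Hs ! k \<lhd> G\<lparr>carrier := Hs ! Suc k\<rparr>" "subgroup (Hs ! Suc k) G"
    using assms(1) step.prems unfolding subnormal_series_def by auto
  then have "Hs ! k \<subseteq> Hs ! Suc k" using normal_in_subgroup_iff by blast
  then show ?case using step by auto
qed simp

text \<open>The induction runs from the top of the series, because \<open>subnormal\<close> is
  generated downwards.\<close>

lemma subnormal_series_subnormal:
  assumes "subnormal_series G Hs" "A \<in> set Hs"
  shows "subnormal A"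
proof -
  let ?l = "length Hs"
  have ne: "?l > 0" using assms(1) by (auto simp: subnormal_series_def)
  have "subnormal (Hs ! (?l - Suc i))" if "i < ?l" for i
    using that
  proof (induction i)
    case 0
    have "Hs ! (?l - Suc 0) = carrier G" using assms(1) ne by (auto simp: subnormal_series_def last_conv_nth)
    then show ?case using subnormal.carrier by simp
  next
    case (Suc i)
    have *: "Suc (?l - Suc (Suc i)) = ?l - Suc i" using Suc.prems by simp
    have "\<forall>i. Suc i < ?l \<longrightarrow> Hs ! i \<lhd> G\<lparr>carrier := Hs ! Suc i\<rparr>"
      using assms(1) by (simp add: subnormal_series_def)
    then have "Hs ! (?l - Suc (Suc i)) \<lhd> G\<lparr>carrier := Hs ! (?l - Suc i)\<rparr>"
      using Suc.prems * by (metis diff_less less_numeral_extra(3) ne zero_less_Suc)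
    then show ?case using Suc subnormal.step[of "Hs ! (?l - Suc i)"] by simp
  qed
  note * = this
  obtain i where i: "i < ?l" "A = Hs ! i" using assms(2) by (metis in_set_conv_nth)
  then show ?thesis using *[of "?l - Suc i"] by simp
qed

text \<open>An additional term \<open>L\<close> of a refinement is comparable with every old term.
  Climbing the series, each term lies in \<open>L\<close>: if \<open>L\<close> contains one term
  properly, it cannot fall short of the next by \<open>next_gen_minimal\<close>. At the top
  \<open>L\<close> is the whole group, which is an old term.\<close>

lemma good_composition_series:
  assumes g: "good xs" and full: "group_of xs = carrier G"
  shows "composition_series G (series_of xs)"
proof -
  let ?Gs = "series_of xs"
  have len: "length ?Gs = Suc (length xs)" by simp
  have "\<forall>A\<in>set ?Gs. subgroup A G" using good_series_subnormal[OF g] subnormal_subgroup by blast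
  moreover have "?Gs ! i \<lhd> G\<lparr>carrier := ?Gs ! Suc i\<rparr>" if "Suc i < length ?Gs" for i
  proof -
    from that have "i < length xs" by simp
    from good_series_steps[OF g this] show ?thesis by (metis next_gen_normal)
  qed
  ultimately have ser: "subnormal_series G ?Gs"
    unfolding subnormal_series_def using full by auto
  have sub: "A \<subseteq> group_of ys" if "good ys" "A \<in> set (series_of ys)" for A ys
    using that
  proof (induction ys)
    case (Cons y ys)
    then show ?case using good_psubset[OF Cons.prems(1)] by auto
  qed simp
  have dist: "distinct (series_of ys)" if "good ys" for ys
    using that
  proof (induction ys)
    case (Cons y ys)
    then have "group_of (y # ys) \<notin> set (series_of ys)"
      using sub[of ys "group_of (y # ys)"] good_psubset[OF Cons.prems] by auto
    then show ?case using Cons by simp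
  qed simp
  have "False" if Hs: "subnormal_series G Hs" "set ?Gs \<subset> set Hs" for Hs
  proof -
    obtain L where L: "L \<in> set Hs" "L \<notin> set ?Gs" using Hs(2) by blast
    have Ls: "subnormal L" using subnormal_series_subnormal[OF Hs(1) L(1)] .
    have comp: "A \<subseteq> L \<or> L \<subseteq> A" if "A \<in> set ?Gs" for A
    proof -
      have "A \<in> set Hs" using that Hs(2) by blast
      then obtain i j where "i < length Hs" "Hs ! i = A" "j < length Hs" "Hs ! j = L"
        using L(1) by (metis in_set_conv_nth)
      then show ?thesis using subnormal_series_mono[OF Hs(1)] by (metis nle_le)
    qed
    have "?Gs ! i \<subseteq> L" if "i \<le> length xs" for i
      using that
    proof (induction i)
      case 0
      have "?Gs ! 0 = {\<one>}" using hd_conv_nth[of ?Gs] by simp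
      then show ?case using subnormal_subgroup[OF Ls] subgroup.one_closed by auto
    next
      case (Suc i)
      then have i: "i < length xs" by simp
      have mem: "?Gs ! i \<in> set ?Gs" "?Gs ! Suc i \<in> set ?Gs" using i by (auto intro!: nth_mem)
      from good_series_steps[OF g i] obtain x K where
        K: "?Gs ! i = K" "?Gs ! Suc i = scl (insert x K)" "subnormal K" "next_gen G K x" .
      have "K \<subset> L" using Suc K(1) mem(1) L(2) by auto
      then show ?case using next_gen_minimal[OF K(3,4) Ls] comp[OF mem(2)] K(2) mem(2) L(2) by metis
    qed
    from this[of "length xs"] have "carrier G \<subseteq> L" using full by (simp add: series_of_last_nth)
    then have "L = group_of xs" using subgroup.subset[OF subnormal_subgroup[OF Ls]] full by auto
    then show False using L(2) last_in_set[OF series_of_ne[of xs]] by simp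
  qed
  then show ?thesis using ser dist[OF g] unfolding composition_series_def by blast
qed

text \<open>The normal closure of the term and \<open>y\<close> inside the following term could be
  inserted between the two if it were smaller than the latter, against maximality. So the following
  term is a fixed point and hence the subnormal closure.\<close>

lemma composition_series_step:
  assumes cs: "composition_series G Hs" and i: "Suc i < length Hs" and y: "y \<in> Hs ! Suc i" "y \<notin> Hs ! i"
  shows "scl (insert y (Hs ! i)) = Hs ! Suc i"
proof -
  let ?A = "Hs ! i" let ?B = "Hs ! Suc i"
  let ?U = "insert y ?A"
  let ?L = "normal_closure_in ?B ?U"
  have ser: "subnormal_series G Hs" and dist: "distinct Hs"
    using cs by (auto simp: composition_series_def)
  have AB: "?A \<lhd> G\<lparr>carrier := ?B\<rparr>" using ser i by (auto simp: subnormal_series_def)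
  have Bs: "subnormal ?B" using i by (intro subnormal_series_subnormal[OF ser]) auto
  note Bg = subnormal_subgroup[OF Bs]
  note A = AB[unfolded normal_in_subgroup_iff[OF Bg]]
  have U: "?U \<subseteq> ?B" "?U \<noteq> {}" using A y by auto
  note L = normal_closure_in[OF fin Bg U]
  note L' = L(2)[unfolded normal_in_subgroup_iff[OF Bg]]
  have AL: "?A \<lhd> G\<lparr>carrier := ?L\<rparr>"
    using A L' L(1) normal_in_subgroup_iff[of ?L ?A] by auto
  have "?L = ?B"
  proof (rule ccontr)
    assume neq: "?L \<noteq> ?B"
    let ?Hs = "take (Suc i) Hs @ ?L # drop (Suc i) Hs"
    \<comment> \<open>Terms up to index \<open>i\<close> lie in \<open>?A\<close> and miss
      \<open>y\<close>; later terms contain \<open>?B\<close>, which is larger than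
      \<open>?L\<close>.\<close>
    have notin: "?L \<notin> set Hs"
    proof
      assume "?L \<in> set Hs"
      then obtain j where j: "j < length Hs" "Hs ! j = ?L" by (metis in_set_conv_nth)
      show False
      proof (cases "j \<le> i")
        case True
        then have "?L \<subseteq> ?A" using subnormal_series_mono[OF ser True] i j by auto
        then show False using L(1) y by auto
      next
        case False
        then have "?B \<subseteq> ?L" using subnormal_series_mono[OF ser, of "Suc i" j] j by auto
        then show False using neq L' by auto
      qed
    qed
    have nth: "?Hs ! j = (if j \<le> i then Hs ! j else if j = Suc i then ?L else Hs ! (j - 1))"
      if "j < length ?Hs" for j
    proof (cases "j \<le> Suc i")
      case False
      then have "Suc (i + (j - Suc (Suc i))) = j - 1" by simp
      then show ?thesis using that i False by (simp add: nth_append nth_Cons' Suc_diff_Suc)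
    qed (use i in \<open>auto simp: nth_append\<close>)
    have set: "set ?Hs = insert ?L (set Hs)"
      by (metis append_take_drop_id list.simps(15) set_append Un_insert_right)
    have "subnormal_series G ?Hs"
      unfolding subnormal_series_def
    proof (intro conjI allI impI)
      have ne: "Hs \<noteq> []" using i by auto
      show "hd ?Hs = {\<one>}" using ser ne by (simp add: subnormal_series_def hd_append)
      show "last ?Hs = carrier G" using ser i by (simp add: subnormal_series_def)
      show "\<forall>A\<in>set ?Hs. subgroup A G" unfolding set using ser L' by (auto simp: subnormal_series_def)
      fix j assume j: "Suc j < length ?Hs"
      have st: "Hs ! k \<lhd> G\<lparr>carrier := Hs ! Suc k\<rparr>" if "Suc k < length Hs" for k
        using ser that by (simp add: subnormal_series_def)
      consider "j < i" | "j = i" | "j = Suc i" | "j > Suc i" by linarith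
      then show "?Hs ! j \<lhd> G\<lparr>carrier := ?Hs ! Suc j\<rparr>"
      proof cases
        case 1
        then have "?Hs ! j = Hs ! j" "?Hs ! Suc j = Hs ! Suc j" using nth[of j] nth[of "Suc j"] j i by auto
        then show ?thesis using st[of j] 1 i by simp
      next
        case 2
        then have "?Hs ! j = ?A" "?Hs ! Suc j = ?L" using nth[of j] nth[of "Suc j"] j by auto
        then show ?thesis using AL by simp
      next
        case 3
        then have "?Hs ! j = ?L" "?Hs ! Suc j = ?B" using nth[of j] nth[of "Suc j"] j by auto
        then show ?thesis using L(2) by simp
      next
        case 4
        then have "?Hs ! j = Hs ! (j - 1)" "?Hs ! Suc j = Hs ! j" using nth[of j] nth[of "Suc j"] j by auto
        moreover have "j < length Hs" using j i by simp
        ultimately show ?thesis using st[of "j - 1"] 4 by simp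
      qed
    qed auto
    moreover have "distinct ?Hs"
    proof -
      have "set (take (Suc i) Hs) \<inter> set (drop (Suc i) Hs) = {}"
        using dist by (rule set_take_disj_set_drop_if_distinct) simp
      then show ?thesis using dist notin by (auto dest: in_set_takeD in_set_dropD)
    qed
    moreover have "set Hs \<subset> set ?Hs" using notin unfolding set by blast
    ultimately show False using cs unfolding composition_series_def by blast
  qed
  then show ?thesis using subnormal_closure_eqI[OF fin _ Bs U] by simp
qed

text \<open>Completeness of the enumeration: by \<open>composition_series_step\<close> every element
  of a term outside its predecessor generates it, so the least such element is an admissible
  generator.\<close>

lemma composition_series_good:
  assumes cs: "composition_series G Hs"
  obtains xs where "good xs" "series_of xs = Hs" "group_of xs = carrier G"
proof -
  have ser: "subnormal_series G Hs" and dist: "distinct Hs"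
    using cs by (auto simp: composition_series_def)
  have ne: "Hs \<noteq> []" using ser by (simp add: subnormal_series_def)
  have "\<exists>xs. good xs \<and> series_of xs = take (Suc i) Hs" if "i < length Hs" for i
    using that
  proof (induction i)
    case 0
    have "take (Suc 0) Hs = [{\<one>}]" using ser ne by (cases Hs) (auto simp: subnormal_series_def)
    then show ?case by (intro exI[of _ "[]"]) simp
  next
    case (Suc i)
    then obtain xs where xs: "good xs" "series_of xs = take (Suc i) Hs" by auto
    let ?A = "Hs ! i" let ?B = "Hs ! Suc i"
    have A: "group_of xs = ?A"
      using last_series_of[of xs] Suc.prems unfolding xs(2) by (simp add: take_Suc_conv_app_nth)
    have "subgroup ?B G" using ser Suc.prems by (auto simp: subnormal_series_def)
    then have Bc: "?B \<subseteq> carrier G" by (rule subgroup.subset)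
    have "?A \<subseteq> ?B" using subnormal_series_mono[OF ser, of i "Suc i"] Suc.prems by simp
    moreover have "?A \<noteq> ?B" using dist Suc.prems by (simp add: nth_eq_iff_index_eq)
    ultimately have ne: "?B - ?A \<noteq> {}" "finite (?B - ?A)" using finite_subset[OF Bc fin] by auto
    define x where "x = Min (?B - ?A)"
    have x: "x \<in> ?B" "x \<notin> ?A" using Min_in[OF ne(2,1)] by (auto simp: x_def)
    note eq = composition_series_step[OF cs Suc.prems]
    have "x \<le> y \<and> x \<in> scl (insert y ?A)" if "y \<in> ?B" "y \<notin> ?A" for y
      using that Min_le[OF ne(2), of y] eq[OF that] x(1) by (simp add: x_def)
    then have "next_gen G ?A x"
      unfolding next_gen_def eq[OF x] using x Bc by blast
    then have "good (x # xs)" "series_of (x # xs) = take (Suc (Suc i)) Hs"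
      using xs A eq[OF x] Suc.prems by (auto simp: take_Suc_conv_app_nth)
    then show ?case by blast
  qed
  from this[of "length Hs - 1"] ne obtain xs where xs: "good xs" "series_of xs = Hs" by auto
  moreover have "group_of xs = carrier G"
    using last_series_of[of xs] ser unfolding xs(2) by (simp add: subnormal_series_def)
  ultimately show ?thesis using that by blast
qed

section \<open>Indices and the number of next terms\<close>

lemma card_subgroup_mult:
  assumes "subgroup A G" "subgroup B G" "A \<subset> B" and p: "\<And>q. Factorial_Ring.prime q \<Longrightarrow> q dvd order G \<Longrightarrow> p \<le> q"
  shows "p * card A \<le> card B"
proof -
  interpret B: group "G\<lparr>carrier := B\<rparr>" using assms(2) by (rule subgroup_imp_group)
  have "subgroup A (G\<lparr>carrier := B\<rparr>)" using assms(1-3) subgroup_incl by auto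
  from B.lagrange[OF this] have "card B = card (rcosets\<^bsub>G\<lparr>carrier := B\<rparr>\<^esub> A) * card A"
    by (simp add: order_def)
  then obtain c where c: "card B = c * card A" ..
  have fB: "finite B" using finite_subset[OF subgroup.subset[OF assms(2)] fin] .
  have "c \<noteq> 1" "c \<noteq> 0" using c psubset_card_mono[OF fB assms(3)] by auto
  then obtain q where q: "Factorial_Ring.prime q" "q dvd c" using prime_factor_nat by blast
  \<comment> \<open>The index divides the order of \<open>B\<close>, hence that of the whole group,
    so its prime divisors are at least \<open>p\<close>.\<close>
  have "c dvd card (rcosets B) * card B" unfolding c by simp
  then have "c dvd order G" unfolding lagrange[OF assms(2)] .
  then have "p \<le> q" using p[OF q(1)] q(2) dvd_trans by blast
  also have "q \<le> c" using q(2) \<open>c \<noteq> 0\<close> by (simp add: dvd_imp_le)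
  finally have "p \<le> c" .
  then show ?thesis using c by simp
qed

text \<open>The sets \<open>?D x\<close> are disjoint and each has at least \<open>card K\<close>
  elements. An element \<open>z\<close> common to \<open>?D x\<close> and \<open>?D x'\<close>
  generates both \<open>x\<close> and \<open>x'\<close>, so each of these lies in the closure of the
  other and is least there.\<close>

lemma card_next_gen:
  assumes K: "subnormal K"
  shows "card {x. next_gen G K x} * card K \<le> order G"
proof -
  let ?V = "{x. next_gen G K x}"
  let ?D = "\<lambda>x. scl (insert x K) - K"
  have Vc: "?V \<subseteq> carrier G" by (auto simp: next_gen_def)
  have fV: "finite ?V" using finite_subset[OF Vc fin] .
  note Ks = subnormal_subgroup[OF K]
  have S: "K \<subset> scl (insert x K)" "subgroup (scl (insert x K)) G" if "x \<in> ?V" for x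
    using scl_insert[OF K, of x] that subnormal_subgroup by (auto simp: next_gen_def)
  have Sc: "?D x \<subseteq> carrier G" if "x \<in> ?V" for x
    using subgroup.subset[OF S(2)[OF that]] by auto
  have one: "x \<le> x'" if x: "x \<in> ?V" "x' \<in> ?V" "z \<in> ?D x" "z \<in> ?D x'" for x x' z
  proof -
    have zc: "z \<in> carrier G" using Sc x by blast
    have "x' \<in> scl (insert z K)" using x by (auto simp: next_gen_def)
    moreover have "scl (insert z K) \<subseteq> scl (insert x K)"
      using scl_insert(4)[OF K zc, of "scl (insert x K)"] scl_insert(1,3)[OF K, of x] x Vc by blast
    moreover have "x' \<notin> K" using x by (auto simp: next_gen_def)
    ultimately show ?thesis using x(1) by (auto simp: next_gen_def)
  qed
  have card: "card K \<le> card (?D x)" if "x \<in> ?V" for x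
  proof -
    \<comment> \<open>Index at least 2 is enough to have \<open>card K\<close> elements outside
      \<open>K\<close>.\<close>
    have "2 * card K \<le> card (scl (insert x K))"
      by (rule card_subgroup_mult[OF Ks S(2)[OF that] S(1)[OF that]]) (auto simp: prime_ge_2_nat)
    moreover have "finite K" using finite_subset[OF subgroup.subset[OF Ks] fin] .
    ultimately show ?thesis using S(1)[OF that] by (subst card_Diff_subset) auto
  qed
  have "card ?V * card K = (\<Sum>x\<in>?V. card K)" by simp
  also have "\<dots> \<le> (\<Sum>x\<in>?V. card (?D x))" using card by (rule sum_mono)
  also have "\<dots> = card (\<Union>x\<in>?V. ?D x)"
  proof (rule card_UN_disjoint[symmetric])
    show "\<forall>i\<in>?V. finite (?D i)" using finite_subset[OF Sc fin] by blast
    show "\<forall>i\<in>?V. \<forall>j\<in>?V. i \<noteq> j \<longrightarrow> ?D i \<inter> ?D j = {}"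
    proof (intro ballI impI equals0I)
      fix i j z assume "i \<in> ?V" "j \<in> ?V" "i \<noteq> j" "z \<in> ?D i \<inter> ?D j"
      then show False using one[of i j z] one[of j i z] by (metis IntD1 IntD2 antisym)
    qed
  qed (rule fV)
  also have "\<dots> \<le> card (carrier G)" using Sc fin by (intro card_mono) auto
  finally show ?thesis by (simp add: order_def)
qed

end

section \<open>Transport of composition series along isomorphisms\<close>

lemma subnormal_series_iso:
  assumes G: "group G" and H: "group H" and \<phi>: "\<phi> \<in> iso G H" and Gs: "subnormal_series G Gs"
  shows "subnormal_series H (map ((`) \<phi>) Gs)"
proof -
  interpret G: group G by (rule G)
  interpret H: group H by (rule H)
  interpret \<phi>: group_hom G H \<phi> using \<phi> by unfold_locales (auto simp: iso_def)
  have sub: "A \<in> set Gs \<Longrightarrow> subgroup A G" for A using Gs by (auto simp: subnormal_series_def)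
  have ne: "Gs \<noteq> []" using Gs by (auto simp: subnormal_series_def)
  have "\<phi> ` A \<lhd> H\<lparr>carrier := \<phi> ` B\<rparr>" if A: "A \<lhd> G\<lparr>carrier := B\<rparr>" and B: "subgroup B G" for A B
    unfolding H.normal_in_subgroup_iff[OF \<phi>.subgroup_img_is_subgroup[OF B]]
  proof (intro conjI ballI)
    note A' = A[unfolded G.normal_in_subgroup_iff[OF B]]
    show "subgroup (\<phi> ` A) H" "\<phi> ` A \<subseteq> \<phi> ` B" using A' \<phi>.subgroup_img_is_subgroup by auto
    fix x h assume "x \<in> \<phi> ` B" "h \<in> \<phi> ` A"
    then obtain b a where ba: "b \<in> B" "x = \<phi> b" "a \<in> A" "h = \<phi> a" by blast
    then have "a \<in> carrier G" "b \<in> carrier G" using A' B subgroup.subset by blast+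
    then have "x \<otimes>\<^bsub>H\<^esub> h \<otimes>\<^bsub>H\<^esub> inv\<^bsub>H\<^esub> x = \<phi> (b \<otimes>\<^bsub>G\<^esub> a \<otimes>\<^bsub>G\<^esub> inv\<^bsub>G\<^esub> b)" using ba by simp
    then show "x \<otimes>\<^bsub>H\<^esub> h \<otimes>\<^bsub>H\<^esub> inv\<^bsub>H\<^esub> x \<in> \<phi> ` A" using A' ba by blast
  qed
  moreover have "\<phi> ` carrier G = carrier H" using \<phi> by (auto simp: iso_def bij_betw_def)
  ultimately show ?thesis
    using Gs ne \<phi>.subgroup_img_is_subgroup by (auto simp: subnormal_series_def hd_map last_map)
qed

text \<open>A proper refinement of the image could be pulled back along the inverse isomorphism.
  Injectivity keeps the terms distinct, so strictness of the inclusion is read off from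
  cardinalities.\<close>

lemma composition_series_iso:
  assumes G: "group G" and H: "group H" and \<phi>: "\<phi> \<in> iso G H" and Gs: "composition_series G Gs"
  shows "composition_series H (map ((`) \<phi>) Gs)"
proof -
  have distinct_image: "distinct (map ((`) f) As)"
    if f: "inj_on f C" and "distinct As" "\<forall>A\<in>set As. A \<subseteq> C" for f :: "'x \<Rightarrow> 'y" and C As
    using that(2,3) inj_on_image_eq_iff[OF f] by (auto simp: distinct_map inj_on_def)
  let ?\<psi> = "inv_into (carrier G) \<phi>"
  have inj: "inj_on \<phi> (carrier G)" and im: "\<phi> ` carrier G = carrier H"
    using \<phi> by (auto simp: iso_def bij_betw_def)
  have ser: "subnormal_series G Gs" and dist: "distinct Gs"
    using Gs by (auto simp: composition_series_def)
  have sub: "\<forall>A\<in>set Gs. A \<subseteq> carrier G"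
    using ser unfolding subnormal_series_def by (blast dest: subgroup.subset)
  have "False" if Hs: "subnormal_series H Hs" "distinct Hs" "set (map ((`) \<phi>) Gs) \<subset> set Hs" for Hs
  proof -
    have subH: "\<forall>A\<in>set Hs. A \<subseteq> carrier H" using Hs(1) unfolding subnormal_series_def by (blast dest: subgroup.subset)
    have inj': "inj_on ?\<psi> (carrier H)" using im by (metis inj_on_inv_into order_refl)
    have s: "subnormal_series G (map ((`) ?\<psi>) Hs)"
      by (rule subnormal_series_iso[OF H G group.iso_set_sym[OF G \<phi>] Hs(1)])
    have d: "distinct (map ((`) ?\<psi>) Hs)" using distinct_image[OF inj' Hs(2) subH] .
    have cancel: "?\<psi> ` \<phi> ` A = A" if "A \<in> set Gs" for A
      using that sub inj by (simp add: inv_into_image_cancel)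
    have "set Gs \<subseteq> set (map ((`) ?\<psi>) Hs)"
    proof
      fix A assume A: "A \<in> set Gs"
      then have "\<phi> ` A \<in> set Hs" using Hs(3) by auto
      then have "?\<psi> ` \<phi> ` A \<in> set (map ((`) ?\<psi>) Hs)" by auto
      then show "A \<in> set (map ((`) ?\<psi>) Hs)" by (simp only: cancel[OF A])
    qed
    moreover have "card (set Gs) < card (set (map ((`) ?\<psi>) Hs))"
    proof -
      have "card (set Gs) = card (set (map ((`) \<phi>) Gs))"
        using distinct_image[OF inj dist sub] dist by (metis distinct_card length_map)
      also have "\<dots> < card (set Hs)" using Hs(3) by (intro psubset_card_mono) auto
      also have "\<dots> = card (set (map ((`) ?\<psi>) Hs))" using d Hs(2) by (metis distinct_card length_map)
      finally show ?thesis .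
    qed
    ultimately have "set Gs \<subset> set (map ((`) ?\<psi>) Hs)" by auto
    then show False using Gs s d unfolding composition_series_def by blast
  qed
  then show ?thesis
    using subnormal_series_iso[OF G H \<phi> ser] distinct_image[OF inj dist sub]
    unfolding composition_series_def by blast
qed

section \<open>The program\<close>

text \<open>
  Registers: 0 answer, 1 order \<open>n\<close>, 2 address before the current table, 3 address of the length of the current
  series, 4 address before the scratch arrays, 5 index of the last term found, 6 candidate generator,
  7 done flag, 16 constant 0.  Term \<open>i\<close> of the current series occupies the \<open>n\<close> cells after
  \<open>r 3 + i * n\<close>; the generators chosen so far are stacked behind four scratch arrays of length \<open>n\<close>.
  Hence the word preceding the current series, the series itself and its length form an oracle query in place.
\<close>

definition Neg :: "expr \<Rightarrow> expr" where "Neg e = Lt e (N 1)"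
definition Truth :: "expr \<Rightarrow> expr" where "Truth e = Lt (N 0) e"
definition Equ :: "expr \<Rightarrow> expr \<Rightarrow> expr" where "Equ a b = Times (Neg (Lt a b)) (Neg (Lt b a))"
definition table :: "expr \<Rightarrow> expr \<Rightarrow> expr" where
  "table a b = Mem (Plus (V 2) (Minus (Plus (Times a (V 1)) b) (V 1)))"
definition scratch :: "nat \<Rightarrow> expr \<Rightarrow> expr" where
  "scratch j z = Plus (V 4) (Plus (Times (N j) (V 1)) z)"
definition series_cell :: "expr \<Rightarrow> expr \<Rightarrow> expr" where
  "series_cell k z = Plus (V 3) (Plus (Times k (V 1)) z)"
definition stack_top :: expr where
  "stack_top = Plus (V 4) (Plus (Times (N 4) (V 1)) (Plus (N 1) (V 5)))"
definition fill :: "expr \<Rightarrow> expr \<Rightarrow> stm" where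
  "fill a e = For 12 (Write a e)"

text \<open>Scratch array 0 holds the group \<open>S\<close>, array 1 the set \<open>T\<close>, and
  array 2 receives \<open>closure_step S T\<close> before it is copied back, so that a round reads
  only old values. Register \<open>w\<close> holds the new generator.\<close>

definition closure_stm :: "nat \<Rightarrow> stm" where
  "closure_stm w = SSeq
     (fill (scratch 0 (V 12)) (N 1))
     (For 10 (SSeq
       (fill (scratch 1 (V 12)) (Truth (Plus (Mem (series_cell (V 5) (V 12))) (Equ (V 12) (V w)))))
       (SSeq
         (For 11 (SSeq
           (fill (scratch 2 (V 12)) (Truth (Plus (Mem (scratch 1 (V 12)))
             (Exi 13 (Exi 14 (Times (Mem (scratch 1 (V 14)))
               (Plus (Times (Mem (scratch 1 (V 13))) (Equ (V 12) (table (V 13) (V 14))))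
                     (Times (Mem (scratch 0 (V 13))) (Equ (table (V 12) (V 13)) (table (V 13) (V 14)))))))))))
           (fill (scratch 1 (V 12)) (Mem (scratch 2 (V 12))))))
         (fill (scratch 0 (V 12)) (Mem (scratch 1 (V 12)))))))"

text \<open>The closure for the candidate is saved in array 3, since computing the closure for each
  \<open>y\<close> (register 8) overwrites the other arrays. Register 9 accumulates the conjunction
  of the conditions in \<open>next_gen\<close>; sums act as disjunctions and products as
  conjunctions.\<close>

definition check_stm :: stm where
  "check_stm = SSeq (closure_stm 6) (SSeq
     (fill (scratch 3 (V 12)) (Mem (scratch 0 (V 12)))) (SSeq
     (Assign 9 (Neg (Mem (series_cell (V 5) (V 6)))))
     (For 8 (SSeq (closure_stm 8)
       (Assign 9 (Truth (Times (V 9) (Plus (Neg (Mem (scratch 3 (V 8))))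
          (Plus (Mem (series_cell (V 5) (V 8)))
             (Times (Neg (Lt (V 8) (V 6))) (Mem (scratch 0 (V 6)))))))))))))"

text \<open>At depth 0 the root is exhausted and the search is done. Otherwise the search resumes
  with the candidate after the popped generator; \<open>stack_top\<close> is read with the depth
  already lowered.\<close>

definition pop_stm :: stm where
  "pop_stm = Ite (V 5)
     (SSeq (Assign 5 (Minus (V 5) (N 1))) (Assign 6 (Plus (Mem stack_top) (N 1))))
     (Assign 7 (N 1))"

definition push_stm :: stm where
  "push_stm = SSeq (fill (series_cell (Plus (V 5) (N 1)) (V 12)) (Mem (scratch 3 (V 12))))
     (SSeq (Write stack_top (V 6)) (SSeq (Assign 5 (Plus (V 5) (N 1))) (Assign 6 (N 1))))"

text \<open>Both searches share this round: for \<open>G\<close> the action at a complete series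
  merely stops, for \<open>H\<close> it consults the oracle and backtracks.\<close>

definition step_stm :: "stm \<Rightarrow> stm" where
  "step_stm leaf = Ite (Neg (Exi 12 (Neg (Mem (series_cell (V 5) (V 12)))))) leaf
     (Ite (Lt (V 1) (V 6)) pop_stm
       (SSeq check_stm (Ite (V 9) push_stm (Assign 6 (Plus (V 6) (N 1))))))"

text \<open>Depth \<open>k\<close> means \<open>k + 1\<close> terms, so the last used cell is
  \<open>r 3 + (k + 1) * n\<close>. The word starts at address 0, hence its length is one
  more.\<close>

definition query_stm :: stm where
  "query_stm = SSeq (Write (V 3) (Plus (V 5) (N 1)))
     (SSeq (Ask 15 (N 0) (series_cell (Plus (V 5) (N 1)) (N 1)))
       (SSeq (Assign 0 (Truth (Plus (V 0) (V 15)))) pop_stm))"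

text \<open>The identity is found as the only idempotent of the group.\<close>

definition trivial_stm :: stm where
  "trivial_stm = SSeq (fill (series_cell (V 5) (V 12)) (Truth (Equ (table (V 12) (V 12)) (V 12)))) (Assign 6 (N 1))"

text \<open>The input has \<open>2 * n * n + 1\<close> cells. Up to \<open>4 * n * n + 3\<close>
  there is room for two length cells and two series of at most \<open>n\<close> terms with
  \<open>n\<close> cells each.\<close>

definition init_stm :: stm where
  "init_stm = SSeq (Assign 1 (Mem (N 0)))
     (SSeq (Assign 3 (Plus (Times (N 2) (Times (V 1) (V 1))) (N 1)))
     (SSeq (Assign 4 (Plus (Times (N 4) (Times (V 1) (V 1))) (N 3))) trivial_stm))"

text \<open>Completes the encoding of the series of \<open>G\<close> by its length, starts the
  second series right behind it, and switches to the table of \<open>H\<close>, which follows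
  address \<open>n * n\<close>.\<close>

definition mid_stm :: stm where
  "mid_stm = SSeq (Write (V 3) (Plus (V 5) (N 1)))
     (SSeq (Assign 3 (series_cell (Plus (V 5) (N 1)) (N 1)))
     (SSeq (Assign 2 (Times (V 1) (V 1)))
     (SSeq (Assign 5 (N 0)) (SSeq (Assign 7 (N 0)) trivial_stm))))"

definition loop_cmd :: "stm \<Rightarrow> cmd" where
  "loop_cmd leaf = While (Equal 7 16) (compile 17 (step_stm leaf))"

definition program :: cmd where
  "program = Seq (compile 17 init_stm) (Seq (loop_cmd (Assign 7 (N 1)))
     (Seq (compile 17 mid_stm) (loop_cmd query_stm)))"

section \<open>Correctness of the blocks in memory\<close>

lemmas stm_defs = Neg_def Truth_def Equ_def table_def scratch_def series_cell_def stack_top_def fill_def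

lemma val_Neg [simp]: "val (Neg e) r m = of_bool (val e r m = 0)"
  and val_Truth [simp]: "val (Truth e) r m = of_bool (val e r m \<noteq> 0)"
  and val_Equ [simp]: "val (Equ a b) r m = of_bool (val a r m = val b r m)"
  and val_table [simp]: "val (table a b) r m = m (r 2 + (val a r m * r 1 + val b r m - r 1))"
  and val_scratch [simp]: "val (scratch j z) r m = r 4 + j * r 1 + val z r m"
  and val_series_cell [simp]: "val (series_cell k z) r m = r 3 + val k r m * r 1 + val z r m"
  and val_stack_top [simp]: "val stack_top r m = r 4 + 4 * r 1 + 1 + r 5"
  by (auto simp: stm_defs)

lemma stm_static:
  "stm_regs (step_stm (Assign 7 (N 1))) \<subseteq> {..<17}" "loops_tame (step_stm (Assign 7 (N 1)))"
  "stm_regs (step_stm query_stm) \<subseteq> {..<17}" "loops_tame (step_stm query_stm)"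
  "stm_regs init_stm \<subseteq> {..<17}" "loops_tame init_stm"
  "stm_regs mid_stm \<subseteq> {..<17}" "loops_tame mid_stm"
  "stm_regs check_stm \<subseteq> {..<17}" "tame check_stm"
  by (auto simp: step_stm_def check_stm_def closure_stm_def pop_stm_def push_stm_def query_stm_def init_stm_def
      trivial_stm_def mid_stm_def stm_defs)

text \<open>The expression is evaluated while the array is partly overwritten; therefore its value
  is required in every memory that agrees with the original one outside the array.\<close>

lemma sem_fill:
  assumes "\<And>z m'. z \<in> {1..r 1} \<Longrightarrow> val a (r(12 := z)) m' = b + z"
    and "\<And>z m'. z \<in> {1..r 1} \<Longrightarrow> (\<And>i. i \<le> b \<or> b + r 1 < i \<Longrightarrow> m' i = m i) \<Longrightarrow>
           val e (r(12 := z)) m' = of_bool (z \<in> A)"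
  obtains r' m' where "sem Q (fill a e) (r, m) = (r', m')" "\<And>i. i \<noteq> 12 \<Longrightarrow> r' i = r i"
    "\<And>i. i \<le> b \<or> b + r 1 < i \<Longrightarrow> m' i = m i"
    "\<And>z. z \<in> {1..r 1} \<Longrightarrow> m' (b + z) = of_bool (z \<in> A)"
proof -
  define I where "I = (\<lambda>j s. (\<forall>i. i \<noteq> 12 \<longrightarrow> fst s i = r i) \<and> (\<forall>i. i \<le> b \<or> b + r 1 < i \<longrightarrow> snd s i = m i) \<and>
     (\<forall>z \<in> {1..j}. snd s (b + z) = of_bool (z \<in> A)))"
  have "I (fst (r, m) 1) (sem Q (For 12 (Write a e)) (r, m))"
  proof (rule sem_For_induct)
    show "I 0 (r, m)" by (simp add: I_def)
    fix j r' m' assume j: "j < fst (r, m) 1" "I j (r', m')"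
    then have "r'(12 := Suc j) = r(12 := Suc j)" by (auto simp: I_def)
    moreover have off: "m' i = m i" if "i \<le> b \<or> b + r 1 < i" for i using j(2) that by (auto simp: I_def)
    ultimately have "sem Q (Write a e) (r'(12 := Suc j), m') = (r(12 := Suc j), m'(b + Suc j := of_bool (Suc j \<in> A)))"
      using assms(1)[of "Suc j" m'] assms(2)[of "Suc j" m', OF _ off] j(1) by simp
    moreover have "I (Suc j) (r(12 := Suc j), m'(b + Suc j := of_bool (Suc j \<in> A)))"
      unfolding I_def
    proof (intro conjI allI ballI impI)
      fix z assume "z \<in> {1..Suc j}"
      then show "snd (r(12 := Suc j), m'(b + Suc j := of_bool (Suc j \<in> A))) (b + z) = of_bool (z \<in> A)"
        using j(2) by (cases "z = Suc j") (auto simp: I_def)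
    qed (use off j(1) in auto)
    ultimately show "I (Suc j) (sem Q (Write a e) (r'(12 := Suc j), m'))" by (simp only:)
  qed
  then have I: "I (r 1) (sem Q (For 12 (Write a e)) (r, m))" by (simp only: fst_conv)
  obtain r' m' where eq: "sem Q (For 12 (Write a e)) (r, m) = (r', m')" by fastforce
  show ?thesis
    by (rule that[unfolded fill_def, OF eq]) (use I in \<open>auto simp: eq I_def simp del: sem.simps\<close>)
qed

text \<open>Serves \<open>G\<close> with the table after address 0, and \<open>H\<close> with the
  table after \<open>n * n\<close> and \<open>hb\<close> behind the stored series of
  \<open>G\<close>. The layout puts the table before the length cell \<open>hb\<close> and leaves
  room for \<open>n\<close> terms up to \<open>sb\<close>.\<close>

locale table_search =
  fixes n :: nat and M :: "nat \<Rightarrow> nat \<Rightarrow> nat" and tb hb sb :: nat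
  assumes grp: "group (table_group n M)" and layout: "tb + n * n < hb" "hb + n * n \<le> sb"
begin

abbreviation "G \<equiv> table_group n M"

sublocale G: group G by (rule grp)

lemma G_simps [simp]: "carrier G = {1..n}" "x \<otimes>\<^bsub>G\<^esub> y = M x y"
  by (simp_all add: table_group_def)

lemma fin: "finite (carrier G)" by simp

lemma order_G [simp]: "order G = n" by (simp add: order_def)

lemma M_closed: "a \<in> {1..n} \<Longrightarrow> b \<in> {1..n} \<Longrightarrow> M a b \<in> {1..n}"
  using G.m_closed[of a b] by simp

lemma idem_iff: "z \<in> {1..n} \<Longrightarrow> M z z = z \<longleftrightarrow> z = \<one>\<^bsub>G\<^esub>"
  using G.l_cancel[of z z "\<one>\<^bsub>G\<^esub>"] G.one_closed G.r_one[of z] G.l_one[of "\<one>\<^bsub>G\<^esub>"]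
  by (auto simp del: G.r_one G.l_one)

lemma n_pos: "1 \<le> n" using G.one_closed by (simp only: G_simps) simp

abbreviation "sub_closure w K \<equiv> G.subnormal_closure (insert w K)"

text \<open>What the blocks read apart from the scratch arrays: the table and the last term found.
  The cell index is \<open>(a - 1) * n + b\<close>, with the truncated subtraction performed last,
  where it is exact.\<close>

definition view :: "(nat \<Rightarrow> nat) \<Rightarrow> (nat \<Rightarrow> nat) \<Rightarrow> nat \<Rightarrow> nat set \<Rightarrow> bool" where
  "view r m k K \<longleftrightarrow> r 1 = n \<and> r 2 = tb \<and> r 3 = hb \<and> r 4 = sb \<and> r 5 = k \<and> k < n \<and>
     (\<forall>a\<in>{1..n}. \<forall>b\<in>{1..n}. m (tb + (a * n + b - n)) = M a b) \<and>
     (\<forall>z\<in>{1..n}. m (hb + k * n + z) = of_bool (z \<in> K))"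

lemma table_addr:
  assumes "a \<in> {1..n}" "b \<in> {1..n}"
  shows "tb + (a * n + b - n) < hb"
proof -
  have "a * n \<le> n * n" using assms by simp
  moreover have "b \<le> n" using assms by simp
  ultimately show ?thesis using layout by linarith
qed

lemma series_addr:
  assumes "k < n" "z \<le> n"
  shows "hb + k * n + z \<le> sb"
proof -
  have "Suc k * n \<le> n * n" using assms by (intro mult_le_mono1) simp
  then show ?thesis using assms layout by simp
qed

lemma view_cong:
  assumes "view r m k K" "\<And>i. i \<in> {1..5} \<Longrightarrow> r' i = r i" "\<And>i. i \<le> sb \<Longrightarrow> m' i = m i"
  shows "view r' m' k K"
proof -
  have k: "k < n" using assms(1) by (simp add: view_def)
  have "m' (tb + (a * n + b - n)) = m (tb + (a * n + b - n))" if "a \<in> {1..n}" "b \<in> {1..n}" for a b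
    using table_addr[OF that] layout by (intro assms(3)) simp
  moreover have "m' (hb + k * n + z) = m (hb + k * n + z)" if "z \<in> {1..n}" for z
    using series_addr[OF k] that by (intro assms(3)) simp
  ultimately show ?thesis using assms(1,2) by (simp add: view_def)
qed

lemma viewD:
  assumes "view r m k K"
  shows "r 1 = n" "r 2 = tb" "r 3 = hb" "r 4 = sb" "r 5 = k" "k < n"
    "z \<in> {1..n} \<Longrightarrow> m (hb + k * n + z) = of_bool (z \<in> K)"
  using assms unfolding view_def by blast+

definition arr :: "(nat \<Rightarrow> nat) \<Rightarrow> nat \<Rightarrow> nat set \<Rightarrow> bool" where
  "arr m j A \<longleftrightarrow> (\<forall>z\<in>{1..n}. m (sb + j * n + z) = of_bool (z \<in> A))"

lemma arrD: "arr m j A \<Longrightarrow> z \<in> {1..n} \<Longrightarrow> m (sb + j * n + z) = of_bool (z \<in> A)"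
  unfolding arr_def by blast

lemma arr_other:
  assumes "arr m j A" "j \<noteq> i" "\<And>c. c \<le> sb + i * n \<or> sb + i * n + n < c \<Longrightarrow> m' c = m c"
  shows "arr m' j A"
proof -
  have "m' (sb + j * n + z) = m (sb + j * n + z)" if "z \<in> {1..n}" for z
  proof (rule assms(3))
    consider "j < i" | "i < j" using assms(2) by linarith
    then show "sb + j * n + z \<le> sb + i * n \<or> sb + i * n + n < sb + j * n + z"
    proof cases
      case 1
      then have "Suc j * n \<le> i * n" by (intro mult_le_mono1) simp
      then show ?thesis using that by auto
    next
      case 2
      then have "Suc i * n \<le> j * n" by (intro mult_le_mono1) simp
      then show ?thesis using that by auto
    qed
  qed
  then show ?thesis using assms(1) by (simp add: arr_def)
qed

lemma sem_fill_scratch: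
  assumes "r 1 = n" "r 4 = sb"
    and "\<And>z m'. z \<in> {1..n} \<Longrightarrow> (\<And>i. i \<le> sb + j * n \<or> sb + j * n + n < i \<Longrightarrow> m' i = m i) \<Longrightarrow>
           val e (r(12 := z)) m' = of_bool (z \<in> A)"
  obtains r' m' where "sem Q (fill (scratch j (V 12)) e) (r, m) = (r', m')" "\<And>i. i \<noteq> 12 \<Longrightarrow> r' i = r i"
    "\<And>i. i \<le> sb + j * n \<or> sb + j * n + n < i \<Longrightarrow> m' i = m i" "arr m' j A"
proof (rule sem_fill[where r = r and m = m and a = "scratch j (V 12)" and b = "sb + j * n" and e = e and A = A and Q = Q])
qed (use assms that in \<open>auto simp: arr_def\<close>)

lemma sem_fill_view:
  assumes v: "view r m k K"
    and e: "\<And>z m'. z \<in> {1..n} \<Longrightarrow> view r m' k K \<Longrightarrow> (\<And>i B. i \<noteq> j \<Longrightarrow> arr m i B \<Longrightarrow> arr m' i B) \<Longrightarrow>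
           val e (r(12 := z)) m' = of_bool (z \<in> A)"
  obtains r' m' where "sem Q (fill (scratch j (V 12)) e) (r, m) = (r', m')" "\<And>i. i \<noteq> 12 \<Longrightarrow> r' i = r i"
    "\<And>i. i \<le> sb + j * n \<or> sb + j * n + n < i \<Longrightarrow> m' i = m i" "arr m' j A"
    "\<And>i B. i \<noteq> j \<Longrightarrow> arr m i B \<Longrightarrow> arr m' i B" "view r' m' k K"
proof -
  have r: "r 1 = n" "r 4 = sb" using v by (auto simp: view_def)
  have e': "val e (r(12 := z)) m' = of_bool (z \<in> A)"
    if "z \<in> {1..n}" and m': "\<And>i. i \<le> sb + j * n \<or> sb + j * n + n < i \<Longrightarrow> m' i = m i" for z m'
    using that(1)
  proof (rule e)
    show "view r m' k K" using v by (rule view_cong) (use m' in auto)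
    show "arr m' i B" if "i \<noteq> j" "arr m i B" for i B using arr_other[OF that(2,1) m'] .
  qed
  obtain r' m' where *: "sem Q (fill (scratch j (V 12)) e) (r, m) = (r', m')" "\<And>i. i \<noteq> 12 \<Longrightarrow> r' i = r i"
    "\<And>i. i \<le> sb + j * n \<or> sb + j * n + n < i \<Longrightarrow> m' i = m i" "arr m' j A"
    by (rule sem_fill_scratch[where r = r and m = m and j = j and e = e and A = A and Q = Q, OF r e']) blast+
  show ?thesis
  proof (rule that[OF *])
    show "arr m' i B" if "i \<noteq> j" "arr m i B" for i B using arr_other[OF that(2,1) *(3)] .
    show "view r' m' k K" using v by (rule view_cong) (use * in auto)
  qed
qed

lemma val_closure_step:
  assumes v: "view r m k K" and S: "arr m 0 S" and T: "arr m 1 T" and z: "z \<in> {1..n}"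
  shows "val (Truth (Plus (Mem (scratch 1 (V 12)))
             (Exi 13 (Exi 14 (Times (Mem (scratch 1 (V 14)))
               (Plus (Times (Mem (scratch 1 (V 13))) (Equ (V 12) (table (V 13) (V 14))))
                     (Times (Mem (scratch 0 (V 13))) (Equ (table (V 12) (V 13)) (table (V 13) (V 14)))))))))) (r(12 := z)) m
    = of_bool (z \<in> G.closure_step S T)" (is "?L = _")
proof -
  have r: "r 1 = n" "r 2 = tb" "r 4 = sb" using v by (auto simp: view_def)
  have t: "m (tb + (a * n + b - n)) = M a b" if "a \<in> {1..n}" "b \<in> {1..n}" for a b
    using v that by (auto simp: view_def)
  have S': "m (sb + a) = of_bool (a \<in> S)" if "a \<in> {1..n}" for a using S that by (auto simp: arr_def)
  have T': "m (sb + n + a) = of_bool (a \<in> T)" if "a \<in> {1..n}" for a using T that by (auto simp: arr_def)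
  have *: "(\<exists>a\<in>{1..n}. \<exists>b\<in>{1..n}. m (sb + n + b) * (m (sb + n + a) * of_bool (z = m (tb + (a * n + b - n))) +
      m (sb + a) * of_bool (m (tb + (z * n + a - n)) = m (tb + (a * n + b - n)))) \<noteq> 0) \<longleftrightarrow>
    (\<exists>a\<in>{1..n}. \<exists>b\<in>{1..n}. b \<in> T \<and> (a \<in> T \<and> z = M a b \<or> a \<in> S \<and> M z a = M a b))"
    by (intro bex_cong refl) (simp add: S' T' t t[OF z])
  have "?L = of_bool (z \<in> T \<or> (\<exists>a\<in>{1..n}. \<exists>b\<in>{1..n}. m (sb + n + b) * (m (sb + n + a) * of_bool (z = m (tb + (a * n + b - n))) +
      m (sb + a) * of_bool (m (tb + (z * n + a - n)) = m (tb + (a * n + b - n)))) \<noteq> 0))"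
    using r T'[OF z] by simp
  also have "\<dots> = of_bool (z \<in> G.closure_step S T)"
    unfolding * using z by (simp only: G.closure_step_def G_simps mem_Collect_eq simp_thms)
  finally show ?thesis .
qed

text \<open>Each of the two nested loops makes \<open>n = order G\<close> rounds, exactly as the
  iterations defining \<open>subnormal_closure\<close> and \<open>normal_closure_in\<close>. The
  restriction on \<open>w\<close> keeps the generator clear of the working registers 10 to
  14.\<close>

lemma sem_closure:
  assumes v: "view r m k K" and w: "r w = x" "x \<in> {1..n}" "w \<in> {6, 8}"
  obtains r' m' where "sem Q (closure_stm w) (r, m) = (r', m')" "\<And>i. i \<notin> {10, 11, 12} \<Longrightarrow> r' i = r i"
    "\<And>i. i \<le> sb \<or> sb + 3 * n < i \<Longrightarrow> m' i = m i" "arr m' 0 (sub_closure x K)"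
proof -
  let ?U = "insert x K"
  define J where "J = (\<lambda>s. (\<forall>i. i \<notin> {10, 11, 12} \<longrightarrow> fst s i = r i) \<and>
     (\<forall>i. i \<le> sb \<or> sb + 3 * n < i \<longrightarrow> snd s i = m i))"
  have viewJ: "view r1 m1 k K" if "J (r1, m1)" for r1 m1
    using v by (rule view_cong) (use that in \<open>auto simp: J_def\<close>)
  have n1: "fst s 1 = n" if "J s" for s using that v by (auto simp: J_def view_def)
  have fillJ: "\<exists>r2 m2. sem Q (fill (scratch j (V 12)) e) s = (r2, m2) \<and> J (r2, m2) \<and> arr m2 j A \<and>
      (\<forall>i B. i \<noteq> j \<longrightarrow> arr (snd s) i B \<longrightarrow> arr m2 i B)"
    if J: "J s" and j: "j < 3"
      and e: "\<And>z m'. z \<in> {1..n} \<Longrightarrow> view (fst s) m' k K \<Longrightarrow> (\<And>i B. i \<noteq> j \<Longrightarrow> arr (snd s) i B \<Longrightarrow> arr m' i B) \<Longrightarrow>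
           val e ((fst s)(12 := z)) m' = of_bool (z \<in> A)" for s j e A
  proof -
    obtain r1 m1 where s: "s = (r1, m1)" by fastforce
    obtain r2 m2 where 2: "sem Q (fill (scratch j (V 12)) e) (r1, m1) = (r2, m2)" "\<And>i. i \<noteq> 12 \<Longrightarrow> r2 i = r1 i"
      "\<And>i. i \<le> sb + j * n \<or> sb + j * n + n < i \<Longrightarrow> m2 i = m1 i" "arr m2 j A"
      "\<And>i B. i \<noteq> j \<Longrightarrow> arr m1 i B \<Longrightarrow> arr m2 i B"
      by (rule sem_fill_view[where r = r1 and m = m1 and k = k and K = K and j = j and e = e and A = A and Q = Q,
            OF viewJ[OF J[unfolded s]] e[unfolded s fst_conv snd_conv]]) blast+
    have "Suc j * n \<le> 3 * n" using j by (intro mult_le_mono1) simp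
    then have "i \<le> sb + j * n \<or> sb + j * n + n < i" if "i \<le> sb \<or> sb + 3 * n < i" for i
      using that unfolding mult_Suc by linarith
    then have "J (r2, m2)" using J 2(2,3) unfolding s J_def by simp
    then show ?thesis using 2(1,4,5) s by auto
  qed
  have lt3: "(0::nat) < 3" "(1::nat) < 3" "(2::nat) < 3" by simp_all
  let ?einit = "Truth (Plus (Mem (series_cell (V 5) (V 12))) (Equ (V 12) (V w)))"
  let ?init = "fill (scratch 1 (V 12)) ?einit"
  let ?estep = "Truth (Plus (Mem (scratch 1 (V 12)))
             (Exi 13 (Exi 14 (Times (Mem (scratch 1 (V 14)))
               (Plus (Times (Mem (scratch 1 (V 13))) (Equ (V 12) (table (V 13) (V 14))))
                     (Times (Mem (scratch 0 (V 13))) (Equ (table (V 12) (V 13)) (table (V 13) (V 14)))))))))"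
  let ?step = "fill (scratch 2 (V 12)) ?estep"
  let ?copy = "fill (scratch 1 (V 12)) (Mem (scratch 2 (V 12)))"
  have r4: "r1 1 = n" "r1 4 = sb" "r1 3 = hb" "r1 5 = k" if "view r1 m1 k K" for r1 m1 using that by (auto simp: view_def)
  have inner: "J (sem Q (For 11 (SSeq ?step ?copy)) s) \<and> arr (snd (sem Q (For 11 (SSeq ?step ?copy)) s)) 0 S \<and>
      arr (snd (sem Q (For 11 (SSeq ?step ?copy)) s)) 1 (G.normal_closure_in S ?U)"
    if s: "J s" "arr (snd s) 0 S" "arr (snd s) 1 ?U" for s S
  proof -
    define I where "I = (\<lambda>j s. J s \<and> arr (snd s) 0 S \<and> arr (snd s) 1 ((G.closure_step S ^^ j) ?U))"
    have "I (fst s 1) (sem Q (For 11 (SSeq ?step ?copy)) s)"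
    proof (rule sem_For_induct)
      show "I 0 s" using s by (simp add: I_def)
      fix j r1 m1 assume "I j (r1, m1)"
      then have i: "J (r1(11 := Suc j), m1)" "arr m1 0 S" "arr m1 1 ((G.closure_step S ^^ j) ?U)"
        by (auto simp: I_def J_def)
      let ?T = "(G.closure_step S ^^ Suc j) ?U"
      have "val ?estep ((fst (r1(11 := Suc j), m1))(12 := z)) m' = of_bool (z \<in> ?T)"
        if "z \<in> {1..n}" "view (fst (r1(11 := Suc j), m1)) m' k K"
          "\<And>i B. i \<noteq> 2 \<Longrightarrow> arr (snd (r1(11 := Suc j), m1)) i B \<Longrightarrow> arr m' i B" for z m'
        using val_closure_step[OF that(2) that(3)[of 0 S] that(3)[of 1 "(G.closure_step S ^^ j) ?U"] that(1)] i(2,3)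
        by (simp del: val_Truth)
      from fillJ[OF i(1) lt3(3) this]
      obtain r2 m2 where 2: "sem Q ?step (r1(11 := Suc j), m1) = (r2, m2)" "J (r2, m2)"
        "arr m2 2 ?T" "\<forall>i B. i \<noteq> 2 \<longrightarrow> arr m1 i B \<longrightarrow> arr m2 i B"
        unfolding snd_conv by blast
      have "val (Mem (scratch 2 (V 12))) ((fst (r2, m2))(12 := z)) m' = of_bool (z \<in> ?T)"
        if "z \<in> {1..n}" "view (fst (r2, m2)) m' k K"
          "\<And>i B. i \<noteq> 1 \<Longrightarrow> arr (snd (r2, m2)) i B \<Longrightarrow> arr m' i B" for z m'
        using that(1) r4[OF that(2)] that(3)[of 2 ?T] 2(3) by (simp add: arr_def)
      from fillJ[OF 2(2) lt3(2) this]
      obtain r3 m3 where 3: "sem Q ?copy (r2, m2) = (r3, m3)" "J (r3, m3)"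
        "arr m3 1 ?T" "\<forall>i B. i \<noteq> 1 \<longrightarrow> arr m2 i B \<longrightarrow> arr m3 i B"
        unfolding snd_conv by blast
      show "I (Suc j) (sem Q (SSeq ?step ?copy) (r1(11 := Suc j), m1))"
        using 2 3 i by (simp add: I_def)
    qed
    then have "I n (sem Q (For 11 (SSeq ?step ?copy)) s)" by (simp only: n1[OF s(1)])
    then show ?thesis unfolding I_def G.normal_closure_in_def order_G .
  qed
  let ?body = "SSeq ?init (SSeq (For 11 (SSeq ?step ?copy)) (fill (scratch 0 (V 12)) (Mem (scratch 1 (V 12)))))"
  have J0: "J (r, m)" by (simp add: J_def)
  obtain r1 m1 where 1: "sem Q (fill (scratch 0 (V 12)) (N 1)) (r, m) = (r1, m1)" "J (r1, m1)" "arr m1 0 {1..n}"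
    using fillJ[OF J0, of 0 "N 1" "{1..n}"] by auto
  define I where "I = (\<lambda>j s. J s \<and> arr (snd s) 0 (((\<lambda>S. G.normal_closure_in S ?U) ^^ j) {1..n}))"
  have "I (fst (r1, m1) 1) (sem Q (For 10 ?body) (r1, m1))"
  proof (rule sem_For_induct)
    show "I 0 (r1, m1)" using 1 by (simp add: I_def)
    fix j r1 m1 assume "I j (r1, m1)"
    define S where "S = ((\<lambda>S. G.normal_closure_in S ?U) ^^ j) {1..n}"
    have i: "J (r1(10 := Suc j), m1)" "arr m1 0 S" using \<open>I j (r1, m1)\<close> by (auto simp: I_def J_def S_def)
    have "(r1(10 := Suc j)) w = x" using i(1) w by (auto simp: J_def)
    then have "val ?einit ((fst (r1(10 := Suc j), m1))(12 := z)) m' = of_bool (z \<in> ?U)"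
      if "z \<in> {1..n}" "view (fst (r1(10 := Suc j), m1)) m' k K" for z m'
      using that w(3) by (auto simp: view_def)
    from fillJ[OF i(1) lt3(2) this]
    obtain r2 m2 where 2: "sem Q ?init (r1(10 := Suc j), m1) = (r2, m2)" "J (r2, m2)"
      "arr m2 1 ?U" "\<forall>i B. i \<noteq> 1 \<longrightarrow> arr m1 i B \<longrightarrow> arr m2 i B"
      unfolding snd_conv by blast
    obtain r3 m3 where 3: "sem Q (For 11 (SSeq ?step ?copy)) (r2, m2) = (r3, m3)" by fastforce
    have t3: "J (r3, m3)" "arr m3 1 (G.normal_closure_in S ?U)"
      using inner[of "(r2, m2)" S] 2 i(2) unfolding 3 by auto
    have "val (Mem (scratch 1 (V 12))) ((fst (r3, m3))(12 := z)) m' = of_bool (z \<in> G.normal_closure_in S ?U)"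
      if "z \<in> {1..n}" "view (fst (r3, m3)) m' k K"
        "\<And>i B. i \<noteq> 0 \<Longrightarrow> arr (snd (r3, m3)) i B \<Longrightarrow> arr m' i B" for z m'
      using that(1) r4[OF that(2)] that(3)[of 1 "G.normal_closure_in S ?U"] t3(2) by (simp add: arr_def)
    from fillJ[OF t3(1) lt3(1) this]
    obtain r4 m4 where 4: "sem Q (fill (scratch 0 (V 12)) (Mem (scratch 1 (V 12)))) (r3, m3) = (r4, m4)" "J (r4, m4)"
      "arr m4 0 (G.normal_closure_in S ?U)"
      unfolding snd_conv by blast
    have "sem Q ?body (r1(10 := Suc j), m1) = (r4, m4)"
      unfolding sem.simps(3) 2(1) 3 4(1) ..
    then show "I (Suc j) (sem Q ?body (r1(10 := Suc j), m1))"
      using 4(2,3) by (simp add: I_def S_def)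
  qed
  then have fin: "I n (sem Q (closure_stm w) (r, m))"
    unfolding closure_stm_def sem.simps(3) 1(1) n1[OF 1(2)] .
  obtain r' m' where *: "sem Q (closure_stm w) (r, m) = (r', m')" by fastforce
  show ?thesis
  proof (rule that[OF *])
    show "r' i = r i" if "i \<notin> {10, 11, 12}" for i using fin that unfolding * I_def J_def fst_conv by blast
    show "m' i = m i" if "i \<le> sb \<or> sb + 3 * n < i" for i using fin that unfolding * I_def J_def snd_conv by blast
    show "arr m' 0 (sub_closure x K)"
      using fin unfolding * I_def snd_conv G.subnormal_closure_def order_G G_simps(1) by blast
  qed
qed

lemma sem_check:
  assumes v: "view r m k K" and x: "r 6 = x" "x \<in> {1..n}" and K: "K \<subseteq> {1..n}"
  obtains r' m' where "sem Q check_stm (r, m) = (r', m')" "\<And>i. i \<notin> {8..12} \<Longrightarrow> r' i = r i"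
    "\<And>i. i \<le> sb \<or> sb + 4 * n < i \<Longrightarrow> m' i = m i" "arr m' 3 (sub_closure x K)"
    "r' 9 = of_bool (next_gen G K x)"
proof -
  define A where "A = sub_closure x K"
  have A: "A \<subseteq> {1..n}"
  proof -
    have "insert x K \<subseteq> carrier G" using K x(2) by simp
    from G.subnormal_subnormal_closure[OF fin this] have "G.subnormal A" unfolding A_def by simp
    from subgroup.subset[OF G.subnormal_subgroup[OF this]] show ?thesis by simp
  qed
  define J where "J = (\<lambda>s. (\<forall>i. i \<notin> {8..12} \<longrightarrow> fst s i = r i) \<and>
     (\<forall>i. i \<le> sb \<or> sb + 4 * n < i \<longrightarrow> snd s i = m i))"
  have viewJ: "view r1 m1 k K" if "J (r1, m1)" for r1 m1
    using v by (rule view_cong) (use that in \<open>auto simp: J_def\<close>)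
  obtain r1 m1 where 1: "sem Q (closure_stm 6) (r, m) = (r1, m1)" "\<And>i. i \<notin> {10, 11, 12} \<Longrightarrow> r1 i = r i"
    "\<And>i. i \<le> sb \<or> sb + 3 * n < i \<Longrightarrow> m1 i = m i" "arr m1 0 A"
    unfolding A_def by (rule sem_closure[OF v x]) auto
  have J1: "J (r1, m1)" using 1 by (auto simp: J_def)
  note v1 = viewJ[OF J1]
  have "val (Mem (scratch 0 (V 12))) (r1(12 := z)) m' = of_bool (z \<in> A)"
    if "z \<in> {1..n}" "view r1 m' k K" "\<And>i B. i \<noteq> 3 \<Longrightarrow> arr m1 i B \<Longrightarrow> arr m' i B" for z m'
    using that(1,2) that(3)[of 0 A] 1(4) by (simp add: arr_def view_def)
  note v2 = this
  obtain r2 m2 where 2: "sem Q (fill (scratch 3 (V 12)) (Mem (scratch 0 (V 12)))) (r1, m1) = (r2, m2)"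
    "\<And>i. i \<noteq> 12 \<Longrightarrow> r2 i = r1 i" "\<And>i. i \<le> sb + 3 * n \<or> sb + 3 * n + n < i \<Longrightarrow> m2 i = m1 i"
    "arr m2 3 A" "view r2 m2 k K"
    by (rule sem_fill_view[where Q = Q and j = 3, OF v1 v2]) blast+
  have J2: "J (r2, m2)" using J1 2(2,3) by (auto simp: J_def)
  let ?r3 = "r2(9 := val (Neg (Mem (series_cell (V 5) (V 6)))) r2 m2)"
  let ?ok = "\<lambda>y. y \<notin> A \<or> y \<in> K \<or> x \<le> y \<and> x \<in> sub_closure y K"
  let ?e = "Truth (Times (V 9) (Plus (Neg (Mem (scratch 3 (V 8))))
          (Plus (Mem (series_cell (V 5) (V 8))) (Times (Neg (Lt (V 8) (V 6))) (Mem (scratch 0 (V 6)))))))"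
  let ?body = "SSeq (closure_stm 8) (Assign 9 ?e)"
  define I where "I = (\<lambda>j s. J s \<and> arr (snd s) 3 A \<and> fst s 9 = of_bool (x \<notin> K \<and> (\<forall>y\<in>{1..j}. ?ok y)))"
  have r6: "r1 6 = x" if "J (r1, m1)" for r1 m1 using that x by (auto simp: J_def)
  have n1: "?r3 1 = n" using 2(5) by (simp add: view_def)
  have "I (fst (?r3, m2) 1) (sem Q (For 8 ?body) (?r3, m2))"
  proof (rule sem_For_induct)
    have "m2 (hb + k * n + x) = of_bool (x \<in> K)" using 2(5) x by (simp add: view_def)
    then show "I 0 (?r3, m2)" using J2 2(4,5) r6[OF J2] by (auto simp: I_def J_def view_def)
    fix j r3 m3 assume j: "j < fst (?r3, m2) 1" "I j (r3, m3)"
    let ?y = "Suc j"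
    have y: "?y \<in> {1..n}" using j(1) n1 by simp
    have J3: "J (r3(8 := ?y), m3)" using j(2) by (auto simp: I_def J_def)
    obtain r4 m4 where 4: "sem Q (closure_stm 8) (r3(8 := ?y), m3) = (r4, m4)"
      "\<And>i. i \<notin> {10, 11, 12} \<Longrightarrow> r4 i = (r3(8 := ?y)) i"
      "\<And>i. i \<le> sb \<or> sb + 3 * n < i \<Longrightarrow> m4 i = m3 i" "arr m4 0 (sub_closure ?y K)"
      by (rule sem_closure[OF viewJ[OF J3], of 8 ?y]) (use y in auto)
    have J4: "J (r4, m4)" using J3 4(2,3) by (auto simp: J_def)
    \<comment> \<open>The inner closure writes only to arrays 0 to 2.\<close>
    have A4: "arr m4 3 A" using j(2) 4(3) by (auto simp: I_def arr_def)
    have "r4 8 = ?y" "r4 9 = of_bool (x \<notin> K \<and> (\<forall>y\<in>{1..j}. ?ok y))" using 4(2) j(2) by (auto simp: I_def)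
    moreover have "m4 (hb + k * n + ?y) = of_bool (?y \<in> K)" "r4 1 = n" "r4 3 = hb" "r4 4 = sb" "r4 5 = k"
      using viewD[OF viewJ[OF J4]] y by blast+
    moreover have "m4 (sb + 3 * n + ?y) = of_bool (?y \<in> A)" "m4 (sb + x) = of_bool (x \<in> sub_closure ?y K)"
      using arrD[OF A4 y] arrD[OF 4(4) x(2)] by simp_all
    moreover have "{1..?y} = insert ?y {1..j}" by auto
    ultimately have "val ?e r4 m4 = of_bool (x \<notin> K \<and> (\<forall>y\<in>{1..?y}. ?ok y))"
      using r6[OF J4] by (auto simp: not_less)
    then show "I (Suc j) (sem Q ?body (r3(8 := ?y), m3))"
      using J4 A4 unfolding sem.simps(1,3) 4(1) by (simp add: I_def J_def del: val.simps val_Truth)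
  qed
  then have I: "I n (sem Q check_stm (r, m))"
    unfolding check_stm_def sem.simps(1,3) 1(1) 2(1) fst_conv snd_conv n1 .
  obtain r' m' where *: "sem Q check_stm (r, m) = (r', m')" by fastforce
  \<comment> \<open>The loop visits all elements; those outside the closure \<open>A\<close> pass by
    the first alternative of \<open>?ok\<close>.\<close>
  have "(x \<notin> K \<and> (\<forall>y\<in>{1..n}. ?ok y)) \<longleftrightarrow> next_gen G K x"
    unfolding next_gen_def A_def[symmetric] G_simps(1) using A x(2) by blast
  note gen = this
  show ?thesis
  proof (rule that[OF *])
    show "r' i = r i" if "i \<notin> {8..12}" for i using I that unfolding * I_def J_def fst_conv by blast
    show "m' i = m i" if "i \<le> sb \<or> sb + 4 * n < i" for i using I that unfolding * I_def J_def snd_conv by blast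
    show "arr m' 3 (sub_closure x K)" using I unfolding * I_def snd_conv A_def by blast
    show "r' 9 = of_bool (next_gen G K x)" using I unfolding * I_def fst_conv gen by blast
  qed
qed

end

section \<open>Depth-first search\<close>

lemma concat_cells:
  assumes "\<And>i z. i < length As \<Longrightarrow> z \<in> {1..n} \<Longrightarrow> m (h + i * n + z) = of_bool (z \<in> As ! i)"
  shows "map m [h + 1..<h + length As * n + 1] =
    concat (map (\<lambda>A. map (\<lambda>x. if x \<in> A then 1 else 0) [1..<n + 1]) As)"
  using assms
proof (induction As rule: rev_induct)
  case (snoc A As)
  have IH: "map m [h + 1..<h + length As * n + 1] =
    concat (map (\<lambda>A. map (\<lambda>x. if x \<in> A then 1 else 0) [1..<n + 1]) As)"
  proof (rule snoc.IH)
    fix i z assume "i < length As" "z \<in> {1..n}"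
    then show "m (h + i * n + z) = of_bool (z \<in> As ! i)" using snoc.prems[of i z] by (simp add: nth_append)
  qed
  have new: "m (h + length As * n + z) = of_bool (z \<in> A)" if "z \<in> {1..n}" for z
    using snoc.prems[of "length As" z] that by simp
  have "[h + 1..<h + length (As @ [A]) * n + 1] =
      [h + 1..<h + length As * n + 1] @ [h + length As * n + 1..<h + length As * n + 1 + n]"
    using upt_add_eq_append[of "h + 1" "h + length As * n + 1" n] by (simp add: ac_simps)
  moreover have "map m [h + length As * n + 1..<h + length As * n + 1 + n] = map (\<lambda>x. if x \<in> A then 1 else 0) [1..<n + 1]"
  proof (rule nth_equalityI)
    fix i assume "i < length (map m [h + length As * n + 1..<h + length As * n + 1 + n])"
    then show "map m [h + length As * n + 1..<h + length As * n + 1 + n] ! i = map (\<lambda>x. if x \<in> A then 1 else 0) [1..<n + 1] ! i"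
      using new[of "Suc i"] by (simp del: upt_Suc)
  qed simp
  ultimately show ?case using IH by simp
qed simp

text \<open>The components are the path of generators, the candidate to be tried next, the answer so
  far and the done flag.\<close>

type_synonym conf = "nat list \<times> nat \<times> bool \<times> bool"

fun backtrack :: "nat list \<Rightarrow> bool \<Rightarrow> conf" where
  "backtrack [] f = ([], 0, f, True)"
| "backtrack (y # ys) f = (ys, Suc y, f, False)"

text \<open>Finished configurations are fixed, so iterating longer than necessary does no
  harm.\<close>

definition dfs_step :: "nat monoid \<Rightarrow> (nat list \<Rightarrow> bool \<Rightarrow> conf) \<Rightarrow> conf \<Rightarrow> conf" where
  "dfs_step G leaf = (\<lambda>(ys, x, f, d).
     if d then (ys, x, f, d)
     else if group_of G ys = carrier G then leaf ys f
     else if card (carrier G) < x then backtrack ys f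
     else if next_gen G (group_of G ys) x then (x # ys, 1, f, False)
     else (ys, Suc x, f, False))"

definition finished :: "conf \<Rightarrow> bool" where
  "finished = (\<lambda>(ys, x, f, d). d)"

section \<open>Machine states representing search configurations\<close>

context table_search
begin

lemmas group_of_simps [simp] = group_of.simps[OF grp fin]
lemmas series_of_simps [simp] = series_of.simps[OF grp fin]
lemmas good_simps [simp] = good.simps[OF grp fin]

lemma good_sub: "good G ys \<Longrightarrow> G.subnormal (group_of G ys)"
  by (rule good_subnormal[OF grp fin])

lemma good_subset: "good G ys \<Longrightarrow> group_of G ys \<subseteq> {1..n}"
  using subgroup.subset[OF G.subnormal_subgroup[OF good_sub]] by simp

lemma good_finite: "good G ys \<Longrightarrow> finite (group_of G ys)"
  using finite_subset[OF good_subset] by simp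

lemma good_card_less: "good G (y # ys) \<Longrightarrow> card (group_of G ys) < card (group_of G (y # ys))"
  using psubset_card_mono[OF good_finite good_psubset[OF grp fin]] by blast

lemma good_card_le: "good G ys \<Longrightarrow> card (group_of G ys) \<le> n"
  using card_mono[OF _ good_subset] by fastforce

lemma good_length: "good G ys \<Longrightarrow> length ys < card (group_of G ys)"
proof (induction ys)
  case (Cons y ys)
  then show ?case using good_card_less[OF Cons.prems] by simp
qed simp

lemma good_length_less: "good G ys \<Longrightarrow> length ys < n"
  using good_length good_card_le by (meson less_le_trans)

lemma good_hd: "good G (y # ys) \<Longrightarrow> y \<in> {1..n}"
  by (simp add: next_gen_def)

lemma series_of_nth_Cons: "i \<le> length ys \<Longrightarrow> series_of G (y # ys) ! i = series_of G ys ! i"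
  using length_series_of[OF grp fin, of ys] by (simp add: nth_append)

definition cells :: "(nat \<Rightarrow> nat) \<Rightarrow> nat list \<Rightarrow> bool" where
  "cells m ys \<longleftrightarrow> (\<forall>i\<le>length ys. \<forall>z\<in>{1..n}. m (hb + i * n + z) = of_bool (z \<in> series_of G ys ! i)) \<and>
     (\<forall>i<length ys. m (sb + 4 * n + 1 + i) = rev ys ! i)"

text \<open>The word \<open>w\<close> precedes the current series: it is the input in the first
  search, and the input with the encoded series of \<open>G\<close> in the second. The length cell
  \<open>hb\<close> is left open up to the bound, since it is filled in only when the word is
  needed. The bound \<open>B\<close> makes all rounds equally expensive.\<close>

definition path_inv :: "nat list \<Rightarrow> nat \<Rightarrow> nat list \<Rightarrow> bool \<Rightarrow> state \<Rightarrow> bool" where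
  "path_inv w B ys f s \<longleftrightarrow> good G ys \<and> view (fst s) (snd s) (length ys) (group_of G ys) \<and> cells (snd s) ys \<and>
     map (snd s) [0..<hb] = w \<and> fst s 0 = of_bool f \<and> fst s 16 = 0 \<and> bounded 17 B s"

definition conf_inv :: "nat list \<Rightarrow> nat \<Rightarrow> conf \<Rightarrow> state \<Rightarrow> bool" where
  "conf_inv w B = (\<lambda>(ys, x, f, d) s. path_inv w B ys f s \<and> fst s 7 = of_bool d \<and>
     (\<not> d \<longrightarrow> fst s 6 = x \<and> 1 \<le> x \<and> x \<le> n + 1))"

lemma path_inv_cong:
  assumes p: "path_inv w B ys f (r, m)" and r: "\<And>i. i \<in> {0..5} \<union> {16} \<Longrightarrow> r' i = r i"
    and m: "\<And>i. i \<le> sb \<or> sb + 4 * n < i \<Longrightarrow> m' i = m i" and b: "bounded 17 B (r', m')"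
  shows "path_inv w B ys f (r', m')"
proof -
  have l: "length ys < n" using p good_length_less by (auto simp: path_inv_def)
  have "view r m (length ys) (group_of G ys)" using p by (simp add: path_inv_def)
  then have "view r' m' (length ys) (group_of G ys)"
    by (rule view_cong) (use r m in auto)
  moreover have "cells m' ys"
    unfolding cells_def
  proof (intro conjI allI ballI impI)
    fix i z assume "i \<le> length ys" "z \<in> {1..n}"
    then have "m' (hb + i * n + z) = m (hb + i * n + z)"
      using series_addr[of i z] l by (intro m) auto
    then show "m' (hb + i * n + z) = of_bool (z \<in> series_of G ys ! i)"
      using p \<open>i \<le> length ys\<close> \<open>z \<in> {1..n}\<close> unfolding path_inv_def cells_def by simp
  next
    fix i assume "i < length ys"
    moreover have "m' (sb + 4 * n + 1 + i) = m (sb + 4 * n + 1 + i)" by (rule m) simp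
    ultimately show "m' (sb + 4 * n + 1 + i) = rev ys ! i" using p by (simp add: path_inv_def cells_def)
  qed
  moreover have "map m' [0..<hb] = w"
  proof -
    have "map m' [0..<hb] = map m [0..<hb]" using m layout by simp
    also have "\<dots> = w" using p by (simp add: path_inv_def)
    finally show ?thesis .
  qed
  ultimately show ?thesis using p r b by (simp add: path_inv_def)
qed

lemma conf_inv_cong:
  assumes "conf_inv w B c (r, m)" "\<And>i. i < 17 \<Longrightarrow> r' i = r i"
  shows "conf_inv w B c (r', m)"
proof -
  obtain ys x f d where c: "c = (ys, x, f, d)" by (cases c) auto
  have "path_inv w B ys f (r, m)" using assms(1) by (simp add: conf_inv_def c)
  then have "path_inv w B ys f (r', m)"
  proof (rule path_inv_cong)
    show "bounded 17 B (r', m)" using assms by (auto simp: conf_inv_def c path_inv_def bounded_def)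
  qed (use assms(2) in auto)
  then show ?thesis using assms by (auto simp: conf_inv_def c)
qed

lemma sem_pop:
  assumes p: "path_inv w B ys f (r, m)" and d: "r 7 = 0" and B: "sb + n + 2 \<le> B"
  shows "conf_inv w B (backtrack ys f) (sem Q pop_stm (r, m))"
proof (cases ys)
  case Nil
  have v: "view r m 0 (group_of G [])" using p Nil by (simp add: path_inv_def)
  have "sem Q pop_stm (r, m) = (r(7 := 1), m)" using viewD(5)[OF v] by (simp add: pop_stm_def)
  moreover have "path_inv w B ys f (r(7 := 1), m)"
    using p by (rule path_inv_cong) (use p B in \<open>auto simp: path_inv_def intro!: bounded_upd\<close>)
  ultimately show ?thesis using Nil by (simp add: conf_inv_def)
next
  case (Cons y zs)
  have g: "good G (y # zs)" "good G zs" using p Cons by (auto simp: path_inv_def)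
  have v: "view r m (Suc (length zs)) (group_of G ys)" using p Cons by (simp add: path_inv_def)
  have c: "cells m ys" using p by (simp add: path_inv_def)
  have "m (sb + 4 * n + 1 + length zs) = rev ys ! length zs"
    using c Cons by (simp only: cells_def) simp
  then have y: "m (sb + 4 * n + 1 + length zs) = y" using Cons by (simp add: nth_append)
  let ?r = "r(5 := length zs, 6 := Suc y)"
  have "sem Q pop_stm (r, m) = (?r, m)"
    using viewD(1-5)[OF v] y by (simp add: pop_stm_def)
  moreover have "path_inv w B zs f (?r, m)"
  proof -
    have cz: "cells m zs"
      unfolding cells_def
    proof (intro conjI allI ballI impI)
      fix i z assume i: "i \<le> length zs" "z \<in> {1..n}"
      then have "m (hb + i * n + z) = of_bool (z \<in> series_of G ys ! i)" using c Cons unfolding cells_def by simp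
      then show "m (hb + i * n + z) = of_bool (z \<in> series_of G zs ! i)"
        using series_of_nth_Cons[OF i(1)] Cons by simp
    next
      fix i assume i: "i < length zs"
      then have "m (sb + 4 * n + 1 + i) = rev ys ! i" using c Cons unfolding cells_def by simp
      then show "m (sb + 4 * n + 1 + i) = rev zs ! i" using i Cons by (simp add: nth_append)
    qed
    moreover have "view ?r m (length zs) (group_of G zs)"
    proof -
      have "m (hb + length zs * n + z) = of_bool (z \<in> group_of G zs)" if "z \<in> {1..n}" for z
        using cz that series_of_last_nth[OF grp fin, of zs] unfolding cells_def by simp
      then show ?thesis using v by (simp add: view_def)
    qed
    moreover have "bounded 17 B (?r, m)"
      using p B good_hd[OF g(1)] good_length_less[OF g(2)] by (auto simp: path_inv_def intro!: bounded_upd)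
    ultimately show ?thesis using p g by (simp add: path_inv_def)
  qed
  ultimately show ?thesis using Cons d good_hd[OF g(1)] by (simp add: conf_inv_def)
qed

text \<open>A good list has fewer than \<open>n\<close> generators, so the new term still ends at or
  before \<open>sb\<close> and does not touch array 3, from which it is copied.\<close>

lemma sem_push:
  assumes p: "path_inv w B ys f (r, m)" and d: "r 7 = 0" and B: "sb + n + 2 \<le> B"
    and x: "r 6 = x" "next_gen G (group_of G ys) x" and A: "arr m 3 (sub_closure x (group_of G ys))"
  shows "conf_inv w B (x # ys, 1, f, False) (sem Q push_stm (r, m))"
proof -
  let ?k = "length ys"
  have g: "good G (x # ys)" using p x by (simp add: path_inv_def)
  have k: "Suc ?k < n" using good_length_less[OF g] by simp
  have v: "view r m ?k (group_of G ys)" using p by (simp add: path_inv_def)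
  have c: "cells m ys" using p by (simp add: path_inv_def)
  note r = viewD(1-5)[OF v]
  have top: "hb + Suc ?k * n + n \<le> sb" using series_addr[OF k, of n] by simp
  obtain r1 m1 where 1: "sem Q (fill (series_cell (Plus (V 5) (N 1)) (V 12)) (Mem (scratch 3 (V 12)))) (r, m) = (r1, m1)"
    "\<And>i. i \<noteq> 12 \<Longrightarrow> r1 i = r i"
    "\<And>i. i \<le> hb + Suc ?k * n \<or> hb + Suc ?k * n + r 1 < i \<Longrightarrow> m1 i = m i"
    "\<And>z. z \<in> {1..r 1} \<Longrightarrow> m1 (hb + Suc ?k * n + z) = of_bool (z \<in> group_of G (x # ys))"
  proof (rule sem_fill[where r = r and m = m and b = "hb + Suc ?k * n" and A = "group_of G (x # ys)" and Q = Q
        and a = "series_cell (Plus (V 5) (N 1)) (V 12)" and e = "Mem (scratch 3 (V 12))"])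
    fix z m' assume z: "z \<in> {1..r 1}" and m': "\<And>i. i \<le> hb + Suc ?k * n \<or> hb + Suc ?k * n + r 1 < i \<Longrightarrow> m' i = m i"
    have "m' (sb + 3 * n + z) = m (sb + 3 * n + z)" using z top r by (intro m') auto
    then show "val (Mem (scratch 3 (V 12))) (r(12 := z)) m' = of_bool (z \<in> group_of G (x # ys))"
      using arrD[OF A, of z] z r by simp
  qed (use r in auto)
  let ?r = "r1(5 := Suc ?k, 6 := 1)"
  let ?m = "m1(sb + 4 * n + 1 + ?k := x)"
  have "sem Q push_stm (r, m) = (?r, ?m)"
    unfolding push_stm_def sem.simps(3) 1(1) using 1(2) r x(1) by simp
  moreover have "path_inv w B (x # ys) f (?r, ?m)"
  proof -
    have old: "?m i = m i" if "i \<le> hb + Suc ?k * n" for i using 1(3)[of i] that top by simp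
    have new: "?m (hb + Suc ?k * n + z) = of_bool (z \<in> group_of G (x # ys))" if "z \<in> {1..n}" for z
      using 1(4)[of z] that top r(1) by simp
    have "view ?r ?m (length (x # ys)) (group_of G (x # ys))"
    proof -
      have "?m (tb + (a * n + b - n)) = M a b" if "a \<in> {1..n}" "b \<in> {1..n}" for a b
        using v table_addr[OF that] that by (subst old) (auto simp: view_def)
      then show ?thesis using new r 1(2) k unfolding view_def by simp
    qed
    moreover have "cells ?m (x # ys)"
      unfolding cells_def
    proof (intro conjI allI ballI impI)
      fix i z assume i: "i \<le> length (x # ys)" "z \<in> {1..n}"
      show "?m (hb + i * n + z) = of_bool (z \<in> series_of G (x # ys) ! i)"
      proof (cases "i = Suc ?k")
        case True
        then show ?thesis using new[OF i(2)] series_of_last_nth[OF grp fin, of "x # ys"] by simp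
      next
        case False
        then have i': "i \<le> ?k" using i(1) by simp
        have "i * n \<le> ?k * n" using i' by (rule mult_le_mono1)
        then have "hb + i * n + z \<le> hb + Suc ?k * n"
          using i(2)[unfolded atLeastAtMost_iff] unfolding mult_Suc by linarith
        then have "?m (hb + i * n + z) = m (hb + i * n + z)" by (rule old)
        then show ?thesis using c i(2) i' series_of_nth_Cons[OF i'] unfolding cells_def by simp
      qed
    next
      fix i assume i: "i < length (x # ys)"
      show "?m (sb + 4 * n + 1 + i) = rev (x # ys) ! i"
      proof (cases "i = ?k")
        case False
        then have "i < ?k" using i by simp
        moreover have "?m (sb + 4 * n + 1 + i) = m (sb + 4 * n + 1 + i)"
          using False top r(1) 1(3)[of "sb + 4 * n + 1 + i"] by simp
        ultimately show ?thesis using c unfolding cells_def by (simp add: nth_append)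
      qed (simp add: nth_append)
    qed
    moreover have "map ?m [0..<hb] = w"
    proof -
      have "map ?m [0..<hb] = map m [0..<hb]" by (rule map_cong[OF refl], rule old) simp
      also have "\<dots> = w" using p by (simp add: path_inv_def)
      finally show ?thesis .
    qed
    moreover have "bounded 17 B (?r, ?m)"
    proof -
      have "tame (fill (series_cell (Plus (V 5) (N 1)) (V 12)) (Mem (scratch 3 (V 12))))"
        "stm_regs (fill (series_cell (Plus (V 5) (N 1)) (V 12)) (Mem (scratch 3 (V 12)))) \<subseteq> {..<17}"
        by (auto simp: stm_defs)
      from bounded_sem_tame[OF _ this, of B "(r, m)" Q] have "bounded 17 B (r1, m1)"
        using p B unfolding 1(1) by (simp add: path_inv_def)
      moreover have "x \<le> B" using good_hd[OF g] B by simp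
      ultimately have "bounded 17 B (r1, ?m)" by (simp add: bounded_def)
      then show ?thesis using B k by (intro bounded_upd) auto
    qed
    ultimately show ?thesis using p g 1(2) by (simp add: path_inv_def)
  qed
  ultimately show ?thesis using d 1(2) by (simp add: conf_inv_def)
qed

lemma sem_step:
  assumes cinv: "conf_inv w B (ys, x, f, False) (r, m)" and B: "sb + n + 2 \<le> B"
    and leaf: "group_of G ys = carrier G \<Longrightarrow> conf_inv w B (lf ys f) (sem Q leaf (r, m))"
  shows "conf_inv w B (dfs_step G lf (ys, x, f, False)) (sem Q (step_stm leaf) (r, m))"
proof -
  let ?K = "group_of G ys"
  have p: "path_inv w B ys f (r, m)" and d: "r 7 = 0" and x: "r 6 = x" "1 \<le> x" "x \<le> n + 1"
    using cinv by (auto simp: conf_inv_def)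
  have g: "good G ys" and v: "view r m (length ys) ?K" using p by (auto simp: path_inv_def)
  note r = viewD(1-5)[OF v]
  have "val (Neg (Exi 12 (Neg (Mem (series_cell (V 5) (V 12)))))) r m = of_bool (\<forall>z\<in>{1..n}. z \<in> ?K)"
    using viewD(7)[OF v] r by auto
  also have "(\<forall>z\<in>{1..n}. z \<in> ?K) \<longleftrightarrow> ?K = carrier G" using good_subset[OF g] by auto
  finally have full: "val (Neg (Exi 12 (Neg (Mem (series_cell (V 5) (V 12)))))) r m = of_bool (?K = carrier G)" .
  show ?thesis
  proof (cases "?K = carrier G")
    case True
    then show ?thesis using leaf full by (simp add: step_stm_def dfs_step_def del: val_Neg)
  next
    case nf: False
    show ?thesis
    proof (cases "n < x")
      case True
      then show ?thesis using nf full sem_pop[OF p d B] x(1) r(1) by (simp add: step_stm_def dfs_step_def del: val_Neg)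
    next
      case False
      then have xn: "x \<in> {1..n}" using x by simp
      obtain r1 m1 where 1: "sem Q check_stm (r, m) = (r1, m1)" "\<And>i. i \<notin> {8..12} \<Longrightarrow> r1 i = r i"
        "\<And>i. i \<le> sb \<or> sb + 4 * n < i \<Longrightarrow> m1 i = m i" "arr m1 3 (sub_closure x ?K)"
        "r1 9 = of_bool (next_gen G ?K x)"
        by (rule sem_check[OF v x(1) xn good_subset[OF g]]) blast
      have b: "bounded 17 B (r1, m1)"
        using bounded_sem_tame[OF _ stm_static(10,9), of B "(r, m)" Q] p B unfolding 1(1) by (simp add: path_inv_def)
      have p1: "path_inv w B ys f (r1, m1)"
        using p by (rule path_inv_cong) (use 1(2,3) b in auto)
      have eq: "sem Q (step_stm leaf) (r, m) =
          (if next_gen G ?K x then sem Q push_stm (r1, m1) else (r1(6 := Suc x), m1))"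
        using nf full False x(1) r(1) 1(1,2,5) by (simp add: step_stm_def del: val_Neg)
      show ?thesis
      proof (cases "next_gen G ?K x")
        case True
        then show ?thesis
          using sem_push[OF p1 _ B _ True 1(4), of Q] 1(2) d x(1) nf False unfolding eq by (simp add: dfs_step_def)
      next
        case nv: False
        have "path_inv w B ys f (r1(6 := Suc x), m1)"
          using p1 by (rule path_inv_cong) (use b B xn in \<open>auto intro!: bounded_upd\<close>)
        then show ?thesis
          using nv nf False xn 1(2) d unfolding eq by (simp add: dfs_step_def conf_inv_def)
      qed
    qed
  qed
qed

lemma series_word:
  assumes p: "path_inv w B ys f (r, m)"
  shows "map (m(hb := Suc (length ys))) [0..<hb + Suc (length ys) * n + 1] = w @ encode_series n (series_of G ys)"
proof -
  let ?k = "length ys" and ?m = "m(hb := Suc (length ys))"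
  have c: "cells m ys" using p by (simp add: path_inv_def)
  have "[0..<hb + Suc ?k * n + 1] = [0..<hb] @ hb # [hb + 1..<hb + Suc ?k * n + 1]"
    using upt_add_eq_append[of 0 hb "Suc ?k * n + 1"] upt_conv_Cons[of hb "hb + Suc ?k * n + 1"] by simp
  moreover have "map ?m [hb + 1..<hb + length (series_of G ys) * n + 1] =
      concat (map (\<lambda>A. map (\<lambda>x. if x \<in> A then 1 else 0) [1..<n + 1]) (series_of G ys))"
  proof (rule concat_cells)
    fix i z assume "i < length (series_of G ys)" "z \<in> {1..n}"
    then show "?m (hb + i * n + z) = of_bool (z \<in> series_of G ys ! i)"
      using c length_series_of[OF grp fin, of ys] unfolding cells_def by simp
  qed
  moreover have "map ?m [0..<hb] = w" using p by (simp add: path_inv_def)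
  ultimately show ?thesis
    using length_series_of[OF grp fin, of ys] by (simp add: encode_series_def)
qed

lemma sem_query:
  assumes cinv: "conf_inv w B (ys, x, f, False) (r, m)" and B: "sb + n + 2 \<le> B"
  shows "conf_inv w B (backtrack ys (f \<or> Q (w @ encode_series n (series_of G ys)))) (sem Q query_stm (r, m))"
proof -
  let ?k = "length ys"
  have p: "path_inv w B ys f (r, m)" and d: "r 7 = 0" using cinv by (auto simp: conf_inv_def)
  have g: "good G ys" and v: "view r m ?k (group_of G ys)" and c: "cells m ys" and f: "r 0 = of_bool f"
    using p by (auto simp: path_inv_def)
  note r = viewD(1-5)[OF v]
  let ?m = "m(hb := Suc ?k)"
  let ?q = "Q (map ?m [0..<hb + Suc ?k * n + 1])"
  let ?r = "r(15 := of_bool ?q, 0 := of_bool (f \<or> ?q))"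
  have "sem Q query_stm (r, m) = sem Q pop_stm (?r, ?m)"
    using r f by (auto simp: query_stm_def fun_eq_iff intro!: arg_cong[where f = "sem Q pop_stm"])
  moreover have "map ?m [0..<hb + Suc ?k * n + 1] = w @ encode_series n (series_of G ys)"
    by (rule series_word[OF p])
  moreover have "path_inv w B ys (f \<or> ?q) (?r, ?m)"
  proof -
    have b: "bounded 17 B (?r, ?m)"
      using p B good_length_less[OF g] by (auto simp: path_inv_def bounded_def)
    have "view ?r ?m ?k (group_of G ys)"
    proof -
      have "tb + (a * n + b - n) \<noteq> hb" if "a \<in> {1..n}" "b \<in> {1..n}" for a b using table_addr[OF that] by simp
      then show ?thesis using v by (simp add: view_def)
    qed
    moreover have "cells ?m ys"
      using c layout unfolding cells_def by auto
    ultimately show ?thesis using p b by (simp add: path_inv_def)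
  qed
  ultimately show ?thesis using sem_pop[of w B ys "f \<or> ?q" ?r ?m Q] d B by auto
qed

end

section \<open>Number of search steps\<close>

context table_search
begin

lemma dfs_step_finished: "finished c \<Longrightarrow> (dfs_step G lf ^^ k) c = c"
proof (induction k)
  case (Suc k)
  then show ?case by (auto simp: dfs_step_def finished_def)
qed simp

text \<open>The machine loop may halt before \<open>k\<close> rounds; as finished configurations are
  fixed, \<open>k\<close> need only be an upper bound for the number of rounds.\<close>

lemma loop_exec:
  assumes B: "sb + n + 2 \<le> B"
    and leaf: "\<And>ys x f r m. conf_inv w B (ys, x, f, False) (r, m) \<Longrightarrow> group_of G ys = carrier G \<Longrightarrow>
      conf_inv w B (lf ys f) (sem Q leaf (r, m))"
    and static: "stm_regs (step_stm leaf) \<subseteq> {..<17}" "loops_tame (step_stm leaf)"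
    and "conf_inv w B c s" "finished ((dfs_step G lf ^^ k) c)"
  shows "\<exists>t s'. exec Q (loop_cmd leaf) s t s' \<and> t \<le> k * (B ^ stm_cost (step_stm leaf) + 1) + 1 \<and>
    conf_inv w B ((dfs_step G lf ^^ k) c) s'"
  using assms(5,6)
proof (induction k arbitrary: c s)
  case 0
  then have "\<not> holds (Equal 7 16) (fst s)"
    by (cases c) (auto simp: conf_inv_def path_inv_def finished_def)
  then have "exec Q (loop_cmd leaf) s 1 s" unfolding loop_cmd_def by (rule exec.WhileFalse)
  then show ?case using 0 by (intro exI[of _ 1] exI[of _ s]) simp
next
  case (Suc k)
  show ?case
  proof (cases "finished c")
    case True
    then have "\<not> holds (Equal 7 16) (fst s)"
      using Suc.prems(1) by (cases c) (auto simp: conf_inv_def path_inv_def finished_def)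
    then have "exec Q (loop_cmd leaf) s 1 s" unfolding loop_cmd_def by (rule exec.WhileFalse)
    then show ?thesis using Suc.prems(1) unfolding dfs_step_finished[OF True]
      by (intro exI[of _ 1] exI[of _ s]) simp
  next
    case False
    then obtain ys x f where c: "c = (ys, x, f, False)" by (cases c) (auto simp: finished_def)
    obtain r m where s: "s = (r, m)" by fastforce
    have i: "conf_inv w B (ys, x, f, False) (r, m)" using Suc.prems(1) by (simp add: c s)
    have b: "bounded 17 B (r, m)" using i by (simp add: conf_inv_def path_inv_def)
    obtain t r' where 1: "exec Q (compile 17 (step_stm leaf)) (r, m) t (r', snd (sem Q (step_stm leaf) (r, m)))"
      "\<forall>i<17. r' i = fst (sem Q (step_stm leaf) (r, m)) i" "t \<le> B ^ stm_cost (step_stm leaf)"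
      using compile_exec[OF _ static(2,1) order_refl refl b, of Q] B by auto
    have "conf_inv w B (dfs_step G lf c) (fst (sem Q (step_stm leaf) (r, m)), snd (sem Q (step_stm leaf) (r, m)))"
      unfolding prod.collapse c by (rule sem_step[OF i B]) (rule leaf[OF i])
    then have i': "conf_inv w B (dfs_step G lf c) (r', snd (sem Q (step_stm leaf) (r, m)))"
      by (rule conf_inv_cong) (use 1(2) in auto)
    have f: "finished ((dfs_step G lf ^^ k) (dfs_step G lf c))"
      using Suc.prems(2) by (simp only: funpow_Suc_right comp_def)
    from Suc.IH[OF i' f] obtain u s' where 2: "exec Q (loop_cmd leaf) (r', snd (sem Q (step_stm leaf) (r, m))) u s'"
      "u \<le> k * (B ^ stm_cost (step_stm leaf) + 1) + 1" "conf_inv w B ((dfs_step G lf ^^ k) (dfs_step G lf c)) s'" by blast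
    have "holds (Equal 7 16) (fst (r, m))" using i by (auto simp: conf_inv_def path_inv_def)
    from exec.WhileTrue[OF this 1(1) 2(1)[unfolded loop_cmd_def]]
    have "exec Q (loop_cmd leaf) s (1 + t + u) s'" unfolding loop_cmd_def s .
    moreover have "1 + t + u \<le> Suc k * (B ^ stm_cost (step_stm leaf) + 1) + 1" using 1(3) 2(2) by simp
    moreover have "conf_inv w B ((dfs_step G lf ^^ Suc k) c) s'" using 2(3) by (simp only: funpow_Suc_right comp_def)
    ultimately show ?thesis by blast
  qed
qed

lemma good_append: "good G (zs @ ys) \<Longrightarrow> good G ys"
  by (induction zs) auto

lemma full_maximal: "good G (zs @ v # ys) \<Longrightarrow> group_of G ys \<noteq> carrier G"
  using good_append[of zs "v # ys"] by (auto simp: next_gen_def)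

text \<open>The search in \<open>G\<close> never backtracks: at each level some generator not yet
  passed exists by \<open>next_gen_exists\<close>. In the measure, a larger group outweighs
  restarting the candidates, whence the factor \<open>n + 1\<close>.\<close>

lemma descend:
  assumes lf: "lf = (\<lambda>ys f. (ys, 0, f, True))" and "good G ys"
    and "group_of G ys = carrier G \<or> (\<exists>v\<ge>x. next_gen G (group_of G ys) v)" "1 \<le> x"
  shows "\<exists>t zs. t \<le> (n - card (group_of G ys)) * (n + 1) + (n + 1 - x) + 1 \<and> good G zs \<and>
    group_of G zs = carrier G \<and> (dfs_step G lf ^^ t) (ys, x, f, False) = (zs, 0, f, True)"
  using assms(2-)
proof (induction "(n - card (group_of G ys)) * (n + 1) + (n + 1 - x)" arbitrary: ys x rule: less_induct)
  case less
  show ?case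
  proof (cases "group_of G ys = carrier G")
    case True
    then have "(dfs_step G lf ^^ 1) (ys, x, f, False) = (ys, 0, f, True)" by (simp add: dfs_step_def lf)
    then show ?thesis using less.prems(1) True by (intro exI[of _ 1] exI[of _ ys]) simp
  next
    case False
    then obtain v where v: "x \<le> v" "next_gen G (group_of G ys) v" using less.prems(2) by blast
    have xn: "x \<le> n" using v by (auto simp: next_gen_def)
    show ?thesis
    proof (cases "next_gen G (group_of G ys) x")
      case True
      then have g: "good G (x # ys)" using less.prems(1) by simp
      have st: "dfs_step G lf (ys, x, f, False) = (x # ys, 1, f, False)"
        using False True xn by (simp add: dfs_step_def)
      have "card (group_of G ys) < card (group_of G (x # ys))" "card (group_of G (x # ys)) \<le> n"
        using good_card_less[OF g] good_card_le[OF g] by auto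
      then have "Suc (n - card (group_of G (x # ys))) * (n + 1) \<le> (n - card (group_of G ys)) * (n + 1)"
        by (intro mult_le_mono1) simp
      then have lt: "(n - card (group_of G (x # ys))) * (n + 1) + (n + 1 - 1) <
          (n - card (group_of G ys)) * (n + 1) + (n + 1 - x)" using xn by simp
      have "group_of G (x # ys) = carrier G \<or> (\<exists>v\<ge>1. next_gen G (group_of G (x # ys)) v)"
        using next_gen_exists[OF grp fin good_sub[OF g]] by (auto simp: next_gen_def)
      from less.hyps[OF lt g this] obtain t zs where
        t: "t \<le> (n - card (group_of G (x # ys))) * (n + 1) + (n + 1 - 1) + 1" "good G zs" "group_of G zs = carrier G"
        "(dfs_step G lf ^^ t) (x # ys, 1, f, False) = (zs, 0, f, True)" by auto
      have "(dfs_step G lf ^^ Suc t) (ys, x, f, False) = (zs, 0, f, True)"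
        using t(4) st by (simp only: funpow_Suc_right comp_def)
      then show ?thesis using t lt by (intro exI[of _ "Suc t"] exI[of _ zs]) linarith
    next
      case nv: False
      have st: "dfs_step G lf (ys, x, f, False) = (ys, Suc x, f, False)"
        using False nv xn by (simp add: dfs_step_def)
      have "v \<noteq> x" using v nv by auto
      then have ex: "group_of G ys = carrier G \<or> (\<exists>v\<ge>Suc x. next_gen G (group_of G ys) v)"
        using v by (auto intro!: exI[of _ v])
      have lt: "(n - card (group_of G ys)) * (n + 1) + (n + 1 - Suc x) <
          (n - card (group_of G ys)) * (n + 1) + (n + 1 - x)" using xn by simp
      from less.hyps[OF lt less.prems(1) ex] obtain t zs where
        t: "t \<le> (n - card (group_of G ys)) * (n + 1) + (n + 1 - Suc x) + 1" "good G zs" "group_of G zs = carrier G"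
        "(dfs_step G lf ^^ t) (ys, Suc x, f, False) = (zs, 0, f, True)" by auto
      have "(dfs_step G lf ^^ Suc t) (ys, x, f, False) = (zs, 0, f, True)"
        using t(4) st by (simp only: funpow_Suc_right comp_def)
      then show ?thesis using t lt by (intro exI[of _ "Suc t"] exI[of _ zs]) linarith
    qed
  qed
qed

end

text \<open>For a node \<open>K\<close> with \<open>n \<le> card K * p ^ Suc j\<close>,
  \<open>card_next_gen\<close> leaves at most \<open>p ^ Suc j\<close> children, and
  \<open>n + 2\<close> covers the scan through the candidates and the final backtracking.\<close>

fun tree_size :: "nat \<Rightarrow> nat \<Rightarrow> nat \<Rightarrow> nat" where
  "tree_size n p 0 = 1"
| "tree_size n p (Suc j) = n + 2 + p ^ Suc j * tree_size n p j"

text \<open>Lists grow at the front, so the last entry of a non-empty extension is the generator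
  chosen right after \<open>ys\<close>; this splits the leaves below \<open>ys\<close> by
  child.\<close>

lemma ex_append_iff: "(\<exists>zs. R (zs @ ys)) \<longleftrightarrow> R ys \<or> (\<exists>zs v. R (zs @ v # ys))"
proof
  assume "\<exists>zs. R (zs @ ys)"
  then obtain zs where "R (zs @ ys)" ..
  then show "R ys \<or> (\<exists>zs v. R (zs @ v # ys))"
    by (cases zs rule: rev_cases) auto
next
  assume "R ys \<or> (\<exists>zs v. R (zs @ v # ys))"
  then show "\<exists>zs. R (zs @ ys)"
  proof
    assume "R ys"
    then show ?thesis by (intro exI[of _ "[]"]) simp
  next
    assume "\<exists>zs v. R (zs @ v # ys)"
    then obtain zs v where "R (zs @ v # ys)" by blast
    then show ?thesis by (intro exI[of _ "zs @ [v]"]) simp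
  qed
qed

context table_search
begin

text \<open>Induction on a bound \<open>j\<close> for the remaining height. Passing to a next term
  multiplies the order by at least \<open>p\<close> and so lowers \<open>j\<close> by one, while
  \<open>j = 0\<close> forces the current term to be the whole group.\<close>

lemma explore:
  assumes lf: "lf = (\<lambda>ys f. backtrack ys (f \<or> P ys))"
    and p: "\<And>q. Factorial_Ring.prime q \<Longrightarrow> q dvd n \<Longrightarrow> p \<le> q"
    and "good G ys" "n \<le> card (group_of G ys) * p ^ j"
  shows "\<exists>t \<le> tree_size n p j. (dfs_step G lf ^^ t) (ys, 1, f, False) =
    backtrack ys (f \<or> (\<exists>zs. good G (zs @ ys) \<and> group_of G (zs @ ys) = carrier G \<and> P (zs @ ys)))"
  using assms(3-)
proof (induction j arbitrary: ys f)
  case (0 ys f)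
  have "group_of G ys = carrier G"
    using 0 card_seteq[OF _ good_subset[OF 0(1)]] by simp
  then have "(dfs_step G lf ^^ 1) (ys, 1, f, False) = backtrack ys (f \<or> P ys)" by (simp add: dfs_step_def lf)
  moreover have "(\<exists>zs. good G (zs @ ys) \<and> group_of G (zs @ ys) = carrier G \<and> P (zs @ ys)) \<longleftrightarrow> P ys"
    using full_maximal[of _ _ ys] 0(1) \<open>group_of G ys = carrier G\<close>
      ex_append_iff[of "\<lambda>zs. good G zs \<and> group_of G zs = carrier G \<and> P zs" ys] by blast
  ultimately show ?case by (intro exI[of _ 1]) simp
next
  case (Suc j ys f)
  note hyp = Suc.IH and gy = Suc.prems(1) and ny = Suc.prems(2)
  let ?K = "group_of G ys"
  let ?leaf = "\<lambda>zs. good G zs \<and> group_of G zs = carrier G \<and> P zs"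
  note split = ex_append_iff[of ?leaf ys]
  show ?case
  proof (cases "?K = carrier G")
    case True
    then have eq: "(\<exists>zs. ?leaf (zs @ ys)) \<longleftrightarrow> P ys"
      unfolding split using full_maximal gy by blast
    have "(dfs_step G lf ^^ 1) (ys, 1, f, False) = backtrack ys (f \<or> P ys)"
      using True by (simp add: dfs_step_def lf)
    then show ?thesis unfolding eq by (intro exI[of _ 1]) simp
  next
    case nf: False
    \<comment> \<open>Here \<open>d\<close> is the number of candidates still to be tried at this
      node; every admissible one is charged the size of one subtree.\<close>
    have scan: "\<exists>t \<le> d + 1 + card {v. next_gen G ?K v \<and> n + 1 - d \<le> v} * tree_size n p j.
        (dfs_step G lf ^^ t) (ys, n + 1 - d, f, False) =
          backtrack ys (f \<or> (\<exists>zs v. n + 1 - d \<le> v \<and> ?leaf (zs @ v # ys)))" if "d \<le> n" for d f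
      using that
    proof (induction d arbitrary: f)
      case 0
      have "\<not> n + 1 \<le> v" if "good G (zs @ v # ys)" for zs v
        using good_hd[OF good_append[OF that]] by simp
      then have eq: "(\<exists>zs v. n + 1 \<le> v \<and> ?leaf (zs @ v # ys)) \<longleftrightarrow> False" by blast
      have "(dfs_step G lf ^^ 1) (ys, n + 1, f, False) = backtrack ys f"
        using nf by (simp add: dfs_step_def)
      then show ?case unfolding diff_zero eq by (intro exI[of _ 1]) simp
    next
      case (Suc d)
      define x where "x = n + 1 - Suc d"
      have x: "n + 1 - d = Suc x" "x \<le> n" "1 \<le> x" using Suc.prems by (auto simp: x_def)
      have dn: "d \<le> n" using Suc.prems by simp
      have fin_gens: "finite {v. next_gen G ?K v \<and> Suc x \<le> v}"
        by (rule finite_subset[OF _ fin]) (auto simp: next_gen_def)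
      have le: "x \<le> v \<longleftrightarrow> v = x \<or> Suc x \<le> v" for v by auto
      show ?case
        unfolding x_def[symmetric]
      proof (cases "next_gen G ?K x")
        case True
        then have g: "good G (x # ys)" using gy by simp
        have "p * card ?K \<le> card (group_of G (x # ys))"
          by (rule card_subgroup_mult[OF grp fin G.subnormal_subgroup[OF good_sub[OF gy]]
                G.subnormal_subgroup[OF good_sub[OF g]] good_psubset[OF grp fin g]]) (use p in simp)
        then have "card ?K * p ^ Suc j \<le> card (group_of G (x # ys)) * p ^ j"
          using mult_le_mono1[of "p * card ?K" _ "p ^ j"] by (simp add: ac_simps)
        then have nj: "n \<le> card (group_of G (x # ys)) * p ^ j" using ny by (rule order_trans[rotated])
        let ?f = "f \<or> (\<exists>zs. ?leaf (zs @ x # ys))"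
        obtain t1 where 1: "t1 \<le> tree_size n p j" "(dfs_step G lf ^^ t1) (x # ys, 1, f, False) = (ys, Suc x, ?f, False)"
          using hyp[OF g nj, of f] by auto
        obtain t2 where 2: "t2 \<le> d + 1 + card {v. next_gen G ?K v \<and> Suc x \<le> v} * tree_size n p j"
          "(dfs_step G lf ^^ t2) (ys, Suc x, ?f, False) =
            backtrack ys (?f \<or> (\<exists>zs v. Suc x \<le> v \<and> ?leaf (zs @ v # ys)))"
          using Suc.IH[OF dn, of ?f] unfolding x(1) by blast
        have "dfs_step G lf (ys, x, f, False) = (x # ys, 1, f, False)"
          using nf True x by (simp add: dfs_step_def)
        then have st: "(dfs_step G lf ^^ (t2 + Suc t1)) (ys, x, f, False) =
            backtrack ys (?f \<or> (\<exists>zs v. Suc x \<le> v \<and> ?leaf (zs @ v # ys)))"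
          using 1(2) 2(2) by (simp only: funpow_add funpow_Suc_right comp_def)
        have iff: "(?f \<or> (\<exists>zs v. Suc x \<le> v \<and> ?leaf (zs @ v # ys))) \<longleftrightarrow>
            (f \<or> (\<exists>zs v. x \<le> v \<and> ?leaf (zs @ v # ys)))"
          unfolding le by blast
        have cnt: "t2 + Suc t1 \<le> Suc d + 1 + card {v. next_gen G ?K v \<and> x \<le> v} * tree_size n p j"
        proof -
          have "{v. next_gen G ?K v \<and> x \<le> v} = insert x {v. next_gen G ?K v \<and> Suc x \<le> v}"
            using True by auto
          then have "card {v. next_gen G ?K v \<and> x \<le> v} = Suc (card {v. next_gen G ?K v \<and> Suc x \<le> v})"
            using fin_gens by simp
          then show ?thesis using 1(1) 2(1) by simp
        qed
        show "\<exists>t \<le> Suc d + 1 + card {v. next_gen G ?K v \<and> x \<le> v} * tree_size n p j.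
          (dfs_step G lf ^^ t) (ys, x, f, False) =
            backtrack ys (f \<or> (\<exists>zs v. x \<le> v \<and> ?leaf (zs @ v # ys)))"
          using st[unfolded iff] cnt by blast
      next
        case False
        obtain t2 where 2: "t2 \<le> d + 1 + card {v. next_gen G ?K v \<and> Suc x \<le> v} * tree_size n p j"
          "(dfs_step G lf ^^ t2) (ys, Suc x, f, False) =
            backtrack ys (f \<or> (\<exists>zs v. Suc x \<le> v \<and> ?leaf (zs @ v # ys)))"
          using Suc.IH[OF dn, of f] unfolding x(1) by blast
        have "dfs_step G lf (ys, x, f, False) = (ys, Suc x, f, False)"
          using nf False x by (simp add: dfs_step_def)
        then have st: "(dfs_step G lf ^^ Suc t2) (ys, x, f, False) =
            backtrack ys (f \<or> (\<exists>zs v. Suc x \<le> v \<and> ?leaf (zs @ v # ys)))"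
          using 2(2) by (simp only: funpow_add funpow_Suc_right comp_def)
        have "\<not> good G (zs @ x # ys)" for zs using False good_append[of zs "x # ys"] by auto
        then have iff: "(\<exists>zs v. Suc x \<le> v \<and> ?leaf (zs @ v # ys)) \<longleftrightarrow> (\<exists>zs v. x \<le> v \<and> ?leaf (zs @ v # ys))"
          unfolding le by blast
        have "{v. next_gen G ?K v \<and> x \<le> v} = {v. next_gen G ?K v \<and> Suc x \<le> v}"
          using False le by auto
        then have cnt: "Suc t2 \<le> Suc d + 1 + card {v. next_gen G ?K v \<and> x \<le> v} * tree_size n p j"
          using 2(1) by simp
        show "\<exists>t \<le> Suc d + 1 + card {v. next_gen G ?K v \<and> x \<le> v} * tree_size n p j.
          (dfs_step G lf ^^ t) (ys, x, f, False) =
            backtrack ys (f \<or> (\<exists>zs v. x \<le> v \<and> ?leaf (zs @ v # ys)))"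
          using st[unfolded iff] cnt by blast
      qed
    qed
    have V: "{v. next_gen G ?K v \<and> 1 \<le> v} = {v. next_gen G ?K v}" by (auto simp: next_gen_def)
    have "1 \<le> v" if "good G (zs @ v # ys)" for zs v
      using good_hd[OF good_append[OF that]] by simp
    then have leaf1: "(\<exists>zs v. 1 \<le> v \<and> ?leaf (zs @ v # ys)) \<longleftrightarrow> (\<exists>zs v. ?leaf (zs @ v # ys))" by blast
    have "card {v. next_gen G ?K v} * card ?K \<le> n"
      using card_next_gen[OF grp fin good_sub[OF gy]] unfolding order_G .
    also have "n \<le> p ^ Suc j * card ?K" using ny by (simp only: mult.commute)
    finally have "card {v. next_gen G ?K v} * card ?K \<le> p ^ Suc j * card ?K" .
    moreover have "0 < card ?K" using good_length[OF gy] by simp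
    ultimately have "card {v. next_gen G ?K v} \<le> p ^ Suc j" by (simp only: mult_le_cancel2)
    then have "card {v. next_gen G ?K v} * tree_size n p j \<le> p ^ Suc j * tree_size n p j"
      by (rule mult_le_mono1)
    then have le: "n + 1 + card {v. next_gen G ?K v} * tree_size n p j \<le> tree_size n p (Suc j)"
      unfolding tree_size.simps(2) by linarith
    have "\<not> (?leaf ys)" using nf by blast
    then have eq: "(\<exists>zs. ?leaf (zs @ ys)) \<longleftrightarrow> (\<exists>zs v. ?leaf (zs @ v # ys))" unfolding split by blast
    have one: "n + 1 - n = 1" by simp
    obtain t where "t \<le> n + 1 + card {v. next_gen G ?K v} * tree_size n p j"
      "(dfs_step G lf ^^ t) (ys, 1, f, False) = backtrack ys (f \<or> (\<exists>zs v. ?leaf (zs @ v # ys)))"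
      using scan[OF order_refl, of f] unfolding one V leaf1 by blast
    then show ?thesis unfolding eq using le order_trans by blast
  qed
qed

end

section \<open>Correctness and running time\<close>

lemma tree_size_le: "1 \<le> p \<Longrightarrow> tree_size n p j \<le> (n + 2) * 2 ^ j * p ^ (\<Sum>i\<le>j. i)"
proof (induction j)
  case (Suc j)
  let ?s = "\<Sum>i\<le>j. i"
  have "p ^ Suc j * tree_size n p j \<le> p ^ Suc j * ((n + 2) * 2 ^ j * p ^ ?s)"
    using Suc by (intro mult_le_mono2) simp
  also have "\<dots> = (n + 2) * 2 ^ j * p ^ (?s + Suc j)" by (simp add: power_add ac_simps)
  finally have "p ^ Suc j * tree_size n p j \<le> (n + 2) * (2 ^ j * p ^ (?s + Suc j))" by (simp only: mult.assoc)
  moreover have "(n + 2) * (1 * 1) \<le> (n + 2) * (2 ^ j * p ^ (?s + Suc j))"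
    using Suc.prems by (intro mult_le_mono le_refl one_le_power) auto
  ultimately have "tree_size n p (Suc j) \<le> 2 * ((n + 2) * (2 ^ j * p ^ (?s + Suc j)))"
    unfolding tree_size.simps(2) mult_1_right by linarith
  also have "\<dots> = (n + 2) * 2 ^ Suc j * p ^ (\<Sum>i\<le>Suc j. i)"
    by (simp only: sum.atMost_Suc power_Suc ac_simps)
  finally show ?case .
qed simp

text \<open>The height \<open>j\<close> is L = log_p n rounded up, and p to the power L is n, so a
  factor L in an exponent of p turns p into n.\<close>

lemma tree_size_bound:
  fixes n p :: nat
  assumes p: "2 \<le> p" "p \<le> n"
  shows "\<exists>j. n \<le> p ^ j \<and> real (tree_size n p j) \<le> real n powr (1 / 2 * log (real p) (real n) + 7)"
proof -
  define L where "L = log (real p) (real n)"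
  have L1: "1 \<le> L" using p by (simp add: L_def)
  have pL: "real p powr L = real n" using p by (simp add: L_def)
  define j where "j = nat \<lceil>L\<rceil>"
  have j: "L \<le> real j" "real j \<le> L + 1" using L1 unfolding j_def by linarith+
  have p1: "1 < real p" and n1: "1 \<le> real n" using p by auto
  have "real n \<le> real p powr real j" unfolding pL[symmetric] using j p1 by (intro powr_mono) auto
  then have "real n \<le> real (p ^ j)" using p1 by (simp add: powr_realpow)
  then have nj: "n \<le> p ^ j" by (simp only: of_nat_le_iff)
  have two: "2 * (\<Sum>i\<le>j. i) = j * (j + 1)" by (induction j) auto
  have "2 * real (\<Sum>i\<le>j. i) = real j * (real j + 1)"
    using arg_cong[OF two, of real] by (simp only: of_nat_mult of_nat_add of_nat_numeral of_nat_1)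
  also have "\<dots> \<le> (L + 1) * (L + 2)" using j L1 by (intro mult_mono) auto
  \<comment> \<open>This is (L + 1) (L + 2) / 2 with the factor L split off; the remaining 1 costs
    one factor p, which is at most n.\<close>
  finally have s: "real (\<Sum>i\<le>j. i) \<le> L * (L / 2 + 3 / 2) + 1" by (simp add: field_simps)
  have "real (p ^ (\<Sum>i\<le>j. i)) = real p powr real (\<Sum>i\<le>j. i)"
    by (subst powr_realpow) (use p1 in auto)
  also have "\<dots> \<le> real p powr (L * (L / 2 + 3 / 2) + 1)" using s p1 by (intro powr_mono) auto
  also have "\<dots> = real n powr (L / 2 + 3 / 2) * real p"
    using p1 pL by (simp add: powr_add powr_powr[symmetric])
  also have "\<dots> \<le> real n powr (L / 2 + 3 / 2) * real n powr 1"
    using p by (intro mult_left_mono) auto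
  also have "\<dots> = real n powr (L / 2 + 5 / 2)" unfolding powr_add[symmetric]
    by (rule arg_cong[where f = "(powr) (real n)"]) simp
  finally have 1: "real (p ^ (\<Sum>i\<le>j. i)) \<le> real n powr (L / 2 + 5 / 2)" .
  have "2 ^ j \<le> p ^ j" using p by (intro power_mono) auto
  then have "real (2 ^ j) \<le> real (p ^ j)" by (simp only: of_nat_le_iff)
  also have "\<dots> = real p powr real j" using p1 by (simp add: powr_realpow)
  also have "\<dots> \<le> real p powr (L + 1)" using j p1 by (intro powr_mono) auto
  also have "\<dots> = real n * real p" using p1 pL by (simp add: powr_add)
  also have "\<dots> \<le> real n * real n" using p by (intro mult_left_mono) auto
  also have "\<dots> = real n powr 2" using n1 by (simp add: powr_numeral power2_eq_square)
  finally have 2: "real (2 ^ j) \<le> real n powr 2" .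
  have "n + 2 \<le> n * n" if "2 \<le> n" for n :: nat
  proof -
    have "n + 2 \<le> 2 * n" using that by simp
    also have "\<dots> \<le> n * n" using that by (intro mult_le_mono1)
    finally show ?thesis .
  qed
  then have "n + 2 \<le> n * n" using p by simp
  then have "real (n + 2) \<le> real (n * n)" by (simp only: of_nat_le_iff)
  also have "\<dots> = real n powr 2" using n1 by (simp add: powr_numeral power2_eq_square)
  finally have 3: "real (n + 2) \<le> real n powr 2" .
  have "real (tree_size n p j) \<le> real ((n + 2) * 2 ^ j * p ^ (\<Sum>i\<le>j. i))"
    using tree_size_le[of p n j] p by (simp only: of_nat_le_iff)
  also have "\<dots> = real (n + 2) * real (2 ^ j) * real (p ^ (\<Sum>i\<le>j. i))" by (simp only: of_nat_mult)
  also have "\<dots> \<le> real n powr 2 * real n powr 2 * real n powr (L / 2 + 5 / 2)"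
    using 1 2 3 by (intro mult_mono) auto
  \<comment> \<open>Two for \<open>n + 2\<close>, two for \<open>2 ^ j\<close> and 5/2 for the power
    of \<open>p\<close>; the total is rounded up to 7.\<close>
  also have "\<dots> = real n powr (L / 2 + 13 / 2)" unfolding powr_add[symmetric]
    by (rule arg_cong[where f = "(powr) (real n)"]) simp
  also have "\<dots> \<le> real n powr (1 / 2 * L + 7)" using n1 by (intro powr_mono) auto
  finally show ?thesis using nj unfolding L_def by blast
qed

section \<open>Layout of the input word\<close>

lemma nth_concat_uniform:
  assumes "\<And>xs. xs \<in> set xss \<Longrightarrow> length xs = n" "i < length xss" "j < n"
  shows "concat xss ! (i * n + j) = xss ! i ! j"
  using assms
proof (induction xss arbitrary: i)
  case (Cons xs xss)
  then show ?case by (cases i) (auto simp: nth_append)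
qed simp

lemma length_encode_table [simp]: "length (encode_table n M) = n * n"
  by (simp add: encode_table_def length_concat comp_def sum_list_triv)

lemma table_index:
  fixes a b n :: nat
  assumes "a \<in> {1..n}" "b \<in> {1..n}"
  shows "a * n + b - n = Suc ((a - 1) * n + (b - 1))" "(a - 1) * n + (b - 1) < n * n"
proof -
  obtain a' b' where ab: "a = Suc a'" "b = Suc b'" using assms by (cases a; cases b) auto
  show "a * n + b - n = Suc ((a - 1) * n + (b - 1))" by (simp add: ab)
  have "a * n \<le> n * n" using assms by simp
  then show "(a - 1) * n + (b - 1) < n * n" using assms(2) by (simp add: ab)
qed

lemma encode_table_nth:
  assumes "a \<in> {1..n}" "b \<in> {1..n}"
  shows "encode_table n M ! ((a - 1) * n + (b - 1)) = M a b"
  unfolding encode_table_def using assms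
  by (subst nth_concat_uniform[where n = n]) (auto simp del: upt_Suc)

lemma set_encode_table:
  assumes "x \<in> set (encode_table n M)"
  obtains a b where "a \<in> {1..n}" "b \<in> {1..n}" "x = M a b"
  using assms by (fastforce simp: encode_table_def simp del: upt_Suc)

section \<open>The two searches combined\<close>

context table_search
begin

lemma sem_trivial:
  assumes r: "r 1 = n" "r 2 = tb" "r 3 = hb" "r 4 = sb" "r 5 = 0" "r 7 = 0" "r 0 = of_bool f" "r 16 = 0"
    and M: "\<And>a b. a \<in> {1..n} \<Longrightarrow> b \<in> {1..n} \<Longrightarrow> m (tb + (a * n + b - n)) = M a b"
    and w: "map m [0..<hb] = w" and b: "bounded 17 B (r, m)" and B: "sb + n + 2 \<le> B"
  shows "conf_inv w B ([], 1, f, False) (sem Q trivial_stm (r, m))"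
proof -
  have nn: "n \<le> n * n" using n_pos by simp
  obtain r1 m1 where 1: "sem Q (fill (series_cell (V 5) (V 12)) (Truth (Equ (table (V 12) (V 12)) (V 12)))) (r, m) = (r1, m1)"
    "\<And>i. i \<noteq> 12 \<Longrightarrow> r1 i = r i" "\<And>i. i \<le> hb \<or> hb + r 1 < i \<Longrightarrow> m1 i = m i"
    "\<And>z. z \<in> {1..r 1} \<Longrightarrow> m1 (hb + z) = of_bool (z \<in> {\<one>\<^bsub>G\<^esub>})"
  proof (rule sem_fill[where r = r and m = m and b = hb and A = "{\<one>\<^bsub>G\<^esub>}" and Q = Q
        and a = "series_cell (V 5) (V 12)" and e = "Truth (Equ (table (V 12) (V 12)) (V 12))"])
    fix z m' assume z: "z \<in> {1..r 1}" and m': "\<And>i. i \<le> hb \<or> hb + r 1 < i \<Longrightarrow> m' i = m i"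
    have zn: "z \<in> {1..n}" using z r(1) by simp
    have "m' (tb + (z * n + z - n)) = m (tb + (z * n + z - n))"
      using table_addr[OF zn zn] by (intro m') simp
    then show "val (Truth (Equ (table (V 12) (V 12)) (V 12))) (r(12 := z)) m' = of_bool (z \<in> {\<one>\<^bsub>G\<^esub>})"
      using M[OF zn zn] idem_iff[OF zn] r by simp
  qed (use r in auto)
  let ?r = "r1(6 := 1)"
  have eq: "sem Q trivial_stm (r, m) = (?r, m1)"
    unfolding trivial_stm_def sem.simps(1,3) 1(1) by simp
  have "tame trivial_stm" "stm_regs trivial_stm \<subseteq> {..<17}" by (auto simp: trivial_stm_def stm_defs)
  from bounded_sem_tame[OF _ this b, of Q] have b1: "bounded 17 B (?r, m1)" using B unfolding eq by simp
  have "view ?r m1 0 {\<one>\<^bsub>G\<^esub>}"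
  proof -
    have "m1 (tb + (a * n + b - n)) = M a b" if "a \<in> {1..n}" "b \<in> {1..n}" for a b
      using table_addr[OF that] M[OF that] 1(3)[of "tb + (a * n + b - n)"] by simp
    then show ?thesis using 1(2,4) r n_pos unfolding view_def by simp
  qed
  moreover have "cells m1 []" using 1(4) r(1) by (simp add: cells_def)
  moreover have "map m1 [0..<hb] = w"
  proof -
    have "map m1 [0..<hb] = map m [0..<hb]" using 1(3) by simp
    then show ?thesis using w by (rule trans)
  qed
  ultimately have "path_inv w B [] f (?r, m1)" using b1 1(2) r unfolding path_inv_def by simp
  then show ?thesis unfolding eq conf_inv_def using 1(2) r n_pos by simp
qed

end

text \<open>The bound \<open>B\<close> is \<open>sb0 + n + 2\<close>, large enough for all values
  occurring in the invariants. The four polynomial blocks enter through their exponents, and only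
  the search in \<open>H\<close> contributes the tree size.\<close>

lemma program_decides:
  fixes n :: nat and G H :: "nat \<Rightarrow> nat \<Rightarrow> nat"
  assumes G: "group (table_group n G)" and H: "group (table_group n H)"
    and Q: "decides_series_isomorphism Q n G H"
    and p: "\<And>q. Factorial_Ring.prime q \<Longrightarrow> q dvd n \<Longrightarrow> p \<le> q" and j: "n \<le> p ^ j"
    and B: "B = 4 * (n * n) + n + 5"
  shows "\<exists>t. decides_in_time Q program (encode_groups n G H) (table_group n G \<cong> table_group n H) t \<and>
    t \<le> B ^ (stm_cost init_stm + stm_cost (step_stm (Assign 7 (N 1))) + stm_cost mid_stm + stm_cost (step_stm query_stm) + 4) *
      tree_size n p j"
proof -
  let ?G = "table_group n G" and ?H = "table_group n H"
  define hb0 sb0 where hb0: "hb0 = 2 * (n * n) + 1" and sb0: "sb0 = 4 * (n * n) + 3"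
  let ?xs = "encode_groups n G H"
  interpret S: table_search n G 0 hb0 sb0 by (rule table_search.intro) (use G in \<open>auto simp: hb0 sb0\<close>)
  interpret T0: table_search n H 0 hb0 sb0 by (rule table_search.intro) (use H in \<open>auto simp: hb0 sb0\<close>)
  let ?c0 = "stm_cost init_stm" and ?c1 = "stm_cost (step_stm (Assign 7 (N 1)))"
    and ?c2 = "stm_cost mid_stm" and ?c3 = "stm_cost (step_stm query_stm)"
  have B2: "2 \<le> B" and BS: "sb0 + n + 2 \<le> B" using B by (auto simp: sb0)
  have len: "length ?xs = hb0" by (simp add: encode_groups_def hb0)
  have tG: "?xs ! (a * n + b - n) = G a b" if "a \<in> {1..n}" "b \<in> {1..n}" for a b
    unfolding table_index(1)[OF that]
    using table_index(2)[OF that] encode_table_nth[OF that, of G] by (simp add: encode_groups_def nth_append)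
  have tH: "?xs ! (n * n + (a * n + b - n)) = H a b" if "a \<in> {1..n}" "b \<in> {1..n}" for a b
    unfolding table_index(1)[OF that]
    using table_index(2)[OF that] encode_table_nth[OF that, of H] by (simp add: encode_groups_def nth_append)
  define m0 where "m0 = snd (initial_state ?xs)"
  have ini: "initial_state ?xs = (\<lambda>_. 0, m0)" by (simp add: m0_def initial_state_def)
  have m0: "m0 i = (if i < hb0 then ?xs ! i else 0)" for i
    unfolding m0_def initial_state_def len by simp
  have w0: "map m0 [0..<hb0] = ?xs" using m0 len by (intro nth_equalityI) (auto simp del: upt_Suc)
  have xs_le: "x \<le> n" if x: "x \<in> set ?xs" for x
  proof -
    consider "x = n" | "x \<in> set (encode_table n G)" | "x \<in> set (encode_table n H)"
      using x by (auto simp: encode_groups_def)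
    then show ?thesis
    proof cases
      case 2
      then obtain a b where "a \<in> {1..n}" "b \<in> {1..n}" "x = G a b" by (rule set_encode_table)
      then show ?thesis using S.M_closed[of a b] by simp
    next
      case 3
      then obtain a b where "a \<in> {1..n}" "b \<in> {1..n}" "x = H a b" by (rule set_encode_table)
      then show ?thesis using T0.M_closed[of a b] by simp
    qed simp
  qed
  have m0B: "m0 i \<le> B" for i
    using xs_le[of "?xs ! i"] len B unfolding m0 by (auto intro: le_trans)
  define r0 :: "nat \<Rightarrow> nat" where "r0 = (\<lambda>_. 0)(1 := n, 3 := hb0, 4 := sb0)"
  have b0: "bounded 17 B (\<lambda>_. 0, m0)" using m0B by (simp add: bounded_def)
  have "m0 0 = n" unfolding m0 by (simp add: encode_groups_def hb0)
  then have init: "sem Q init_stm (\<lambda>_. 0, m0) = sem Q trivial_stm (r0, m0)"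
    by (simp add: init_stm_def r0_def hb0 sb0)
  have "S.conf_inv ?xs B ([], 1, False, False) (sem Q init_stm (\<lambda>_. 0, m0))"
    unfolding init
  proof (rule S.sem_trivial)
    fix a b assume "a \<in> {1..n}" "b \<in> {1..n}"
    then show "m0 (0 + (a * n + b - n)) = G a b"
      using tG[of a b] S.table_addr[of a b] unfolding m0 by simp
  next
    show "bounded 17 B (r0, m0)" unfolding r0_def using b0 BS S.layout by (intro bounded_upd) auto
  qed (use w0 BS in \<open>auto simp: r0_def simp del: upt_Suc\<close>)
  then have i0: "S.conf_inv ?xs B ([], 1, False, False)
      (fst (sem Q init_stm (\<lambda>_. 0, m0)), snd (sem Q init_stm (\<lambda>_. 0, m0)))" by simp
  obtain t0 r1 m1 where e0: "exec Q (compile 17 init_stm) (\<lambda>_. 0, m0) t0 (r1, m1)"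
    "\<forall>i<17. r1 i = fst (sem Q init_stm (\<lambda>_. 0, m0)) i" "m1 = snd (sem Q init_stm (\<lambda>_. 0, m0))" "t0 \<le> B ^ ?c0"
    using compile_exec[OF B2 stm_static(6,5) order_refl refl b0, of Q] by blast
  have c1: "S.conf_inv ?xs B ([], 1, False, False) (r1, m1)"
    unfolding e0(3) by (rule S.conf_inv_cong[OF i0]) (use e0(2) in blast)

  let ?lf1 = "\<lambda>ys f. (ys, 0, f, True) :: conf"
  have "group_of ?G [] = carrier ?G \<or> (\<exists>v\<ge>1. next_gen ?G (group_of ?G []) v)"
    using next_gen_exists[OF G S.fin S.good_sub[of "[]"]] by (auto simp: next_gen_def)
  then obtain k1 zs where k1: "k1 \<le> (n - card (group_of ?G [])) * (n + 1) + (n + 1 - 1) + 1" "good ?G zs"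
    "group_of ?G zs = carrier ?G" "(dfs_step ?G ?lf1 ^^ k1) ([], 1, False, False) = (zs, 0, False, True)"
    using S.descend[OF refl, of "[]" 1 False] by auto
  have leaf1: "S.conf_inv ?xs B (?lf1 ys f) (sem Q (Assign 7 (N 1)) (r, m))"
    if "S.conf_inv ?xs B (ys, x, f, False) (r, m)" "group_of ?G ys = carrier ?G" for ys x f r m
  proof -
    have p: "S.path_inv ?xs B ys f (r, m)" using that(1) by (simp add: S.conf_inv_def)
    then have "S.path_inv ?xs B ys f (r(7 := 1), m)"
      by (rule S.path_inv_cong) (use p B2 in \<open>auto simp: S.path_inv_def intro!: bounded_upd\<close>)
    then show ?thesis by (simp add: S.conf_inv_def)
  qed
  have fin1: "finished ((dfs_step ?G ?lf1 ^^ k1) ([], 1, False, False))" unfolding k1(4) by (simp add: finished_def)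
  have "\<exists>t s'. exec Q (loop_cmd (Assign 7 (N 1))) (r1, m1) t s' \<and> t \<le> k1 * (B ^ ?c1 + 1) + 1 \<and>
      S.conf_inv ?xs B ((dfs_step ?G ?lf1 ^^ k1) ([], 1, False, False)) s'"
    by (rule S.loop_exec[OF BS _ stm_static(1,2) c1 fin1]) (rule leaf1)
  then obtain t1 s1 where s1: "exec Q (loop_cmd (Assign 7 (N 1))) (r1, m1) t1 s1"
    "t1 \<le> k1 * (B ^ ?c1 + 1) + 1" "S.conf_inv ?xs B (zs, 0, False, True) s1"
    unfolding k1(4) by blast
  obtain r2 m2 where "s1 = (r2, m2)" by fastforce
  note e1 = s1[unfolded this]

  let ?k = "Suc (length zs)"
  \<comment> \<open>The cell behind the last term of the series of \<open>G\<close> becomes the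
    length cell of the second series.\<close>
  define hb where "hb = hb0 + ?k * n + 1"
  let ?w = "?xs @ encode_series n (series_of ?G zs)"
  let ?m2 = "m2(hb0 := ?k)"
  define r3 where "r3 = r2(3 := hb, 2 := n * n, 5 := 0, 7 := 0)"
  have p2: "S.path_inv ?xs B zs False (r2, m2)" using e1(3) by (simp add: S.conf_inv_def)
  have v2: "S.view r2 m2 (length zs) (group_of ?G zs)" and b2: "bounded 17 B (r2, m2)"
    and w2: "map m2 [0..<hb0] = ?xs" and r2: "r2 0 = 0" "r2 16 = 0"
    using p2 by (auto simp: S.path_inv_def simp del: upt_Suc)
  have kn: "?k \<le> n" using S.good_length_less[OF k1(2)] by simp
  then have "?k * n \<le> n * n" by (rule mult_le_mono1)
  then have hbn: "n * n + n * n < hb" "hb + n * n \<le> sb0" unfolding hb_def hb0 sb0 by linarith+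
  interpret T: table_search n H "n * n" hb sb0 by (rule table_search.intro) (use H hbn in auto)
  have mid: "sem Q mid_stm (r2, m2) = sem Q trivial_stm (r3, ?m2)"
    using S.viewD(1-5)[OF v2] by (simp add: mid_stm_def r3_def hb_def fun_upd_twist ac_simps)
  have b3: "bounded 17 B (r3, ?m2)"
  proof -
    have "bounded 17 B (r2, ?m2)" using b2 kn B by (simp add: bounded_def)
    then show ?thesis unfolding r3_def using hbn BS by (intro bounded_upd) auto
  qed
  have "T.conf_inv ?w B ([], 1, False, False) (sem Q mid_stm (r2, m2))"
    unfolding mid
  proof (rule T.sem_trivial)
    fix a b assume ab: "a \<in> {1..n}" "b \<in> {1..n}"
    have i: "n * n + (a * n + b - n) < hb0"
      using table_index[OF ab] unfolding hb0 by linarith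
    have "m2 (n * n + (a * n + b - n)) = map m2 [0..<hb0] ! (n * n + (a * n + b - n))"
      using i by (simp del: upt_Suc)
    also have "\<dots> = H a b" unfolding w2 by (rule tH[OF ab])
    finally show "?m2 (n * n + (a * n + b - n)) = H a b" using i by simp
  next
    show "map ?m2 [0..<hb] = ?w" unfolding hb_def by (rule S.series_word[OF p2])
  qed (use S.viewD(1,4)[OF v2] r2 b3 BS in \<open>auto simp: r3_def\<close>)
  then have i2: "T.conf_inv ?w B ([], 1, False, False) (fst (sem Q mid_stm (r2, m2)), snd (sem Q mid_stm (r2, m2)))" by simp
  obtain t2 r4 m4 where e2: "exec Q (compile 17 mid_stm) (r2, m2) t2 (r4, m4)"
    "\<forall>i<17. r4 i = fst (sem Q mid_stm (r2, m2)) i" "m4 = snd (sem Q mid_stm (r2, m2))" "t2 \<le> B ^ ?c2"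
    using compile_exec[OF B2 stm_static(8,7) order_refl refl b2, of Q] by blast
  have c4: "T.conf_inv ?w B ([], 1, False, False) (r4, m4)"
    unfolding e2(3) by (rule T.conf_inv_cong[OF i2]) (use e2(2) in blast)

  let ?P = "\<lambda>ys. Q (?w @ encode_series n (series_of ?H ys))"
  let ?lf2 = "\<lambda>ys f. backtrack ys (f \<or> ?P ys)"
  define f where "f \<longleftrightarrow> (\<exists>ys. good ?H ys \<and> group_of ?H ys = carrier ?H \<and> ?P ys)"
  have "n \<le> card (group_of ?H []) * p ^ j" using j by simp
  from T.explore[OF refl p _ this, of ?P False]
  obtain k3 where k3: "k3 \<le> tree_size n p j"
    "(dfs_step ?H ?lf2 ^^ k3) ([], 1, False, False) = ([], 0, f, True)"
    unfolding f_def by auto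
  have fin2: "finished ((dfs_step ?H ?lf2 ^^ k3) ([], 1, False, False))" unfolding k3(2) by (simp add: finished_def)
  have leaf2: "T.conf_inv ?w B (?lf2 ys f) (sem Q query_stm (r, m))"
    if "T.conf_inv ?w B (ys, x, f, False) (r, m)" "group_of ?H ys = carrier ?H" for ys x f r m
    by (rule T.sem_query[OF that(1) BS])
  have "\<exists>t s'. exec Q (loop_cmd query_stm) (r4, m4) t s' \<and> t \<le> k3 * (B ^ ?c3 + 1) + 1 \<and>
      T.conf_inv ?w B ((dfs_step ?H ?lf2 ^^ k3) ([], 1, False, False)) s'"
    by (rule T.loop_exec[OF BS _ stm_static(3,4) c4 fin2]) (rule leaf2)
  then obtain t3 s3 where s3: "exec Q (loop_cmd query_stm) (r4, m4) t3 s3"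
    "t3 \<le> k3 * (B ^ ?c3 + 1) + 1" "T.conf_inv ?w B ([], 0, f, True) s3"
    unfolding k3(2) by blast
  obtain r5 m5 where "s3 = (r5, m5)" by fastforce
  note e3 = s3[unfolded this]

  have ex: "exec Q program (initial_state ?xs) (t0 + (t1 + (t2 + t3))) (r5, m5)"
    unfolding program_def ini by (rule exec.Seq[OF e0(1) exec.Seq[OF e1(1) exec.Seq[OF e2(1) e3(1)]]])
  have res: "r5 0 = of_bool f" using e3(3) by (simp add: T.conf_inv_def T.path_inv_def)
  have csG: "composition_series ?G (series_of ?G zs)"
    by (rule good_composition_series[OF G S.fin k1(2,3)])
  have query: "?P ys \<longleftrightarrow> series_isomorphic ?G (series_of ?G zs) ?H (series_of ?H ys)"
    if "good ?H ys" "group_of ?H ys = carrier ?H" for ys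
    using Q csG good_composition_series[OF H T.fin that]
    unfolding decides_series_isomorphism_def encode_series_query_def by simp
  have "f \<longleftrightarrow> ?G \<cong> ?H"
  proof
    assume f
    then obtain ys where "series_isomorphic ?G (series_of ?G zs) ?H (series_of ?H ys)"
      unfolding f_def using query by blast
    then show "?G \<cong> ?H" unfolding series_isomorphic_def is_iso_def by blast
  next
    \<comment> \<open>The image of the series of \<open>G\<close> is among the series visited,
      because every composition series of \<open>H\<close> comes from a good list.\<close>
    assume "?G \<cong> ?H"
    then obtain \<phi> where \<phi>: "\<phi> \<in> iso ?G ?H" unfolding is_iso_def by blast
    have "composition_series ?H (map ((`) \<phi>) (series_of ?G zs))"
      by (rule composition_series_iso[OF G H \<phi> csG])
    then obtain ys where ys: "good ?H ys" "series_of ?H ys = map ((`) \<phi>) (series_of ?G zs)"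
      "group_of ?H ys = carrier ?H"
      by (rule composition_series_good[OF H T.fin])
    have "series_isomorphic ?G (series_of ?G zs) ?H (series_of ?H ys)"
      unfolding series_isomorphic_def ys(2) using \<phi> by auto
    then show f unfolding f_def using query[OF ys(1,3)] ys by blast
  qed
  then have dec: "decides_in_time Q program ?xs (?G \<cong> ?H) (t0 + (t1 + (t2 + t3)))"
    unfolding decides_in_time_def using ex res by (intro exI[of _ "(r5, m5)"]) simp

  let ?T = "tree_size n p j"
  define S where "S = B ^ (?c0 + ?c1 + ?c2 + ?c3)"
  have T1: "1 \<le> ?T" by (cases j) auto
  have cS: "B ^ ?c0 \<le> S" "B ^ ?c1 \<le> S" "B ^ ?c2 \<le> S" "B ^ ?c3 \<le> S" "1 \<le> S"
    using B2 by (auto simp: S_def intro!: power_increasing one_le_power)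
  have k1B: "k1 \<le> B"
  proof -
    have "(n - 1) * (n + 1) + n + 1 \<le> n * n + n + 1" by (cases n) auto
    then show ?thesis using k1(1) B by simp
  qed
  have "t1 \<le> 2 * (S * B) + S"
    using e1(2) mult_le_mono[OF k1B, of "B ^ ?c1 + 1" "2 * S"] cS by (simp add: ac_simps)
  moreover have "t3 \<le> 2 * (S * ?T) + S"
    using e3(2) mult_le_mono[OF k3(1), of "B ^ ?c3 + 1" "2 * S"] cS by (simp add: ac_simps)
  moreover have "S * 1 \<le> S * (B * ?T)" "S * B \<le> S * (B * ?T)" "S * ?T \<le> S * (B * ?T)"
    using T1 B2 by simp_all
  \<comment> \<open>The factor \<open>B\<close> pays for the search in \<open>G\<close>; together
    with 8 being at most \<open>B ^ 3\<close> it accounts for the 4 in the exponent.\<close>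
  ultimately have "t0 + (t1 + (t2 + t3)) \<le> 8 * (S * (B * ?T))"
    using cS(1,3) e0(4) e2(4) unfolding mult_1_right by linarith
  also have "\<dots> \<le> B ^ 3 * (S * (B * ?T))"
    using power_mono[OF B2, of 3] by (intro mult_right_mono) auto
  also have "\<dots> = B ^ (?c0 + ?c1 + ?c2 + ?c3 + 4) * ?T"
    by (simp add: S_def power_add power_numeral_reduce ac_simps)
  finally show ?thesis using dec by blast
qed

theorem theorem1p2:
  shows "\<exists>(P :: cmd) (c :: real). \<forall>(n :: nat) (G :: nat \<Rightarrow> nat \<Rightarrow> nat) (H :: nat \<Rightarrow> nat \<Rightarrow> nat) (Q :: nat list \<Rightarrow> bool).
    group (table_group n G) \<longrightarrow> group (table_group n H) \<longrightarrow> decides_series_isomorphism Q n G H \<longrightarrow>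
    (\<exists>t :: nat.
       decides_in_time Q P (encode_groups n G H) (table_group n G \<cong> table_group n H) t \<and>
       (n > 1 \<longrightarrow>
         real t \<le> real n powr (1 / 2 * log (real (smallest_prime_divisor n)) (real n) + c)))"
proof -
  define E where "E = stm_cost init_stm + stm_cost (step_stm (Assign 7 (N 1))) + stm_cost mid_stm + stm_cost (step_stm query_stm) + 4"
  show ?thesis
  \<comment> \<open>Neither \<open>program\<close> nor \<open>E\<close> depends on the input. The
    term \<open>5 * E\<close> comes from bounding \<open>?B\<close> by \<open>n ^ 5\<close>, the 7
    from \<open>tree_size_bound\<close>.\<close>
  proof (rule exI[of _ program], rule exI[of _ "real (5 * E + 7)"], intro allI impI)
    fix n G H Q
    assume G: "group (table_group n G)" and H: "group (table_group n H)" and Q: "decides_series_isomorphism Q n G H"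
    interpret G: group "table_group n G" by (rule G)
    have n: "1 \<le> n" using G.one_closed by (auto simp: table_group_def)
    let ?B = "4 * (n * n) + n + 5"
    show "\<exists>t. decides_in_time Q program (encode_groups n G H) (table_group n G \<cong> table_group n H) t \<and>
       (n > 1 \<longrightarrow> real t \<le> real n powr (1 / 2 * log (real (smallest_prime_divisor n)) (real n) + real (5 * E + 7)))"
    proof (cases "n = 1")
      case True
      \<comment> \<open>The number 1 has no prime divisor, so 2 takes the place of \<open>p\<close>,
        with height 0; for this order only the answer matters.\<close>
      have "2 \<le> q" if "Factorial_Ring.prime q" for q :: nat using that by (rule prime_ge_2_nat)
      moreover have "n \<le> 2 ^ 0" using True by simp
      ultimately show ?thesis using program_decides[OF G H Q _ _ refl, of 2 0] True by auto
    next
      case False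
      define p where "p = smallest_prime_divisor n"
      have "\<exists>q. Factorial_Ring.prime q \<and> q dvd n" using False prime_factor_nat by blast
      from LeastI_ex[OF this] have p: "Factorial_Ring.prime p" "p dvd n"
        unfolding p_def smallest_prime_divisor_def by blast+
      have least: "p \<le> q" if "Factorial_Ring.prime q" "q dvd n" for q
        unfolding p_def smallest_prime_divisor_def using that by (intro Least_le conjI)
      have p2: "2 \<le> p" "p \<le> n" using p n by (auto simp: prime_ge_2_nat dvd_imp_le)
      obtain j where j: "n \<le> p ^ j" "real (tree_size n p j) \<le> real n powr (1 / 2 * log (real p) (real n) + 7)"
        using tree_size_bound[OF p2] by blast
      obtain t where t: "decides_in_time Q program (encode_groups n G H) (table_group n G \<cong> table_group n H) t"
        "t \<le> ?B ^ E * tree_size n p j"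
        using program_decides[OF G H Q least j(1) refl] unfolding E_def by blast
      have "?B \<le> n ^ 5"
      proof -
        have n2: "2 \<le> n" using n False by simp
        have nn: "2 * n \<le> n * n" using n2 by (rule mult_le_mono1)
        then have "?B \<le> 8 * (n * n)" using n2 by linarith
        also have "\<dots> \<le> n ^ 3 * (n * n)" using power_mono[OF n2, of 3] by (intro mult_right_mono) auto
        also have "\<dots> = n ^ 5" by (simp add: numeral_eq_Suc)
        finally show ?thesis .
      qed
      then have "?B ^ E \<le> n ^ (5 * E)" using power_mono[of ?B "n ^ 5" E] by (simp add: power_mult)
      then have "t \<le> n ^ (5 * E) * tree_size n p j" using t(2) mult_le_mono1 order_trans by blast
      then have "real t \<le> real n ^ (5 * E) * real (tree_size n p j)"
        by (simp flip: of_nat_power of_nat_mult)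
      also have "real n ^ (5 * E) = real n powr real (5 * E)"
        by (subst powr_realpow) (use n in auto)
      also have "real n powr real (5 * E) * real (tree_size n p j) \<le>
          real n powr real (5 * E) * real n powr (1 / 2 * log (real p) (real n) + 7)"
        using j(2) by (intro mult_left_mono) auto
      also have "\<dots> = real n powr (1 / 2 * log (real p) (real n) + real (5 * E + 7))"
        by (simp add: powr_add[symmetric] ac_simps)
      finally show ?thesis using t(1) unfolding p_def by blast
    qed
  qed
qed

end
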